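(* Let $k=\mathbb{F}_q$ be a finite field and let $A$ be a finite simple $k$-algebra. Then $P(A)\ge 3/8$, with equality if and only if $A=M_2(\mathbb{F}_2)$ (up to isomorphism; here necessarily $k=\mathbb{F}_2$).
   Context: A finite simple algebra over $k=\mathbb{F}_q$ is an associative, unital, finite-dimensional simple $k$-algebra (so isomorphic to $M_n(\mathbb{F}_{q^m})$ for some $n,m\ge1$, viewed as a $k$-algebra). Subalgebras contain the identity. $P(A)$ is the probability that two elements of $A$, chosen uniformly and independently at random, generate $A$ as a unital $k$-algebra: $P(A)=|\{(x,y)\in A\times A:\langle x,y\rangle=A\}|/|A|^2$. *)

theory Defs
  imports "HOL-Analysis.Analysis"
begin

text \<open>
  The class \<open>ring_1\<close> makes \<open>'a\<close> an associative, unital, not necessarily commutative ring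
  with \<open>0 \<noteq> 1\<close>; in particular the zero ring is excluded.
\<close>

locale assoc_algebra = vector_space scale
  for scale :: "'k::field \<Rightarrow> 'a::ring_1 \<Rightarrow> 'a" +
  assumes scale_mult_left: "scale c x * y = scale c (x * y)"
    and scale_mult_right: "x * scale c y = scale c (x * y)"
begin

definition subalgebra :: "'a set \<Rightarrow> bool" where
  "subalgebra S \<longleftrightarrow> subspace S \<and> 1 \<in> S \<and> (\<forall>x\<in>S. \<forall>y\<in>S. x * y \<in> S)"

definition generated_subalgebra :: "'a set \<Rightarrow> 'a set" where
  "generated_subalgebra X = subalgebra hull X"

text \<open>Meaningful when \<open>'a\<close> is finite.\<close>

definition generation_probability :: real where
  "generation_probability =
     real (card {(x, y). generated_subalgebra {x, y} = UNIV}) / real CARD('a) ^ 2"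

text \<open>Closure under negation and under scalars follows from \<open>- x = (- 1) * x\<close> and
  \<open>scale c x = scale c 1 * x\<close>.\<close>

definition two_sided_ideal :: "'a set \<Rightarrow> bool" where
  "two_sided_ideal I \<longleftrightarrow> 0 \<in> I \<and> (\<forall>x\<in>I. \<forall>y\<in>I. x + y \<in> I) \<and>
     (\<forall>a. \<forall>x\<in>I. a * x \<in> I \<and> x * a \<in> I)"

text \<open>The product on \<open>'k ^ 'n ^ 'n\<close> is \<open>**\<close>; the operation \<open>*\<close> on that type is entrywise.
  Hence the matrix algebra is not an instance of \<open>assoc_algebra\<close> and its operations are
  spelled out.\<close>

definition isomorphic_to_matrix_algebra :: "'n::finite itself \<Rightarrow> bool" where
  "isomorphic_to_matrix_algebra _ \<longleftrightarrow>
     (\<exists>f :: 'a \<Rightarrow> 'k ^ 'n ^ 'n. bij f \<and>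
        Vector_Spaces.linear scale (\<lambda>c M. \<chi> i j. c * M $ i $ j) f \<and>
        f 1 = mat 1 \<and> (\<forall>x y. f (x * y) = f x ** f y))"

end

locale finite_simple_algebra = assoc_algebra scale
  for scale :: "'k::{field, finite} \<Rightarrow> 'a::ring_1 \<Rightarrow> 'a" +
  assumes finite_dimensional: "\<exists>B. finite B \<and> span B = UNIV"
    and simple: "two_sided_ideal I \<Longrightarrow> I = {0} \<or> I = UNIV"

end

theory Submission
  imports Defs "HOL-Computational_Algebra.Polynomial" "HOL-Algebra.Multiplicative_Group"
begin

text \<open>
  Let \<open>A\<close> be a finite simple ring with centre \<open>Z\<close> of order \<open>Q\<close>, acting on a minimal left ideal
  \<open>V\<close> of dimension \<open>n\<close> over \<open>Z\<close>, so that \<open>A\<close> consists of all \<open>Z\<close>-linear maps of \<open>V\<close>.  A proper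
  subring \<open>B\<close> leaves a proper non-zero subspace of \<open>V\<close> invariant, or commutes with a field
  properly containing \<open>Z\<close>, or leaves invariant an \<open>F\<close>-form of \<open>V\<close> for a proper subfield \<open>F\<close> of \<open>Z\<close>:
  if \<open>V\<close> is irreducible then the centralizer of \<open>B\<close> is a field by Schur and Wedderburn, and if
  this field is \<open>Z\<close> then \<open>B\<close> is simple and a minimal left ideal of \<open>B\<close> provides the form.  Hence
  a pair that does not generate lies in one of explicitly counted families of products
  \<open>M \<times> M\<close>, and the union bound shows that such pairs have density less than \<open>5/8\<close>, except
  when \<open>Q = 2\<close> and \<open>n\<close> is \<open>2\<close> or \<open>3\<close>.  For \<open>n = 3\<close> the overlaps between the stabilizers of
  points and of planes have to be taken into account; for \<open>n = 2\<close> exactly \<open>160\<close> of the \<open>256\<close>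
  pairs do not generate.
\<close>

section \<open>Finite vector spaces over division subrings\<close>

text \<open>The theorem speaks of \<open>k\<close>-subalgebras, but the count is for subrings. A
  proper subalgebra is a proper subring, so the density of pairs lying in a common proper subring
  bounds the probability of failure from above, wherever \<open>k\<close> sits inside the centre;
  the price is the family of forms over proper subfields. Equality is at stake only for
  \<open>Q = 2\<close>: then the centre is {0, 1}, scalars act as 0 or 1, and the two notions agree.
  A family of N subrings, each of index m, has density at most N / m^2, and the squared index
  normally outweighs N. It does not in the two exceptional cases: for \<open>Q = 2\<close> the 3
  lines of a plane already contribute 3/4, and the 7 points and 7 planes in dimension 3 contribute
  7/8. The constant 5/8 is the exact value 160/256 of the first of these cases. Division rings,
  modules and forms are all subsets of one ring type, with scalars acting by left multiplication.
  This allows the base field to change freely between the centre, its extensions and its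
  subfields.\<close>

definition div_subring :: "'a::ring_1 \<Rightarrow> 'a set \<Rightarrow> bool" where
  "div_subring e F \<longleftrightarrow> e \<in> F \<and> e \<noteq> 0 \<and> (\<forall>x\<in>F. \<forall>y\<in>F. x - y \<in> F \<and> x * y \<in> F) \<and>
     (\<forall>x\<in>F. e * x = x \<and> x * e = x) \<and> (\<forall>x\<in>F. x \<noteq> 0 \<longrightarrow> (\<exists>y\<in>F. y * x = e))"

text \<open>Lists instead of sets, since the counts below are counts of ordered bases; in the
  recursion each new head contributes one factor.\<close>

fun lspan :: "'a::ring_1 set \<Rightarrow> 'a list \<Rightarrow> 'a set" where
  "lspan F [] = {0}"
| "lspan F (v # vs) = {c * v + s | c s. c \<in> F \<and> s \<in> lspan F vs}"

fun lindep :: "'a::ring_1 set \<Rightarrow> 'a list \<Rightarrow> bool" where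
  "lindep F [] \<longleftrightarrow> True"
| "lindep F (v # vs) \<longleftrightarrow> v \<notin> lspan F vs \<and> lindep F vs"

text \<open>The identity is the parameter \<open>e\<close> and not 1, because Wedderburn's theorem
  is applied to a corner ring \<open>e R e\<close>, whose identity is the idempotent
  \<open>e\<close>.\<close>

definition lsubspace :: "'a::ring_1 \<Rightarrow> 'a set \<Rightarrow> 'a set \<Rightarrow> bool" where
  "lsubspace e F V \<longleftrightarrow> 0 \<in> V \<and> (\<forall>v\<in>V. \<forall>w\<in>V. v - w \<in> V) \<and>
     (\<forall>c\<in>F. \<forall>v\<in>V. c * v \<in> V) \<and> (\<forall>v\<in>V. e * v = v)"

lemma div_subringD:
  assumes "div_subring e F"
  shows "e \<in> F" "e \<noteq> 0" "0 \<in> F"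
    "\<And>x y. x \<in> F \<Longrightarrow> y \<in> F \<Longrightarrow> x - y \<in> F"
    "\<And>x y. x \<in> F \<Longrightarrow> y \<in> F \<Longrightarrow> x + y \<in> F"
    "\<And>x. x \<in> F \<Longrightarrow> - x \<in> F"
    "\<And>x y. x \<in> F \<Longrightarrow> y \<in> F \<Longrightarrow> x * y \<in> F"
    "\<And>x. x \<in> F \<Longrightarrow> e * x = x" "\<And>x. x \<in> F \<Longrightarrow> x * e = x"
proof -
  note d = assms[unfolded div_subring_def]
  show e: "e \<in> F" "e \<noteq> 0" using d by auto
  have "e - e \<in> F" using d e by blast
  then show 0: "0 \<in> F" by simp
  show m: "\<And>x y. x \<in> F \<Longrightarrow> y \<in> F \<Longrightarrow> x - y \<in> F" using d by blast
  show u: "- x \<in> F" if "x \<in> F" for x using m[OF 0 that] by simp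
  show "x + y \<in> F" if "x \<in> F" "y \<in> F" for x y using m[OF that(1) u[OF that(2)]] by simp
qed (use assms[unfolded div_subring_def] in auto)

text \<open>Only left inverses are postulated. The left inverse \<open>y\<close> of \<open>x\<close>
  has a left inverse \<open>z\<close> of its own, and \<open>z = z * y * x = x\<close>, so inverses
  are two-sided.\<close>

lemma div_subring_inv:
  assumes "div_subring e F" "x \<in> F" "x \<noteq> 0"
  obtains y where "y \<in> F" "y \<noteq> 0" "y * x = e" "x * y = e"
proof -
  note d = assms(1)[unfolded div_subring_def]
  obtain y where y: "y \<in> F" "y * x = e" using d assms by blast
  have "y \<noteq> 0" using y d by auto
  then obtain z where z: "z \<in> F" "z * y = e" using d y by blast
  have "z = z * (y * x)" using d y z by simp
  also have "\<dots> = x" using z d assms by (simp flip: mult.assoc)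
  finally show ?thesis using that y z \<open>y \<noteq> 0\<close> by blast
qed

lemma div_subring_no_zero_divisors:
  assumes "div_subring e F" "x \<in> F" "y \<in> F" "x * y = 0"
  shows "x = 0 \<or> y = 0"
proof (rule ccontr)
  assume n: "\<not> ?thesis"
  then obtain z where "z \<in> F" "z * x = e" using div_subring_inv[OF assms(1,2)] by metis
  then have "y = z * (x * y)" using div_subringD(8)[OF assms(1,3)] by (simp flip: mult.assoc)
  then show False using assms n by simp
qed

lemma lsubspaceD:
  assumes "lsubspace e F V"
  shows "0 \<in> V" "\<And>v w. v \<in> V \<Longrightarrow> w \<in> V \<Longrightarrow> v - w \<in> V" "\<And>v w. v \<in> V \<Longrightarrow> w \<in> V \<Longrightarrow> v + w \<in> V"
    "\<And>c v. c \<in> F \<Longrightarrow> v \<in> V \<Longrightarrow> c * v \<in> V" "\<And>v. v \<in> V \<Longrightarrow> e * v = v"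
proof -
  note d = assms[unfolded lsubspace_def]
  show 0: "0 \<in> V" "\<And>v w. v \<in> V \<Longrightarrow> w \<in> V \<Longrightarrow> v - w \<in> V" using d by auto
  show "v + w \<in> V" if "v \<in> V" "w \<in> V" for v w
    using 0(2)[OF that(1) 0(2)[OF 0(1) that(2)]] by simp
qed (use assms[unfolded lsubspace_def] in auto)

lemma lspan_subset:
  assumes "lsubspace e F V" "set vs \<subseteq> V"
  shows "lspan F vs \<subseteq> V"
  using assms(2)
proof (induction vs)
  case Nil then show ?case using lsubspaceD[OF assms(1)] by simp
next
  case (Cons v vs)
  then show ?case using lsubspaceD[OF assms(1)] by (auto simp: subset_iff)
qed

lemma zero_in_lspan: "0 \<in> F \<Longrightarrow> 0 \<in> lspan F vs"
  by (induction vs) force+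

lemma lspan_ConsI: "c \<in> F \<Longrightarrow> s \<in> lspan F vs \<Longrightarrow> c * v + s \<in> lspan F (v # vs)"
  by auto

lemma finite_lspan: "finite F \<Longrightarrow> finite (lspan F vs)"
proof (induction vs)
  case (Cons v vs)
  have "lspan F (v # vs) = (\<lambda>(c, s). c * v + s) ` (F \<times> lspan F vs)" by auto
  then show ?case using Cons by simp
qed simp

locale finite_lspace =
  fixes e :: "'a::ring_1" and F V :: "'a set"
  assumes F: "div_subring e F" and V: "lsubspace e F V" and finF: "finite F" and finV: "finite V"
begin

lemmas FD = div_subringD[OF F]
lemmas VD = lsubspaceD[OF V]

lemma card_F: "2 \<le> card F"
  using card_mono[OF finF, of "{0, e}"] FD(1-3) by auto

lemma lsubspace_lspan: "set vs \<subseteq> V \<Longrightarrow> lsubspace e F (lspan F vs)"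
proof (induction vs)
  case Nil then show ?case by (simp add: lsubspace_def)
next
  case (Cons v vs)
  then have IH: "lsubspace e F (lspan F vs)" and v: "v \<in> V" by auto
  note I = lsubspaceD[OF IH]
  have "c * v + s - (d * v + t) \<in> lspan F (v # vs)"
    if "c \<in> F" "d \<in> F" "s \<in> lspan F vs" "t \<in> lspan F vs" for c d s t
  proof -
    have "c * v + s - (d * v + t) = (c - d) * v + (s - t)" by (simp add: algebra_simps)
    then show ?thesis using that FD(4) I(2) lspan_ConsI by metis
  qed
  moreover have "d * (c * v + s) \<in> lspan F (v # vs)"
    if "c \<in> F" "d \<in> F" "s \<in> lspan F vs" for c d s
  proof -
    have "d * (c * v + s) = (d * c) * v + d * s" by (simp add: algebra_simps)
    then show ?thesis using that FD(7) I(4) lspan_ConsI by metis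
  qed
  moreover have "e * x = x" if "x \<in> lspan F (v # vs)" for x
    using that lspan_subset[OF V Cons.prems] VD(5) by auto
  moreover have "0 \<in> lspan F (v # vs)" using zero_in_lspan FD(3) by blast
  ultimately show ?case unfolding lsubspace_def by fastforce
qed

lemma set_subset_lspan: "set vs \<subseteq> V \<Longrightarrow> set vs \<subseteq> lspan F vs"
proof (induction vs)
  case (Cons v vs)
  have "v = e * v + 0" using Cons VD(5) by simp
  then have "v \<in> lspan F (v # vs)" using lspan_ConsI[OF FD(1) zero_in_lspan[OF FD(3)]] by metis
  moreover have "lspan F vs \<subseteq> lspan F (v # vs)" using FD(3) by force
  ultimately show ?case using Cons by auto
qed simp

lemma lspan_Cons_unique:
  assumes "set vs \<subseteq> V" "v \<in> V" "v \<notin> lspan F vs" "c \<in> F" "d \<in> F" "s \<in> lspan F vs" "t \<in> lspan F vs"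
    "c * v + s = d * v + t"
  shows "c = d \<and> s = t"
proof -
  note I = lsubspaceD[OF lsubspace_lspan[OF assms(1)]]
  have eq: "(c - d) * v = t - s" using assms(8) by (simp add: algebra_simps)
  have "c - d = 0"
  proof (rule ccontr)
    assume "c - d \<noteq> 0"
    then obtain y where y: "y \<in> F" "y * (c - d) = e"
      using div_subring_inv[OF F FD(4)[OF assms(4,5)]] by metis
    have "v = y * ((c - d) * v)" using y VD(5)[OF assms(2)] by (simp flip: mult.assoc)
    then show False using eq I y assms by metis
  qed
  then show ?thesis using assms(8) by auto
qed

lemma lspan_Cons_eq:
  assumes "set vs \<subseteq> V" "v \<in> lspan F vs"
  shows "lspan F (v # vs) = lspan F vs"
proof -
  note I = lsubspaceD[OF lsubspace_lspan[OF assms(1)]]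
  have "lspan F vs \<subseteq> lspan F (v # vs)" using FD(3) by force
  then show ?thesis using I assms by auto
qed

lemma card_lspan_Cons:
  assumes "set vs \<subseteq> V" "v \<in> V" "v \<notin> lspan F vs"
  shows "card (lspan F (v # vs)) = card F * card (lspan F vs)"
proof -
  have "lspan F (v # vs) = (\<lambda>(c, s). c * v + s) ` (F \<times> lspan F vs)" by auto
  moreover have "inj_on (\<lambda>(c, s). c * v + s) (F \<times> lspan F vs)"
    using lspan_Cons_unique[OF assms] by (intro inj_onI) auto
  ultimately show ?thesis by (simp add: card_image card_cartesian_product)
qed

lemma card_lspan: "set vs \<subseteq> V \<Longrightarrow> lindep F vs \<Longrightarrow> card (lspan F vs) = card F ^ length vs"
  by (induction vs) (simp_all add: card_lspan_Cons del: lspan.simps(2))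

lemma card_lspan_le: "set vs \<subseteq> V \<Longrightarrow> card (lspan F vs) \<le> card F ^ length vs"
proof (induction vs)
  case (Cons v vs)
  have "card F > 0" using card_F by simp
  then have "card (lspan F vs) \<le> card F * card (lspan F vs)" by simp
  then have "card (lspan F (v # vs)) \<le> card F * card (lspan F vs)"
    using Cons.prems card_lspan_Cons[of vs v] lspan_Cons_eq[of vs v]
    by (cases "v \<in> lspan F vs") (auto simp del: lspan.simps)
  also have "\<dots> \<le> card F * card F ^ length vs" using Cons by (intro mult_left_mono) auto
  finally show ?case by simp
qed simp

text \<open>A head inside the span of its tail does not enlarge the span, which then falls short of
  the maximum by a factor \<open>card F\<close>.\<close>

lemma lindepI_card: "set vs \<subseteq> V \<Longrightarrow> card (lspan F vs) = card F ^ length vs \<Longrightarrow> lindep F vs"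
proof (induction vs)
  case (Cons v vs)
  have v: "v \<notin> lspan F vs"
  proof
    assume "v \<in> lspan F vs"
    then have "card F ^ Suc (length vs) \<le> card F ^ length vs"
      using Cons lspan_Cons_eq[of vs v] card_lspan_le[of vs] by (simp del: lspan.simps)
    then show False using card_F by simp
  qed
  then have "card (lspan F vs) = card F ^ length vs"
    using Cons.prems card_lspan_Cons[of vs v] card_F by (simp del: lspan.simps)
  then show ?case using v Cons by simp
qed simp

lemma length_le_if_lindep:
  assumes "set vs \<subseteq> V" "lindep F vs"
  shows "card F ^ length vs \<le> card V"
  using card_lspan[OF assms] card_mono[OF finV lspan_subset[OF V assms(1)]] by simp

text \<open>New vectors go in front: \<open>lindep\<close> tests a head against its tail, so the
  given list stays intact as the tail.\<close>

lemma lindep_extend: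
  assumes "set vs \<subseteq> V" "lindep F vs"
  obtains us where "set us \<subseteq> V" "lindep F (us @ vs)" "lspan F (us @ vs) = V"
proof -
  have "\<exists>us. set us \<subseteq> V \<and> lindep F (us @ vs) \<and> lspan F (us @ vs) = V" using assms
  proof (induction "card V - card (lspan F vs)" arbitrary: vs rule: less_induct)
    case less
    have sub: "lspan F vs \<subseteq> V" using lspan_subset[OF V less.prems(1)] .
    show ?case
    proof (cases "lspan F vs = V")
      case True
      then show ?thesis using less.prems by (intro exI[of _ "[]"]) simp
    next
      case False
      then obtain v where v: "v \<in> V" "v \<notin> lspan F vs" using sub by blast
      have s2: "set (v # vs) \<subseteq> V" "lindep F (v # vs)" using v less.prems by auto
      have "card (lspan F vs) > 0" using finite_lspan[OF finF] zero_in_lspan[OF FD(3)]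
        by (metis card_gt_0_iff empty_iff)
      then have "card (lspan F vs) < card (lspan F (v # vs))"
        using card_lspan_Cons[OF less.prems(1) v] card_F by simp
      moreover have "card (lspan F (v # vs)) \<le> card V"
        by (rule card_mono[OF finV lspan_subset[OF V s2(1)]])
      ultimately obtain us where us: "set us \<subseteq> V" "lindep F (us @ v # vs)" "lspan F (us @ v # vs) = V"
        using less.hyps[OF _ s2] by (meson diff_less_mono2 le_trans less_le_not_le not_le)
      then show ?thesis using v by (intro exI[of _ "us @ [v]"]) simp
    qed
  qed
  then show ?thesis using that by blast
qed

lemma ex_basis:
  obtains vs where "set vs \<subseteq> V" "lindep F vs" "lspan F vs = V" "card V = card F ^ length vs"
proof -
  obtain vs where "set vs \<subseteq> V" "lindep F (vs @ [])" "lspan F (vs @ []) = V"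
    using lindep_extend[of "[]"] by auto
  then show ?thesis using that[of vs] card_lspan[of vs] by simp
qed

lemma basis_if_length:
  assumes "set vs \<subseteq> V" "lindep F vs" "card V = card F ^ length vs"
  shows "lspan F vs = V"
  using card_lspan[OF assms(1,2)] assms(3) lspan_subset[OF V assms(1)] finV
  by (simp add: card_subset_eq)

lemma finite_lists_V: "finite {vs. length vs = r \<and> set vs \<subseteq> V}"
  using finite_lists_length_eq[OF finV, of r] by (simp add: conj_commute)

lemma card_lindep_lists:
  "card {vs. length vs = r \<and> set vs \<subseteq> V \<and> lindep F vs} = (\<Prod>i<r. card V - card F ^ i)"
proof (induction r)
  case 0
  have "{vs. length vs = 0 \<and> set vs \<subseteq> V \<and> lindep F vs} = {[]}" by auto
  then show ?case by simp
next
  case (Suc r)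
  let ?S = "{vs. length vs = r \<and> set vs \<subseteq> V \<and> lindep F vs}"
  have finS: "finite ?S" by (rule finite_subset[OF _ finite_lists_V[of r]]) auto
  have "{vs. length vs = Suc r \<and> set vs \<subseteq> V \<and> lindep F vs} =
      (\<lambda>(vs, v). v # vs) ` (SIGMA vs:?S. V - lspan F vs)"
    by (auto simp: length_Suc_conv image_iff)
  moreover have "inj_on (\<lambda>(vs, v). v # vs) (SIGMA vs:?S. V - lspan F vs)" by (auto intro!: inj_onI)
  ultimately have "card {vs. length vs = Suc r \<and> set vs \<subseteq> V \<and> lindep F vs} =
      (\<Sum>vs\<in>?S. card (V - lspan F vs))"
    using finS finV by (simp add: card_image card_SigmaI)
  also have "\<dots> = (\<Sum>vs\<in>?S. card V - card F ^ r)"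
    by (rule sum.cong[OF refl])
      (auto simp: card_Diff_subset finite_lspan finF lspan_subset[OF V] card_lspan)
  also have "\<dots> = (\<Prod>i<Suc r. card V - card F ^ i)" using Suc by simp
  finally show ?case .
qed

lemma ex_linear_map:
  assumes "set vs \<subseteq> V" "lindep F vs" "lsubspace e F W" "set ws \<subseteq> W" "length ws = length vs"
  shows "\<exists>T. (\<forall>x\<in>lspan F vs. \<forall>y\<in>lspan F vs. T (x + y) = T x + T y) \<and>
    (\<forall>c\<in>F. \<forall>x\<in>lspan F vs. T (c * x) = c * T x) \<and> (\<forall>x\<in>lspan F vs. T x \<in> W) \<and> map T vs = ws"
  using assms(1,2,4,5)
proof (induction vs arbitrary: ws)
  case Nil
  then show ?case using lsubspaceD[OF assms(3)] by (intro exI[of _ "\<lambda>_. 0"]) auto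
next
  case (Cons v vs)
  note W = lsubspaceD[OF assms(3)]
  obtain w ws' where ws: "ws = w # ws'" "length ws' = length vs" using Cons.prems(4) by (cases ws) auto
  have p: "set vs \<subseteq> V" "v \<in> V" "v \<notin> lspan F vs" "lindep F vs" "w \<in> W" "set ws' \<subseteq> W"
    using Cons.prems ws by auto
  note I = lsubspaceD[OF lsubspace_lspan[OF p(1)]]
  obtain T where T: "\<And>x y. x\<in>lspan F vs \<Longrightarrow> y\<in>lspan F vs \<Longrightarrow> T (x + y) = T x + T y"
    "\<And>c x. c\<in>F \<Longrightarrow> x\<in>lspan F vs \<Longrightarrow> T (c * x) = c * T x"
    "\<And>x. x\<in>lspan F vs \<Longrightarrow> T x \<in> W" "map T vs = ws'"
    using Cons.IH[OF p(1,4,6) ws(2)] by blast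
  \<comment> \<open>\<open>P\<close> relates a vector to its coefficient at \<open>v\<close> and its
    remainder. The pair is unique on the span, so the choice below is forced there; off the span the
    value of \<open>T'\<close> is arbitrary.\<close>
  define P where "P x cs \<longleftrightarrow> fst cs \<in> F \<and> snd cs \<in> lspan F vs \<and> x = fst cs * v + snd cs" for x cs
  define T' where "T' x = (let cs = SOME cs. P x cs in fst cs * w + T (snd cs))" for x
  have T': "T' (c * v + s) = c * w + T s" if "c \<in> F" "s \<in> lspan F vs" for c s
  proof -
    have "(SOME cs. P (c * v + s) cs) = (c, s)"
    proof (rule some_equality)
      show "P (c * v + s) (c, s)" using that by (simp add: P_def)
      show "cs = (c, s)" if "P (c * v + s) cs" for cs
        using that lspan_Cons_unique[OF p(1-3), of c "fst cs" s "snd cs"] \<open>c \<in> F\<close> \<open>s \<in> lspan F vs\<close>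
        by (auto simp: P_def prod_eq_iff)
    qed
    then show ?thesis by (simp add: T'_def)
  qed
  have "T' (x + y) = T' x + T' y" if xy: "x \<in> lspan F (v # vs)" "y \<in> lspan F (v # vs)" for x y
  proof -
    obtain c s d t where cd: "x = c * v + s" "y = d * v + t" "c \<in> F" "d \<in> F"
        "s \<in> lspan F vs" "t \<in> lspan F vs"
      using xy by auto
    have xy': "x + y = (c + d) * v + (s + t)" unfolding cd by (simp add: algebra_simps)
    have "T' (x + y) = (c + d) * w + (T s + T t)"
      unfolding xy' using T'[OF FD(5)[OF cd(3,4)] I(3)[OF cd(5,6)]] T(1)[OF cd(5,6)] by simp
    then show ?thesis using T' cd by (simp add: algebra_simps)
  qed
  moreover have "T' (d * x) = d * T' x" if x: "x \<in> lspan F (v # vs)" and "d \<in> F" for x d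
  proof -
    obtain c s where cs: "x = c * v + s" "c \<in> F" "s \<in> lspan F vs"
      using x by auto
    have dx: "d * x = (d * c) * v + d * s" unfolding cs by (simp add: algebra_simps)
    have "T' (d * x) = (d * c) * w + d * T s"
      unfolding dx
      using T'[OF FD(7)[OF \<open>d \<in> F\<close> cs(2)] I(4)[OF \<open>d \<in> F\<close> cs(3)]] T(2)[OF \<open>d \<in> F\<close> cs(3)] by simp
    then show ?thesis using T' cs by (simp add: algebra_simps)
  qed
  moreover have "T' x \<in> W" if "x \<in> lspan F (v # vs)" for x
    using that T' T(3) W p(5) by auto
  moreover have "T' v = w"
  proof -
    have "T 0 = 0" using T(1)[of 0 0] I(1) by simp
    then show ?thesis using T'[of e 0] FD(1) I(1) VD(5) W(5) p by simp
  qed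
  moreover have "T' x = T x" if "x \<in> lspan F vs" for x
    using T'[of 0 x] that FD(3) by simp
  then have "map T' vs = ws'" using T(4) set_subset_lspan[OF p(1)] by (auto intro!: map_cong)
  ultimately show ?case using ws by (intro exI[of _ T']) auto
qed

lemma ex_endomorphism:
  assumes "set vs \<subseteq> V" "lindep F vs" "lspan F vs = V" "set ws \<subseteq> V" "length ws = length vs"
  obtains T where "\<And>x y. x \<in> V \<Longrightarrow> y \<in> V \<Longrightarrow> T (x + y) = T x + T y"
    "\<And>c x. c \<in> F \<Longrightarrow> x \<in> V \<Longrightarrow> T (c * x) = c * T x" "\<And>x. x \<in> V \<Longrightarrow> T x \<in> V" "map T vs = ws"
proof -
  obtain T where "\<forall>x\<in>V. \<forall>y\<in>V. T (x + y) = T x + T y"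
    "\<forall>c\<in>F. \<forall>x\<in>V. T (c * x) = c * T x" "\<forall>x\<in>V. T x \<in> V" "map T vs = ws"
    using ex_linear_map[OF assms(1,2) V assms(4,5)] unfolding assms(3) by (elim exE conjE)
  then show ?thesis using that[of T] by blast
qed

end

lemma finite_lspace_subspace:
  assumes "finite_lspace e F V" "lsubspace e F W" "W \<subseteq> V"
  shows "finite_lspace e F W"
  using assms by (auto simp: finite_lspace_def intro: finite_subset)

section \<open>Wedderburn's little theorem\<close>

definition primitive_roots :: "nat \<Rightarrow> complex set" where
  "primitive_roots n = {z. z ^ n = 1 \<and> (\<forall>m. 0 < m \<and> m < n \<longrightarrow> z ^ m \<noteq> 1)}"

definition cyclotomic :: "nat \<Rightarrow> complex poly" where
  "cyclotomic n = (\<Prod>z\<in>primitive_roots n. [:-z, 1:])"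

lemma finite_primitive_roots: "n > 0 \<Longrightarrow> finite (primitive_roots n)"
  unfolding primitive_roots_def by (rule finite_subset[OF _ finite_roots_unity[of n]]) auto

text \<open>Roots of unity are sorted by exact order; division with remainder shows that the order
  divides \<open>n\<close>.\<close>

lemma roots_unity_eq_Union:
  assumes "n > 0"
  shows "{z::complex. z ^ n = 1} = (\<Union>d\<in>{d. d dvd n}. primitive_roots d)"
proof (intro equalityI subsetI)
  fix z :: complex assume "z \<in> {z. z ^ n = 1}"
  then have z: "z ^ n = 1" by simp
  define d where "d = (LEAST m. 0 < m \<and> z ^ m = 1)"
  have d: "0 < d" "z ^ d = 1" using LeastI[of "\<lambda>m. 0 < m \<and> z ^ m = 1" n] z assms by (auto simp: d_def)
  have least: "z ^ m \<noteq> 1" if "0 < m" "m < d" for m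
    using not_less_Least[of m "\<lambda>m. 0 < m \<and> z ^ m = 1"] that by (auto simp: d_def)
  have "z ^ n = (z ^ d) ^ (n div d) * z ^ (n mod d)"
    by (metis div_mult_mod_eq mult.commute power_add power_mult)
  then have "z ^ (n mod d) = 1" using z d by simp
  then have "n mod d = 0" using least[of "n mod d"] d by (meson mod_less_divisor neq0_conv)
  then show "z \<in> (\<Union>d\<in>{d. d dvd n}. primitive_roots d)"
    using d least by (auto simp: primitive_roots_def dvd_eq_mod_eq_0)
next
  fix z assume "z \<in> (\<Union>d\<in>{d. d dvd n}. primitive_roots d)"
  then show "z \<in> {z. z ^ n = 1}" by (auto simp: primitive_roots_def elim!: dvdE simp: power_mult)
qed

lemma disjoint_primitive_roots:
  assumes "0 < d" "0 < d'" "d \<noteq> d'"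
  shows "primitive_roots d \<inter> primitive_roots d' = {}"
  using assms by (cases d d' rule: linorder_cases) (auto simp: primitive_roots_def)

lemma degree_prod_linear:
  "degree (\<Prod>z\<in>A. [:-z, 1::complex:]) = card A"
  by (cases "finite A") (simp_all add: degree_prod_eq_sum_degree)

lemma lead_coeff_prod_linear:
  "lead_coeff (\<Prod>z\<in>A. [:-z, 1::complex:]) = 1"
  by (simp add: lead_coeff_prod)

lemma X_power_minus_1_eq_prod:
  assumes "n > 0"
  shows "Polynomial.monom 1 n - 1 = (\<Prod>z\<in>{z::complex. z ^ n = 1}. [:-z, 1:])"
proof (rule poly_eqI_degree_lead_coeff[where n=n and A="{z::complex. z ^ n = 1}"])
  have fin: "finite {z::complex. z ^ n = 1}" using finite_roots_unity assms by auto
  have c: "card {z::complex. z ^ n = 1} = n" by (rule card_roots_unity_eq[OF assms])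
  then show "n \<le> card {z::complex. z ^ n = 1}" by simp
  show "degree (Polynomial.monom 1 n - 1 :: complex poly) \<le> n"
    by (intro degree_diff_le) (auto simp: degree_monom_le)
  show "degree (\<Prod>z\<in>{z::complex. z ^ n = 1}. [:-z, 1:]) \<le> n" using c by (simp add: degree_prod_linear)
  have "poly.coeff (\<Prod>z\<in>{z::complex. z ^ n = 1}. [:-z, 1:]) n = 1"
    using lead_coeff_prod_linear[of "{z::complex. z ^ n = 1}"] c by (simp add: degree_prod_linear)
  then show "poly.coeff (Polynomial.monom 1 n - 1) n = poly.coeff (\<Prod>z\<in>{z::complex. z ^ n = 1}. [:-z, 1:]) n"
    using assms by simp
  fix w :: complex assume w: "w \<in> {z. z ^ n = 1}"
  then show "poly (Polynomial.monom 1 n - 1) w = poly (\<Prod>z\<in>{z::complex. z ^ n = 1}. [:-z, 1:]) w"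
    using fin by (auto simp: poly_prod poly_monom prod_zero_iff)
qed

lemma X_power_minus_1_eq_cyclotomic:
  assumes "n > 0"
  shows "Polynomial.monom 1 n - 1 = (\<Prod>d\<in>{d. d dvd n}. cyclotomic d)"
proof -
  have "(\<Prod>z\<in>(\<Union>d\<in>{d. d dvd n}. primitive_roots d). [:-z, 1::complex:]) =
      (\<Prod>d\<in>{d. d dvd n}. \<Prod>z\<in>primitive_roots d. [:-z, 1:])"
  proof (rule prod.UNION_disjoint)
    show "finite {d. d dvd n}" using assms by simp
    show "\<forall>d\<in>{d. d dvd n}. finite (primitive_roots d)"
      by (auto intro!: finite_primitive_roots dest: dvd_pos_nat[OF assms])
    show "\<forall>i\<in>{d. d dvd n}. \<forall>j\<in>{d. d dvd n}. i \<noteq> j \<longrightarrow> primitive_roots i \<inter> primitive_roots j = {}"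
      using disjoint_primitive_roots dvd_pos_nat[OF assms] by blast
  qed
  then show ?thesis
    unfolding X_power_minus_1_eq_prod[OF assms] roots_unity_eq_Union[OF assms] cyclotomic_def .
qed

lemma map_poly_of_int_mult:
  "map_poly (of_int :: int \<Rightarrow> complex) (p * q) = map_poly of_int p * map_poly of_int q"
  by (intro poly_eqI) (simp add: coeff_map_poly coeff_mult)

lemma map_poly_of_int_prod:
  "map_poly (of_int :: int \<Rightarrow> complex) (\<Prod>x\<in>A. f x) = (\<Prod>x\<in>A. map_poly of_int (f x))"
  by (induction A rule: infinite_finite_induct) (simp_all add: map_poly_of_int_mult)

lemma poly_map_of_int: "poly (map_poly (of_int :: int \<Rightarrow> complex) p) (of_int x) = of_int (poly p x)"
  by (induction p) (simp_all add: map_poly_pCons)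

text \<open>Division by a monic polynomial is possible over the integers. Seen over the complex
  numbers, the remainder is a multiple of \<open>g\<close> of smaller degree, hence zero, and the
  integral quotient is \<open>h\<close>.\<close>

lemma monic_quotient_int:
  fixes p g :: "int poly" and h :: "complex poly"
  assumes "map_poly of_int p = map_poly of_int g * h" "lead_coeff g = 1"
  shows "\<exists>h'. h = map_poly of_int h' \<and> p = g * h'"
proof -
  have g0: "g \<noteq> 0" using assms(2) by auto
  obtain q r where qr: "pseudo_divmod p g = (q, r)" by fastforce
  have 1: "p = g * q + r" and 2: "r = 0 \<or> degree r < degree g"
    using pseudo_divmod[OF g0 qr] assms(2) by auto
  let ?c = "map_poly (of_int :: int \<Rightarrow> complex)"
  have add: "?c (a + b) = ?c a + ?c b" for a b by (intro poly_eqI) (simp add: coeff_map_poly)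
  have deg: "degree (?c a) = degree a" for a by (rule degree_map_poly) simp
  have z: "?c a = 0 \<longleftrightarrow> a = 0" for a by (simp add: map_poly_eq_0_iff)
  have "?c g * h = ?c g * ?c q + ?c r" using assms(1) 1 by (simp add: add map_poly_of_int_mult)
  then have eq: "?c g * (h - ?c q) = ?c r" by (simp add: algebra_simps)
  have "h - ?c q = 0"
  proof (rule ccontr)
    assume n: "h - ?c q \<noteq> 0"
    then have "degree (?c g) \<le> degree (?c r)"
      unfolding eq[symmetric] using g0 z by (subst degree_mult_eq) auto
    moreover have "?c r \<noteq> 0" using eq n g0 z by (metis mult_eq_0_iff)
    ultimately show False using 2 z by (auto simp: deg)
  qed
  moreover from this have "r = 0" using eq z by simp
  ultimately show ?thesis using 1 by auto
qed

text \<open>Induction: the cyclotomic polynomial is the quotient of X^n - 1 by the monic product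
  over the proper divisors, which is integral by hypothesis.\<close>

lemma cyclotomic_int: "n > 0 \<Longrightarrow> \<exists>g :: int poly. cyclotomic n = map_poly of_int g \<and> lead_coeff g = 1"
proof (induction n rule: less_induct)
  case (less n)
  let ?D = "{d. d dvd n} - {n}"
  have fin: "finite {d. d dvd n}" using less by simp
  have "\<forall>d\<in>?D. \<exists>g :: int poly. cyclotomic d = map_poly of_int g \<and> lead_coeff g = 1"
  proof
    fix d assume "d \<in> ?D"
    then have "0 < d" "d < n" using less(2) dvd_pos_nat[OF less(2), of d] dvd_imp_le[of d n] by auto
    then show "\<exists>g :: int poly. cyclotomic d = map_poly of_int g \<and> lead_coeff g = 1"
      using less(1) by blast
  qed
  then obtain g where g: "\<And>d. d \<in> ?D \<Longrightarrow> cyclotomic d = map_poly of_int (g d :: int poly) \<and> lead_coeff (g d) = 1"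
    by metis
  let ?G = "\<Prod>d\<in>?D. g d"
  have "Polynomial.monom 1 n - 1 = cyclotomic n * (\<Prod>d\<in>?D. cyclotomic d)"
    using X_power_minus_1_eq_cyclotomic[OF less(2)] fin by (subst prod.remove[symmetric]) auto
  also have "(\<Prod>d\<in>?D. cyclotomic d) = map_poly of_int ?G"
    using g by (simp add: map_poly_of_int_prod)
  also have "Polynomial.monom 1 n - 1 = map_poly (of_int :: int \<Rightarrow> complex) (Polynomial.monom 1 n - 1)"
    by (intro poly_eqI) (simp add: coeff_map_poly)
  finally have eq: "map_poly of_int (Polynomial.monom 1 n - 1) = map_poly of_int ?G * cyclotomic n" by (simp add: mult.commute)
  have "lead_coeff ?G = 1" using g by (simp add: lead_coeff_prod)
  from monic_quotient_int[OF eq this] obtain h where h: "cyclotomic n = map_poly of_int h" by blast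
  have "lead_coeff (cyclotomic n) = 1" by (simp add: cyclotomic_def lead_coeff_prod_linear)
  then have "lead_coeff h = 1" unfolding h by (simp add: degree_map_poly coeff_map_poly)
  then show ?case using h by blast
qed

text \<open>Every point of the unit circle has distance at least q - 1 \<ge> 1 from q, and every
  point other than 1 has a larger one. A single primitive root \<open>w\<close> therefore makes the
  product exceed q - 1.\<close>

lemma norm_cyclotomic_gt:
  assumes "n \<ge> 2" "q \<ge> (2::nat)"
  shows "cmod (poly (cyclotomic n) (of_nat q)) > real q - 1"
proof -
  define w where "w = cis (2 * pi / real n)"
  have pw: "w ^ m = cis (2 * pi * real m / real n)" for m unfolding w_def Complex.DeMoivre by (rule arg_cong[where f=cis]) simp
  have "w \<in> primitive_roots n"
  proof -
    have "w ^ n = 1" using assms by (simp add: pw)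
    moreover have "w ^ m \<noteq> 1" if m: "0 < m" "m < n" for m
    proof
      assume "w ^ m = 1"
      then have "cos (2 * pi * real m / real n) = 1" by (simp add: pw complex_eq_iff)
      then obtain k :: int where "2 * pi * real m / real n = real_of_int k * 2 * pi"
        using cos_one_2pi_int by auto
      then have "real m = real_of_int k * real n" using assms by (simp add: field_simps)
      then have "int m = k * int n" by (metis of_int_eq_iff of_int_mult of_int_of_nat_eq)
      then have "int n dvd int m" by simp
      then show False using m by (simp add: nat_dvd_not_less)
    qed
    ultimately show ?thesis by (simp add: primitive_roots_def)
  qed
  have fin: "finite (primitive_roots n)" using assms by (intro finite_primitive_roots) simp
  have ge: "cmod (of_nat q - z) \<ge> real q - 1" if "z \<in> primitive_roots n" for z
  proof -
    have "cmod z ^ n = 1" using that by (auto simp: primitive_roots_def simp flip: norm_power)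
    then have "cmod z = 1" using assms power_eq_imp_eq_base[of "cmod z" n 1] by simp
    then show ?thesis using norm_triangle_ineq2[of "of_nat q" z] by simp
  qed
  have wn: "cmod w = 1" by (simp add: w_def)
  have w1: "w \<noteq> 1" using \<open>w \<in> primitive_roots n\<close> assms by (auto simp: primitive_roots_def dest: spec[where x=1])
  have "Re w < 1"
  proof (rule ccontr)
    assume "\<not> Re w < 1"
    then have "Re w = 1" using complex_Re_le_cmod[of w] wn by simp
    then have "(Im w)\<^sup>2 = 0" using wn by (simp add: cmod_def)
    then show False using w1 \<open>Re w = 1\<close> by (simp add: complex_eq_iff)
  qed
  then have "real q - 1 < Re (of_nat q - w)" by simp
  also have "\<dots> \<le> cmod (of_nat q - w)" by (rule complex_Re_le_cmod)
  finally have gt: "cmod (of_nat q - w) > real q - 1" .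
  have "cmod (poly (cyclotomic n) (of_nat q)) = (\<Prod>z\<in>primitive_roots n. cmod (of_nat q - z))"
    by (simp add: cyclotomic_def poly_prod prod_norm)
  also have "\<dots> = cmod (of_nat q - w) * (\<Prod>z\<in>primitive_roots n - {w}. cmod (of_nat q - z))"
    using fin \<open>w \<in> primitive_roots n\<close> by (rule prod.remove)
  also have "\<dots> \<ge> cmod (of_nat q - w) * 1"
  proof (intro mult_left_mono prod_ge_1)
    fix z assume "z \<in> primitive_roots n - {w}"
    then show "1 \<le> cmod (of_nat q - z)" using ge[of z] assms by simp
  qed simp
  finally show ?thesis using gt by simp
qed

text \<open>The integer \<open>P\<close> is the absolute value of the \<open>n\<close>-th cyclotomic polynomial at \<open>q\<close>.\<close>

lemma ex_cyclotomic_value: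
  fixes q n :: nat
  assumes "n \<ge> 2" "q \<ge> 2"
  obtains P :: nat where "P > q - 1" "P dvd q ^ n - 1"
    "\<And>d. d dvd n \<Longrightarrow> d < n \<Longrightarrow> P * (q ^ d - 1) dvd q ^ n - 1"
proof -
  have "\<forall>d\<in>{0<..}. \<exists>g :: int poly. cyclotomic d = map_poly of_int g"
    using cyclotomic_int by blast
  then obtain g where g: "\<And>d. d > 0 \<Longrightarrow> cyclotomic d = map_poly of_int (g d :: int poly)"
    by (metis greaterThan_iff)
  have X: "int q ^ m - 1 = (\<Prod>d\<in>{d. d dvd m}. poly (g d) (int q))" if "m > 0" for m
  proof -
    have "of_int (int q ^ m - 1) = poly (Polynomial.monom 1 m - 1 :: complex poly) (of_nat q)"
      by (simp add: poly_monom)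
    also have "\<dots> = (\<Prod>d\<in>{d. d dvd m}. poly (cyclotomic d) (of_nat q))"
      by (simp add: X_power_minus_1_eq_cyclotomic[OF that] poly_prod)
    also have "\<dots> = (\<Prod>d\<in>{d. d dvd m}. of_int (poly (g d) (int q)))"
    proof (rule prod.cong[OF refl])
      fix d assume "d \<in> {d. d dvd m}"
      then have "d > 0" using dvd_pos_nat[OF that, of d] by auto
      then show "poly (cyclotomic d) (of_nat q) = of_int (poly (g d) (int q))"
        using g[of d] poly_map_of_int[of "g d" "int q"] by simp
    qed
    finally show ?thesis by (metis of_int_eq_iff of_int_prod)
  qed
  define P where "P = nat \<bar>poly (g n) (int q)\<bar>"
  have "real P = cmod (poly (cyclotomic n) (of_nat q))"
    using g[of n] assms poly_map_of_int[of "g n" "int q"] by (simp add: P_def)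
  then have 1: "P > q - 1" using norm_cyclotomic_gt[OF assms] assms by linarith
  have fin: "finite {d. d dvd n}" using assms by simp
  have dv: "P * (q ^ d - 1) dvd q ^ n - 1" if d: "d dvd n" "d < n" for d
  proof -
    have "d > 0" using d assms dvd_pos_nat[of n d] by auto
    \<comment> \<open>The divisors of \<open>n\<close> split into \<open>n\<close> itself, those of
      \<open>d\<close>, and the rest; the middle part contributes exactly q^d - 1.\<close>
    have eq: "{d. d dvd n} = insert n ({e. e dvd d} \<union> ({e. e dvd n} - {n} - {e. e dvd d}))"
      using d by (auto dest: dvd_trans)
    have nn: "n \<notin> {e. e dvd d} \<union> ({e. e dvd n} - {n} - {e. e dvd d})"
      using d \<open>d > 0\<close> by (auto dest: dvd_imp_le)
    have fd: "finite {e. e dvd d}" using \<open>d > 0\<close> by simp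
    have "int q ^ n - 1 = poly (g n) (int q) * ((int q ^ d - 1) *
        (\<Prod>e\<in>{e. e dvd n} - {n} - {e. e dvd d}. poly (g e) (int q)))"
    proof -
      have "int q ^ n - 1 = (\<Prod>d\<in>{d. d dvd n}. poly (g d) (int q))" using assms by (intro X) simp
      also have "\<dots> = poly (g n) (int q) *
          (\<Prod>e\<in>{e. e dvd d} \<union> ({e. e dvd n} - {n} - {e. e dvd d}). poly (g e) (int q))"
        by (subst eq, subst prod.insert) (use fin fd nn in auto)
      also have "(\<Prod>e\<in>{e. e dvd d} \<union> ({e. e dvd n} - {n} - {e. e dvd d}). poly (g e) (int q)) =
          (\<Prod>e\<in>{e. e dvd d}. poly (g e) (int q)) *
          (\<Prod>e\<in>{e. e dvd n} - {n} - {e. e dvd d}. poly (g e) (int q))"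
        by (rule prod.union_disjoint) (use fin fd in auto)
      finally show ?thesis by (simp only: X[OF \<open>d > 0\<close>])
    qed
    then have "poly (g n) (int q) * (int q ^ d - 1) dvd int q ^ n - 1"
      unfolding mult.assoc[symmetric] by simp
    then have "\<bar>poly (g n) (int q)\<bar> * (int q ^ d - 1) dvd int q ^ n - 1"
      by (cases "poly (g n) (int q) \<ge> 0") simp_all
    moreover have "int (q ^ k - 1) = int q ^ k - 1" for k using assms by (simp add: of_nat_diff)
    ultimately have "int (P * (q ^ d - 1)) dvd int (q ^ n - 1)" by (simp add: P_def)
    then show ?thesis by (simp only: int_dvd_int_iff)
  qed
  have "P dvd q ^ n - 1" using dv[of 1] assms dvd_mult_left by fastforce
  then show ?thesis using 1 dv that by blast
qed


section \<open>Conjugacy classes in a finite division ring\<close>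

lemma card_fibre_sum:
  assumes "finite S" "\<And>y. y \<in> f ` S \<Longrightarrow> card {x \<in> S. f x = y} = k"
  shows "card S = card (f ` S) * k"
proof -
  have "card S = (\<Sum>x\<in>S. 1)" by simp
  also have "\<dots> = (\<Sum>y\<in>f ` S. \<Sum>x\<in>{x \<in> S. f x = y}. 1)" by (rule sum.image_gen[OF assms(1)])
  also have "\<dots> = (\<Sum>y\<in>f ` S. k)" using assms(2) by (intro sum.cong) auto
  finally show ?thesis by simp
qed

lemma dvd_card_partition:
  fixes S :: "'b set"
  assumes "finite S" "\<And>x. x \<in> S \<Longrightarrow> x \<in> K x \<and> K x \<subseteq> S \<and> m dvd card (K x)"
    "\<And>x y. x \<in> S \<Longrightarrow> y \<in> K x \<Longrightarrow> K y = K x"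
  shows "m dvd card S"
proof -
  have "S = \<Union>(K ` S)" using assms(2) by blast
  moreover have "card (\<Union>(K ` S)) = sum card (K ` S)"
  proof (rule card_Union_disjoint)
    show "pairwise disjnt (K ` S)"
    proof (rule pairwiseI)
      fix A B assume "A \<in> K ` S" "B \<in> K ` S" and ne: "A \<noteq> B"
      then obtain x y where xy: "x \<in> S" "y \<in> S" "A = K x" "B = K y" by auto
      have "z \<notin> B" if "z \<in> A" for z
        using assms(3)[of x z] assms(3)[of y z] xy that ne by auto
      then show "disjnt A B" by (auto simp: disjnt_def)
    qed
    show "finite A" if "A \<in> K ` S" for A
      using that assms(1,2) by (auto intro: finite_subset)
  qed
  moreover have "m dvd sum card (K ` S)" using assms(2) by (intro dvd_sum) auto
  ultimately show ?thesis by metis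
qed

lemma centralizer_div_subring:
  assumes "div_subring e G" "X \<subseteq> G"
  shows "div_subring e {y \<in> G. \<forall>x\<in>X. y * x = x * y}"
proof -
  note d = div_subringD[OF assms(1)]
  have "\<exists>z\<in>{y \<in> G. \<forall>x\<in>X. y * x = x * y}. z * y = e"
    if y: "y \<in> G" "\<And>x. x \<in> X \<Longrightarrow> y * x = x * y" "y \<noteq> 0" for y
  proof -
    obtain z where z: "z \<in> G" "z * y = e" "y * z = e" using div_subring_inv[OF assms(1) y(1,3)] by metis
    have "z * x = x * z" if "x \<in> X" for x
    proof -
      have x: "x \<in> G" using that assms(2) by auto
      have "z * x = z * x * (y * z)" using d(7,9) z x by metis
      also have "\<dots> = z * (x * y) * z" by (simp add: mult.assoc)
      also have "\<dots> = z * (y * x) * z" using y that by simp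
      also have "\<dots> = z * y * (x * z)" by (simp add: mult.assoc)
      also have "\<dots> = x * z" using z d(7,8) x by simp
      finally show ?thesis .
    qed
    then show ?thesis using z by blast
  qed
  moreover have "x * y * z = z * (x * y)" if "x * z = z * x" "y * z = z * y" for x y z :: 'a
    using that by (metis mult.assoc)
  ultimately show ?thesis using d assms(2) unfolding div_subring_def
    by (auto simp: left_diff_distrib right_diff_distrib subset_iff)
qed

text \<open>Witt's argument. With centre of order q and division ring of order q^n, a noncentral
  class has (q^n - 1) / (q^k - 1) elements for a proper divisor k of n. The cyclotomic value
  \<open>P\<close> divides all these numbers as well as q^n - 1, hence q - 1, although
  \<open>P > q - 1\<close>.\<close>

theorem wedderburn_little:
  assumes fin: "finite G" and G: "div_subring e G" and "a \<in> G" "b \<in> G"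
  shows "a * b = b * a"
proof -
  note d = div_subringD[OF G]
  define C where "C = {y \<in> G. \<forall>x\<in>G. y * x = x * y}"
  define q where "q = card C"
  have C: "div_subring e C" unfolding C_def by (rule centralizer_div_subring[OF G]) simp
  have CG: "C \<subseteq> G" by (auto simp: C_def)
  have sp: "finite_lspace e A B" if "div_subring e A" "div_subring e B" "A \<subseteq> B" "B \<subseteq> G" for A B
    using that div_subringD[OF that(2)] fin unfolding finite_lspace_def lsubspace_def
    by (auto intro: finite_subset)
  interpret C: finite_lspace e C G using sp[OF C G CG] by simp
  obtain n where n: "card G = q ^ n" using C.ex_basis q_def by metis
  have q2: "q \<ge> 2" using C.card_F q_def by simp
  have "C = G"
  proof (rule ccontr)
    assume "C \<noteq> G"
    then have lt: "card C < card G" using CG fin by (simp add: psubset_card_mono psubsetI)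
    have n2: "n \<ge> 2"
    proof (rule ccontr)
      assume "\<not> ?thesis"
      then have "n = 0 \<or> n = 1" by auto
      then show False using lt n q2 q_def by auto
    qed
    obtain P where P: "P > q - 1" "P dvd q ^ n - 1"
      "\<And>d. d dvd n \<Longrightarrow> d < n \<Longrightarrow> P * (q ^ d - 1) dvd q ^ n - 1"
      using ex_cyclotomic_value[OF n2 q2] by metis
    define iv where "iv g = (SOME h. h \<in> G \<and> h \<noteq> 0 \<and> h * g = e \<and> g * h = e)" for g
    have iv: "iv g \<in> G \<and> iv g \<noteq> 0 \<and> iv g * g = e \<and> g * iv g = e" if "g \<in> G - {0}" for g
      unfolding iv_def by (rule someI_ex) (use div_subring_inv[OF G, of g] that in blast)
    have prod0: "g * h \<in> G - {0}" if "g \<in> G - {0}" "h \<in> G - {0}" for g h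
      using that d(7) div_subring_no_zero_divisors[OF G] by blast
    define K where "K x = {y. \<exists>g\<in>G - {0}. y = g * x * iv g}" for x
    \<comment> \<open>Conjugacy is rewritten as \<open>y * g = g * x\<close>, which can be composed
      without computing inverses of products.\<close>
    have K_iff: "y \<in> K x \<longleftrightarrow> y \<in> G \<and> (\<exists>g\<in>G - {0}. y * g = g * x)" if "x \<in> G" for x y
    proof
      assume "y \<in> K x"
      then obtain g where g: "g \<in> G - {0}" "y = g * x * iv g" by (auto simp: K_def)
      have "y * g = g * x * (iv g * g)" using g by (simp add: mult.assoc)
      then have "y * g = g * x" using iv[OF g(1)] d(7,9) that g by auto
      then show "y \<in> G \<and> (\<exists>g\<in>G - {0}. y * g = g * x)" using g iv[OF g(1)] d(7) that by auto
    next
      assume "y \<in> G \<and> (\<exists>g\<in>G - {0}. y * g = g * x)"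
      then obtain g where g: "y \<in> G" "g \<in> G - {0}" "y * g = g * x" by blast
      have "g * x * iv g = y * (g * iv g)" using g by (simp add: mult.assoc flip: g(3))
      then show "y \<in> K x" using iv[OF g(2)] d(9) g by (auto simp: K_def)
    qed
    have "P dvd card (G - C)"
    proof (rule dvd_card_partition[where K=K])
      show "finite (G - C)" using fin by simp
      have sub: "y \<in> G - C" if x: "x \<in> G - C" and y: "y \<in> K x" for x y
      proof -
        obtain g where g: "y \<in> G" "g \<in> G - {0}" "y * g = g * x" using K_iff y x by auto
        have "y \<notin> C"
        proof
          assume "y \<in> C"
          then have "g * y = g * x" using g by (auto simp: C_def)
          then have "iv g * g * y = iv g * g * x" by (simp add: mult.assoc)
          then have "y = x" using iv[OF g(2)] d(8) g x by auto
          then show False using \<open>y \<in> C\<close> x by simp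
        qed
        then show ?thesis using g by simp
      qed
      fix x assume x: "x \<in> G - C"
      then have xG: "x \<in> G" by simp
      have "x \<in> K x" using K_iff[OF xG] xG d(1,2,8,9) by (auto intro!: bexI[of _ e])
      moreover have "K x \<subseteq> G - C" using sub x by blast
      moreover have "P dvd card (K x)"
      proof -
        define H where "H = {y \<in> G. \<forall>z\<in>{x}. y * z = z * y}"
        have H: "div_subring e H" unfolding H_def using xG by (intro centralizer_div_subring[OF G]) simp
        have HG: "H \<subseteq> G" and CH: "C \<subseteq> H" using xG by (auto simp: H_def C_def)
        have Hne: "H \<noteq> G"
        proof
          assume "H = G"
          then have "x * y = y * x" if "y \<in> G" for y using that unfolding H_def by force
          then show False using x by (auto simp: C_def)
        qed
        interpret H1: finite_lspace e C H using sp[OF C H CH HG] .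
        interpret H2: finite_lspace e H G using sp[OF H G HG] by simp
        obtain k where k: "card H = q ^ k" using H1.ex_basis q_def by metis
        obtain r where r: "card G = card H ^ r" using H2.ex_basis by metis
        have "n = k * r" using r n k q2 by (simp flip: power_mult)
        have "card H < card G" using HG Hne fin by (simp add: psubset_card_mono psubsetI)
        then have "k < n" using k n q2 by simp
        have "card (G - {0}) = card ((\<lambda>g. g * x * iv g) ` (G - {0})) * (q ^ k - 1)"
        proof (rule card_fibre_sum)
          show "finite (G - {0})" using fin by simp
          fix y assume "y \<in> (\<lambda>g. g * x * iv g) ` (G - {0})"
          then obtain h where h: "h \<in> G - {0}" "y = h * x * iv h" by auto
          \<comment> \<open>The fibre of the conjugation map through \<open>h\<close> is the coset
            \<open>h H\<close> of the centralizer \<open>H\<close> of \<open>x\<close>, without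
            zero.\<close>
          have "{g \<in> G - {0}. g * x * iv g = y} = (\<lambda>c. h * c) ` (H - {0})"
          proof (intro equalityI subsetI)
            fix g assume "g \<in> {g \<in> G - {0}. g * x * iv g = y}"
            then have g: "g \<in> G - {0}" "g * x * iv g = h * x * iv h" using h by auto
            let ?c = "iv h * g"
            have "iv h * (g * x * iv g) * g = iv h * (h * x * iv h) * g" using g by simp
            then have "iv h * g * x * (iv g * g) = iv h * h * x * (iv h * g)"
              by (simp add: mult.assoc)
            then have "?c * x = x * ?c" using iv g h xG d(7,8,9) by simp
            then have "?c \<in> H - {0}" using prod0[of "iv h" g] iv[OF h(1)] g by (auto simp: H_def)
            moreover have "h * ?c = g" using iv[OF h(1)] g d(8) by (simp flip: mult.assoc)
            ultimately show "g \<in> (\<lambda>c. h * c) ` (H - {0})" by force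
          next
            fix g assume "g \<in> (\<lambda>c. h * c) ` (H - {0})"
            then obtain c where c: "c \<in> H - {0}" "g = h * c" by auto
            have c': "c \<in> G - {0}" using c HG by auto
            have g: "g \<in> G - {0}" using prod0[OF h(1) c'] c by simp
            have "y * g = h * x * (iv h * h) * c" using h c by (simp add: mult.assoc)
            also have "\<dots> = h * (x * c)" using iv[OF h(1)] xG h d(7,9) by (simp add: mult.assoc)
            also have "x * c = c * x" using c by (simp add: H_def)
            finally have "y * g = g * x" using c by (simp add: mult.assoc)
            then have "g * x * iv g = y * (g * iv g)" by (simp flip: mult.assoc)
            moreover have "y \<in> G" using h xG d(7) iv by auto
            ultimately have "g * x * iv g = y" using iv[OF g] d(9) by simp
            then show "g \<in> {g \<in> G - {0}. g * x * iv g = y}" using g by simp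
          qed
          moreover have "inj_on (\<lambda>c. h * c) (H - {0})"
          proof (rule inj_onI)
            fix c c' assume cc: "c \<in> H - {0}" "c' \<in> H - {0}" "h * c = h * c'"
            then have "iv h * h * c = iv h * h * c'" by (simp add: mult.assoc)
            then have "e * c = e * c'" using iv[OF h(1)] by metis
            moreover have "c \<in> G" "c' \<in> G" using cc HG by auto
            ultimately show "c = c'" using d(8) by metis
          qed
          ultimately show "card {g \<in> G - {0}. g * x * iv g = y} = q ^ k - 1"
            using k div_subringD(3)[OF H] by (simp add: card_image card_Diff_singleton)
        qed
        moreover have "(\<lambda>g. g * x * iv g) ` (G - {0}) = K x" by (auto simp: K_def)
        ultimately have eq: "q ^ n - 1 = card (K x) * (q ^ k - 1)"
          using n d(3) by (simp add: card_Diff_singleton)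
        have "k > 0"
        proof (rule ccontr)
          assume "\<not> k > 0"
          then show False using eq n2 q2 one_less_power[of q n] by simp
        qed
        then have "q ^ k - 1 > 0" using q2 one_less_power[of q k] by simp
        moreover have "P * (q ^ k - 1) dvd card (K x) * (q ^ k - 1)"
          using P(3)[of k] \<open>n = k * r\<close> \<open>k < n\<close> eq by simp
        ultimately show ?thesis by simp
      qed
      ultimately show "x \<in> K x \<and> K x \<subseteq> G - C \<and> P dvd card (K x)" by blast
      fix y assume y: "y \<in> K x"
      then have yG: "y \<in> G" using sub x by blast
      obtain g where g: "g \<in> G - {0}" "y * g = g * x" using K_iff[OF xG] y by blast
      have "z \<in> K x" if z: "z \<in> K y" for z
      proof -
        obtain h where h: "z \<in> G" "h \<in> G - {0}" "z * h = h * y" using K_iff[OF yG] z by blast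
        have "z * (h * g) = h * (y * g)" using h by (simp flip: mult.assoc)
        also have "\<dots> = h * g * x" using g by (simp flip: mult.assoc)
        finally show ?thesis using K_iff[OF xG] h(1) prod0[OF h(2) g(1)] by blast
      qed
      moreover have "z \<in> K y" if z: "z \<in> K x" for z
      proof -
        obtain h where h: "z \<in> G" "h \<in> G - {0}" "z * h = h * x" using K_iff[OF xG] z by blast
        have ig: "iv g \<in> G - {0}" using iv[OF g(1)] by simp
        have "x * iv g = iv g * (g * x) * iv g"
          using iv[OF g(1)] d(8) xG by (simp flip: mult.assoc)
        also have "\<dots> = iv g * y * (g * iv g)" using g by (simp flip: mult.assoc g(2))
        also have "\<dots> = iv g * y" using iv[OF g(1)] d(7,9) yG by simp
        finally have "x * iv g = iv g * y" .
        then have "z * (h * iv g) = h * iv g * y" using h by (metis mult.assoc)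
        then show ?thesis using K_iff[OF yG] h(1) prod0[OF h(2) ig] by blast
      qed
      ultimately show "K y = K x" by blast
    qed
    moreover have "card (G - C) = q ^ n - q" using CG n q_def fin by (simp add: card_Diff_subset finite_subset)
    \<comment> \<open>The class equation modulo \<open>P\<close>: the difference of q^n - 1 and q^n
      - q is q - 1.\<close>
    ultimately have "P dvd (q ^ n - 1) - (q ^ n - q)" using P(2) by (metis dvd_diff_nat)
    moreover have "q \<le> q ^ n" using n2 q2 by (simp add: self_le_power)
    then have "(q ^ n - 1) - (q ^ n - q) = q - 1" using q2 by simp
    ultimately have "P dvd q - 1" by simp
    then have "P \<le> q - 1" using q2 by (intro dvd_imp_le) auto
    then show False using P(1) by simp
  qed
  then show ?thesis using assms(3,4) by (auto simp: C_def)
qed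

section \<open>Finite simple rings\<close>

definition unital_subring :: "'a::ring_1 set \<Rightarrow> bool" where
  "unital_subring R \<longleftrightarrow> 1 \<in> R \<and> (\<forall>x\<in>R. \<forall>y\<in>R. x - y \<in> R \<and> x * y \<in> R)"

text \<open>Primeness is isolated because it is all that the construction of idempotents uses; for
  an irreducible subring it is available before simplicity.\<close>

definition prime_subring :: "'a::ring_1 set \<Rightarrow> bool" where
  "prime_subring R \<longleftrightarrow> unital_subring R \<and> (\<forall>a\<in>R. \<forall>b\<in>R. a \<noteq> 0 \<longrightarrow> b \<noteq> 0 \<longrightarrow> (\<exists>r\<in>R. a * r * b \<noteq> 0))"

definition ideal_of :: "'a::ring_1 set \<Rightarrow> 'a set \<Rightarrow> bool" where
  "ideal_of R I \<longleftrightarrow> I \<subseteq> R \<and> 0 \<in> I \<and> (\<forall>x\<in>I. \<forall>y\<in>I. x + y \<in> I) \<and> (\<forall>r\<in>R. \<forall>x\<in>I. r * x \<in> I \<and> x * r \<in> I)"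

definition simple_subring :: "'a::ring_1 set \<Rightarrow> bool" where
  "simple_subring R \<longleftrightarrow> unital_subring R \<and> (\<forall>I. ideal_of R I \<longrightarrow> I = {0} \<or> I = R)"

definition left_ideal_of :: "'a::ring_1 set \<Rightarrow> 'a set \<Rightarrow> bool" where
  "left_ideal_of R I \<longleftrightarrow> I \<subseteq> R \<and> 0 \<in> I \<and> (\<forall>x\<in>I. \<forall>y\<in>I. x + y \<in> I) \<and> (\<forall>r\<in>R. \<forall>x\<in>I. r * x \<in> I)"

definition centre_of :: "'a::ring_1 set \<Rightarrow> 'a set" where
  "centre_of R = {z \<in> R. \<forall>r\<in>R. z * r = r * z}"

lemma unital_subringD:
  assumes "unital_subring R"
  shows "1 \<in> R" "0 \<in> R" "\<And>x y. x \<in> R \<Longrightarrow> y \<in> R \<Longrightarrow> x - y \<in> R" "\<And>x y. x \<in> R \<Longrightarrow> y \<in> R \<Longrightarrow> x + y \<in> R"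
    "\<And>x. x \<in> R \<Longrightarrow> - x \<in> R" "\<And>x y. x \<in> R \<Longrightarrow> y \<in> R \<Longrightarrow> x * y \<in> R"
proof -
  note d = assms[unfolded unital_subring_def]
  show 1: "1 \<in> R" using d by simp
  show m: "x - y \<in> R" "x * y \<in> R" if "x \<in> R" "y \<in> R" for x y using d that by auto
  show 0: "0 \<in> R" using m(1)[OF 1 1] by simp
  show u: "- x \<in> R" if "x \<in> R" for x using m(1)[OF 0 that] by simp
  show "x + y \<in> R" if "x \<in> R" "y \<in> R" for x y using m(1)[OF that(1) u[OF that(2)]] by simp
qed

text \<open>The elements annihilated by \<open>a R\<close> form an ideal. If it contained
  \<open>b \<noteq> 0\<close> it would contain 1, which forces \<open>a = 0\<close>.\<close>

lemma simple_imp_prime: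
  assumes "simple_subring R"
  shows "prime_subring R"
  unfolding prime_subring_def
proof (intro conjI ballI impI)
  show R: "unital_subring R" using assms by (simp add: simple_subring_def)
  note d = unital_subringD[OF R]
  fix a b assume ab: "a \<in> R" "b \<in> R" "a \<noteq> 0" "b \<noteq> 0"
  show "\<exists>r\<in>R. a * r * b \<noteq> 0"
  proof (rule ccontr)
    assume n: "\<not> ?thesis"
    let ?J = "{x \<in> R. \<forall>r\<in>R. a * r * x = 0}"
    have "a * r * (s * x) = 0" if "r \<in> R" "s \<in> R" "x \<in> ?J" for r s x
      using that d(6)[of r s] by (auto simp: mult.assoc)
    moreover have "a * r * (x * s) = 0" if "r \<in> R" "s \<in> R" "x \<in> ?J" for r s x
      using that by (simp flip: mult.assoc)
    ultimately have "ideal_of R ?J" using d unfolding ideal_of_def by (auto simp: distrib_left)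
    then have "?J = R" using assms ab n by (auto simp: simple_subring_def)
    then have "a * 1 * 1 = 0" using d(1) by blast
    then show False using ab by simp
  qed
qed

lemma left_ideal_of_right_mult:
  assumes "unital_subring R" "left_ideal_of R X" "v \<in> R"
  shows "left_ideal_of R ((\<lambda>x. x * v) ` X)"
  unfolding left_ideal_of_def
proof (intro conjI ballI)
  note d = unital_subringD[OF assms(1)]
  note X = assms(2)[unfolded left_ideal_of_def]
  show "(\<lambda>x. x * v) ` X \<subseteq> R" using assms(3) X d by auto
  have "0 * v \<in> (\<lambda>x. x * v) ` X" using X by blast
  then show "0 \<in> (\<lambda>x. x * v) ` X" by simp
  show "x + y \<in> (\<lambda>x. x * v) ` X" if "x \<in> (\<lambda>x. x * v) ` X" "y \<in> (\<lambda>x. x * v) ` X" for x y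
    using that X by (auto simp flip: distrib_right)
  show "r * x \<in> (\<lambda>x. x * v) ` X" if "r \<in> R" "x \<in> (\<lambda>x. x * v) ` X" for r x
    using that X by (auto simp flip: mult.assoc)
qed

text \<open>Brauer's lemma. In a minimal left ideal \<open>L\<close> primeness provides
  \<open>u\<close> with \<open>L u = L\<close>, so some \<open>e\<close> in \<open>L\<close> has
  \<open>e * u = u\<close>. Then \<open>e * e - e\<close> lies in the annihilator of
  \<open>u\<close> in \<open>L\<close>, which is zero by minimality. The last conclusion, that each
  nonzero \<open>x * e\<close> generates \<open>L\<close> again, is what makes \<open>e R e\<close>
  a division ring.\<close>

lemma brauer_idempotent:
  assumes R: "prime_subring R" "finite R" and I: "left_ideal_of R I" "I \<noteq> {0}"
  obtains e where "e \<in> I" "e \<noteq> 0" "e * e = e" "\<And>x. x \<in> R \<Longrightarrow> x * e \<noteq> 0 \<Longrightarrow> \<exists>y\<in>R. y * (x * e) = e"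
proof -
  have U: "unital_subring R" using R by (simp add: prime_subring_def)
  note d = unital_subringD[OF U]
  note Ru = left_ideal_of_right_mult[OF U]
  define P where "P L \<longleftrightarrow> left_ideal_of R L \<and> L \<subseteq> I \<and> L \<noteq> {0}" for L
  obtain L where L: "P L" and least: "\<And>L'. P L' \<Longrightarrow> card L \<le> card L'"
    using ex_has_least_nat[of P I card] I by (auto simp: P_def)
  note l = L[unfolded P_def left_ideal_of_def]
  have finL: "finite L" using l R(2) by (auto intro: finite_subset)
  have min: "L' = L" if "left_ideal_of R L'" "L' \<subseteq> L" "L' \<noteq> {0}" for L'
  proof (rule card_seteq[OF finL that(2)])
    show "card L \<le> card L'" using least[of L'] that L unfolding P_def by blast
  qed
  obtain a where a: "a \<in> L" "a \<noteq> 0" using l by auto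
  then have "a \<in> R" using l by blast
  then obtain r where r: "r \<in> R" "a * r * a \<noteq> 0" using R(1) a unfolding prime_subring_def by blast
  define u where "u = r * a"
  have u: "u \<in> L" "a * u \<noteq> 0" using r a l by (auto simp: u_def mult.assoc)
  have LR: "left_ideal_of R L" using L by (simp add: P_def)
  have "(\<lambda>x. x * u) ` L = L"
  proof (rule min)
    show "left_ideal_of R ((\<lambda>x. x * u) ` L)" using Ru[OF LR] u l by blast
    show "(\<lambda>x. x * u) ` L \<subseteq> L" using u l by auto
    show "(\<lambda>x. x * u) ` L \<noteq> {0}" using u a by auto
  qed
  then obtain e where e: "e \<in> L" "e * u = u" using u by (metis imageE)
  let ?K = "{x \<in> L. x * u = 0}"
  have "left_ideal_of R ?K" using l unfolding left_ideal_of_def by (auto simp: distrib_right mult.assoc)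
  moreover have "?K \<noteq> L" using a u by auto
  ultimately have K: "?K = {0}" using min[of ?K] by blast
  have "e * e - e \<in> ?K"
  proof -
    have "- e \<in> L" using l e d(1,5) by (metis mult_minus1)
    moreover have "e * e \<in> L" using l e by auto
    ultimately have "e * e + - e \<in> L" using l by blast
    then show ?thesis using e by (simp add: left_diff_distrib mult.assoc)
  qed
  then have ee: "e * e = e" using K by auto
  have e0: "e \<noteq> 0" using e u by auto
  have "\<exists>y\<in>R. y * (x * e) = e" if x: "x \<in> R" "x * e \<noteq> 0" for x
  proof -
    have "(\<lambda>y. y * (x * e)) ` R = L"
    proof (rule min)
      have "left_ideal_of R R" using d by (simp add: left_ideal_of_def)
      then show "left_ideal_of R ((\<lambda>y. y * (x * e)) ` R)" using x e l d by (intro Ru) auto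
      show "(\<lambda>y. y * (x * e)) ` R \<subseteq> L" using x e l by auto
      have "1 * (x * e) \<in> (\<lambda>y. y * (x * e)) ` R" using d(1) by blast
      then show "(\<lambda>y. y * (x * e)) ` R \<noteq> {0}" using x(2) by (metis mult_1 singletonD)
    qed
    then show ?thesis using e by (metis imageE)
  qed
  then show ?thesis using that e(1) l e0 ee by blast
qed

text \<open>The ideal \<open>R e R\<close>, built by adding one product at a time, so that
  statements about a representation of 1 as such a sum can be proved by induction over its
  summands.\<close>

inductive_set gen_ideal :: "'a::ring_1 set \<Rightarrow> 'a \<Rightarrow> 'a set" for R e where
  zero: "0 \<in> gen_ideal R e"
| add: "x \<in> gen_ideal R e \<Longrightarrow> a \<in> R \<Longrightarrow> b \<in> R \<Longrightarrow> x + a * e * b \<in> gen_ideal R e"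

lemma ideal_of_gen_ideal:
  assumes "unital_subring R" "e \<in> R"
  shows "ideal_of R (gen_ideal R e)" "e \<in> gen_ideal R e"
proof -
  note d = unital_subringD[OF assms(1)]
  have 1: "x \<in> gen_ideal R e \<Longrightarrow> x \<in> R" for x
    by (induction rule: gen_ideal.induct) (use d assms in auto)
  have 2: "x + y \<in> gen_ideal R e" if "y \<in> gen_ideal R e" "x \<in> gen_ideal R e" for x y
    using that by (induction rule: gen_ideal.induct) (auto simp flip: add.assoc intro: gen_ideal.add)
  have 3: "r * x \<in> gen_ideal R e" if "x \<in> gen_ideal R e" "r \<in> R" for x r
    using that
  proof (induction rule: gen_ideal.induct)
    case (add x a b)
    then have "r * x + (r * a) * e * b \<in> gen_ideal R e" using d by (intro gen_ideal.add) auto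
    then show ?case by (simp add: distrib_left mult.assoc)
  qed (simp add: gen_ideal.zero)
  have 4: "x * r \<in> gen_ideal R e" if "x \<in> gen_ideal R e" "r \<in> R" for x r
    using that
  proof (induction rule: gen_ideal.induct)
    case (add x a b)
    then have "x * r + a * e * (b * r) \<in> gen_ideal R e" using d by (intro gen_ideal.add) auto
    then show ?case by (simp add: distrib_right mult.assoc)
  qed (simp add: gen_ideal.zero)
  show "ideal_of R (gen_ideal R e)" using 1 2 3 4 gen_ideal.zero by (auto simp: ideal_of_def)
  show "e \<in> gen_ideal R e" using gen_ideal.add[OF gen_ideal.zero d(1,1), of e] by simp
qed

text \<open>For central \<open>z \<noteq> 0\<close> the set \<open>z R\<close> is a nonzero ideal,
  hence contains 1; the inverse obtained in this way is again central.\<close>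

lemma centre_div_subring:
  assumes "simple_subring R"
  shows "div_subring 1 (centre_of R)"
proof -
  have R: "unital_subring R" using assms by (simp add: simple_subring_def)
  note d = unital_subringD[OF R]
  have inv: "\<exists>y\<in>centre_of R. y * z = 1" if z: "z \<in> centre_of R" "z \<noteq> 0" for z
  proof -
    have zR: "z \<in> R" "\<And>r. r \<in> R \<Longrightarrow> z * r = r * z" using z by (auto simp: centre_of_def)
    have "ideal_of R ((\<lambda>r. z * r) ` R)" unfolding ideal_of_def
    proof (intro conjI ballI)
      show "(\<lambda>r. z * r) ` R \<subseteq> R" using zR d by auto
      have "z * 0 \<in> (\<lambda>r. z * r) ` R" using d(2) by blast
      then show "0 \<in> (\<lambda>r. z * r) ` R" by simp
      show "x + y \<in> (\<lambda>r. z * r) ` R" if "x \<in> (\<lambda>r. z * r) ` R" "y \<in> (\<lambda>r. z * r) ` R" for x y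
        using that d by (auto simp flip: distrib_left)
      show "r * x \<in> (\<lambda>r. z * r) ` R" "x * r \<in> (\<lambda>r. z * r) ` R" if r: "r \<in> R" "x \<in> (\<lambda>r. z * r) ` R" for r x
      proof -
        obtain s where s: "s \<in> R" "x = z * s" using r by auto
        have "r * x = z * (r * s)" using zR(2)[OF r(1)] s by (simp flip: mult.assoc)
        then show "r * x \<in> (\<lambda>r. z * r) ` R" using s r d by auto
        show "x * r \<in> (\<lambda>r. z * r) ` R" using s r d by (auto simp: mult.assoc)
      qed
    qed
    moreover have "z * 1 \<in> (\<lambda>r. z * r) ` R" using d(1) by blast
    ultimately have "(\<lambda>r. z * r) ` R = R" using assms z by (auto simp: simple_subring_def)
    then obtain y where y: "y \<in> R" "z * y = 1" using d(1) by (metis imageE)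
    have yz: "y * z = 1" using zR(2)[OF y(1)] y by simp
    have "y * r = r * y" if "r \<in> R" for r
    proof -
      have "y * r = y * r * (z * y)" using y by simp
      also have "\<dots> = y * (r * z) * y" by (simp add: mult.assoc)
      also have "\<dots> = y * (z * r) * y" using zR(2)[OF that] by simp
      also have "\<dots> = r * y" using yz by (simp flip: mult.assoc)
      finally show ?thesis .
    qed
    then show ?thesis using y yz by (auto simp: centre_of_def)
  qed
  moreover have "x * y * r = r * (x * y)" if "x * r = r * x" "y * r = r * y" for x y r :: 'a
    using that by (metis mult.assoc)
  ultimately have "x * y \<in> centre_of R" if "x \<in> centre_of R" "y \<in> centre_of R" for x y
    using that d(6) unfolding centre_of_def by blast
  moreover have "(x - y) * r = r * (x - y)" if "x * r = r * x" "y * r = r * y" for x y r :: 'a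
    using that by (simp add: left_diff_distrib right_diff_distrib)
  then have "x - y \<in> centre_of R" if "x \<in> centre_of R" "y \<in> centre_of R" for x y
    using that d(3) unfolding centre_of_def by blast
  moreover have "1 \<in> centre_of R" using d(1) by (simp add: centre_of_def)
  ultimately show ?thesis using inv by (simp add: div_subring_def)
qed

text \<open>The minimal left ideal \<open>R e\<close> is a right vector space over the field \<open>e R e\<close>.  A
  representation \<open>1 = a\<^sub>1 e b\<^sub>1 + \<dots>\<close> serves as a dual basis: it shows that right
  multiplication by an element of \<open>e R e\<close> is left multiplication by a central element, and
  that every linear map of \<open>R e\<close> is left multiplication by an element of \<open>R\<close>.\<close>

lemma simple_subring_structure:
  assumes R: "simple_subring R" "finite R"
  obtains L where "left_ideal_of R L" "L \<noteq> {0}"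
    "\<And>r. r \<in> R \<Longrightarrow> (\<And>v. v \<in> L \<Longrightarrow> r * v = 0) \<Longrightarrow> r = 0"
    "\<And>v w. v \<in> L \<Longrightarrow> v \<noteq> 0 \<Longrightarrow> w \<in> L \<Longrightarrow> \<exists>r\<in>R. r * v = w"
    "\<And>T. (\<And>v w. v \<in> L \<Longrightarrow> w \<in> L \<Longrightarrow> T (v + w) = T v + T w) \<Longrightarrow>
      (\<And>z v. z \<in> centre_of R \<Longrightarrow> v \<in> L \<Longrightarrow> T (z * v) = z * T v) \<Longrightarrow>
      (\<And>v. v \<in> L \<Longrightarrow> T v \<in> L) \<Longrightarrow> \<exists>r\<in>R. \<forall>v\<in>L. T v = r * v"
proof -
  have U: "unital_subring R" using R by (simp add: simple_subring_def)
  note d = unital_subringD[OF U]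
  note prime = simple_imp_prime[OF R(1)]
  have "left_ideal_of R R" using d by (simp add: left_ideal_of_def)
  have "R \<noteq> {0}" using d(1) by (metis singletonD zero_neq_one)
  with \<open>left_ideal_of R R\<close> obtain e where e: "e \<in> R" "e \<noteq> 0" "e * e = e"
    and min: "\<And>x. x \<in> R \<Longrightarrow> x * e \<noteq> 0 \<Longrightarrow> \<exists>y\<in>R. y * (x * e) = e"
    using brauer_idempotent[OF prime R(2)] by metis
  define L where "L = (\<lambda>r. r * e) ` R"
  have L: "left_ideal_of R L"
    unfolding L_def by (rule left_ideal_of_right_mult[OF U \<open>left_ideal_of R R\<close> e(1)])
  have LI: "r * e \<in> L" if "r \<in> R" for r using that by (simp add: L_def)
  have Le: "v * e = v" if "v \<in> L" for v using that e by (auto simp: L_def mult.assoc)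
  have LR: "v \<in> R" if "v \<in> L" for v using that L by (auto simp: left_ideal_of_def)
  have RL: "r * v \<in> L" if "r \<in> R" "v \<in> L" for r v using that L by (auto simp: left_ideal_of_def)
  have "e \<in> L" using LI[OF e(1)] e by simp
  then have L0: "L \<noteq> {0}" using e by auto
  have faithful: "r = 0" if r: "r \<in> R" "\<And>v. v \<in> L \<Longrightarrow> r * v = 0" for r
  proof (rule ccontr)
    assume "r \<noteq> 0"
    then obtain s where "s \<in> R" "r * s * e \<noteq> 0" using prime r(1) e by (auto simp: prime_subring_def)
    then show False using r(2)[OF LI[of s]] by (simp add: mult.assoc)
  qed
  have trans: "\<exists>r\<in>R. r * v = w" if vw: "v \<in> L" "v \<noteq> 0" "w \<in> L" for v w
  proof -
    obtain y where "y \<in> R" "y * (v * e) = e" using min[of v] LR vw Le by metis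
    then have "w * y * v = w" using Le vw by (metis mult.assoc)
    then show ?thesis using d(6)[OF LR[OF vw(3)] \<open>y \<in> R\<close>] by blast
  qed
  define G where "G = (\<lambda>r. e * r * e) ` R"
  have GI: "e * r * e \<in> G" if "r \<in> R" for r using that by (simp add: G_def)
  have GR: "g \<in> R" if "g \<in> G" for g using that d e by (auto simp: G_def)
  have eG: "e * g = g" "g * e = g" if "g \<in> G" for g
  proof -
    obtain r where g: "g = e * r * e" using \<open>g \<in> G\<close> by (auto simp: G_def)
    have "e * g = (e * e) * r * e" unfolding g by (simp only: mult.assoc)
    then show "e * g = g" using e g by simp
    have "g * e = e * r * (e * e)" unfolding g by (simp only: mult.assoc)
    then show "g * e = g" using e g by simp
  qed
  have G: "div_subring e G"
    unfolding div_subring_def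
  proof (intro conjI ballI impI)
    show "e \<in> G" using GI[OF d(1)] e by simp
    show "e \<noteq> 0" by fact
    show "x - y \<in> G" if xy: "x \<in> G" "y \<in> G" for x y
      using GI[OF d(3)[OF GR[OF xy(1)] GR[OF xy(2)]]] eG xy by (simp add: left_diff_distrib right_diff_distrib)
    show "x * y \<in> G" if xy: "x \<in> G" "y \<in> G" for x y
      using GI[OF d(6)[OF GR[OF xy(1)] GR[OF xy(2)]]] eG xy by (metis mult.assoc)
    show "e * x = x" "x * e = x" if "x \<in> G" for x using eG that by auto
    show "\<exists>y\<in>G. y * x = e" if x: "x \<in> G" "x \<noteq> 0" for x
    proof -
      obtain y where y: "y \<in> R" "y * x = e" using min[of x] GR x eG by metis
      have "e * y * e * x = e * (y * (e * x))" by (simp add: mult.assoc)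
      then have "e * y * e * x = e" using y eG[OF x(1)] e by simp
      then show ?thesis using GI[OF y(1)] by blast
    qed
  qed
  have "finite G" using R(2) by (simp add: G_def)
  then have Gcomm: "g * h = h * g" if "g \<in> G" "h \<in> G" for g h using wedderburn_little[OF _ G] that by blast
  have "gen_ideal R e = R"
    using R(1) ideal_of_gen_ideal[OF U e(1)] e(2) by (auto simp: simple_subring_def)
  then have one: "1 \<in> gen_ideal R e" using d(1) by simp
  \<comment> \<open>For \<open>x\<close> a sum of products \<open>a * e * b\<close> the witness is
    the sum of the \<open>a * g * b\<close>: commutativity of \<open>e R e\<close> moves
    \<open>g\<close> past \<open>e * b * v * e\<close> to the right end.\<close>
  have right_mult: "\<exists>z\<in>R. \<forall>v\<in>L. z * v = x * v * g" if "x \<in> gen_ideal R e" "g \<in> G" for x g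
    using that(1)
  proof (induction rule: gen_ideal.induct)
    case zero then show ?case using d(2) by (intro bexI[of _ 0]) auto
  next
    case (add x a b)
    then obtain z where z: "z \<in> R" "\<forall>v\<in>L. z * v = x * v * g" by blast
    have "(z + a * g * b) * v = (x + a * e * b) * v * g" if v: "v \<in> L" for v
    proof -
      have h: "e * (b * v) * e \<in> G" by (rule GI[OF d(6)[OF add(3) LR[OF v]]])
      have "a * g * b * v = a * ((g * e) * (b * (v * e)))" using eG \<open>g \<in> G\<close> Le[OF v] by (simp add: mult.assoc)
      also have "\<dots> = a * (g * (e * (b * v) * e))" by (simp add: mult.assoc)
      also have "\<dots> = a * ((e * (b * v) * e) * g)" using Gcomm[OF \<open>g \<in> G\<close> h] by simp
      also have "\<dots> = a * e * b * (v * e) * g" by (simp add: mult.assoc)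
      also have "\<dots> = a * e * b * v * g" using Le[OF v] by simp
      finally show ?thesis using z(2) v by (simp add: distrib_right)
    qed
    moreover have "z + a * g * b \<in> R" using d z add GR \<open>g \<in> G\<close> by simp
    ultimately show ?case by blast
  qed
  \<comment> \<open>Right multiplication commutes with the left action of \<open>R\<close>, and
    faithfulness turns this into centrality of the representing element.\<close>
  have right_central: "\<exists>z\<in>centre_of R. \<forall>v\<in>L. z * v = v * g" if g: "g \<in> G" for g
  proof -
    obtain z where z: "z \<in> R" "\<And>v. v \<in> L \<Longrightarrow> z * v = v * g" using right_mult[OF one g] by auto
    have "z * r - r * z = 0" if r: "r \<in> R" for r
    proof (rule faithful)
      show "z * r - r * z \<in> R" using d z r by simp
      fix v assume v: "v \<in> L"
      have "z * (r * v) = r * (z * v)" using z(2)[OF RL[OF r v]] z(2)[OF v] by (simp add: mult.assoc)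
      then show "(z * r - r * z) * v = 0" by (simp add: left_diff_distrib mult.assoc)
    qed
    then show ?thesis using z by (auto simp: centre_of_def)
  qed
  \<comment> \<open>The witness is the sum of the \<open>T (a * e) * b\<close>. It works because
    \<open>a * e * b * v\<close> is \<open>a * e\<close> times the right scalar
    \<open>e * b * v * e\<close>, which acts as a central element and so passes through
    \<open>T\<close>.\<close>
  have dual: "\<exists>r\<in>R. \<forall>v\<in>L. T (x * v) = r * v"
    if "x \<in> gen_ideal R e" and Tadd: "\<And>v w. v \<in> L \<Longrightarrow> w \<in> L \<Longrightarrow> T (v + w) = T v + T w"
      and lin: "\<And>z v. z \<in> centre_of R \<Longrightarrow> v \<in> L \<Longrightarrow> T (z * v) = z * T v"
      and TL: "\<And>v. v \<in> L \<Longrightarrow> T v \<in> L" for x T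
    using that(1)
  proof (induction rule: gen_ideal.induct)
    case zero
    have "0 \<in> L" using L by (simp add: left_ideal_of_def)
    then have "T 0 = 0" using Tadd[of 0 0] by simp
    then show ?case using d(2) by (intro bexI[of _ 0]) auto
  next
    case (add x a b)
    then obtain r where r: "r \<in> R" "\<forall>v\<in>L. T (x * v) = r * v" by blast
    have "T ((x + a * e * b) * v) = (r + T (a * e) * b) * v" if v: "v \<in> L" for v
    proof -
      let ?g = "e * (b * v) * e"
      have g: "?g \<in> G" by (rule GI[OF d(6)[OF add(3) LR[OF v]]])
      obtain z where z: "z \<in> centre_of R" "\<forall>v\<in>L. z * v = v * ?g" using right_central[OF g] by blast
      have ae: "a * e \<in> L" by (rule LI[OF add(2)])
      have "a * e * b * v = a * (e * e) * b * (v * e)" using e Le[OF v] by simp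
      also have "\<dots> = a * e * ?g" by (simp add: mult.assoc)
      finally have 1: "a * e * b * v = z * (a * e)" using z ae by simp
      have "T (a * e) * b * v = (T (a * e) * e) * b * (v * e)" using Le[OF v] Le[OF TL[OF ae]] by simp
      also have "\<dots> = z * T (a * e)" using z TL[OF ae] by (simp add: mult.assoc)
      finally have 2: "T (a * e * b * v) = T (a * e) * b * v" using 1 lin[OF z(1) ae] by simp
      have "a * e * b * v \<in> L" "x * v \<in> L"
        using RL[OF d(6)[OF d(6)[OF add(2) e(1)] add(3)] v] RL v add(1) ideal_of_gen_ideal(1)[OF U e(1)]
        by (auto simp: ideal_of_def)
      then show ?thesis using Tadd r v 2 by (simp add: distrib_right)
    qed
    moreover have "r + T (a * e) * b \<in> R" using r d add LR TL LI by simp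
    ultimately show ?case by blast
  qed
  show ?thesis
  proof (rule that[OF L L0 faithful trans])
    fix T assume "\<And>v w. v \<in> L \<Longrightarrow> w \<in> L \<Longrightarrow> T (v + w) = T v + T w"
      "\<And>z v. z \<in> centre_of R \<Longrightarrow> v \<in> L \<Longrightarrow> T (z * v) = z * T v" "\<And>v. v \<in> L \<Longrightarrow> T v \<in> L"
    from dual[OF one this] show "\<exists>r\<in>R. \<forall>v\<in>L. T v = r * v" by simp
  qed
qed

section \<open>Proper subrings of a finite simple ring\<close>

abbreviation centre :: "'a::ring_1 set" where "centre \<equiv> centre_of UNIV"

text \<open>Minimality makes every noncentral element generate the field over the centre, so that a
  field can be recovered from a single element when fields are counted.\<close>

definition minimal_fields :: "'a::ring_1 set set" where
  "minimal_fields = {R. div_subring 1 R \<and> centre \<subset> R \<and>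
     (\<forall>R'. div_subring 1 R' \<longrightarrow> centre \<subset> R' \<longrightarrow> R' \<subseteq> R \<longrightarrow> R' = R)}"

lemma centre_commute: "z \<in> centre \<Longrightarrow> z * x = x * z"
  by (simp add: centre_of_def)

text \<open>\<open>End\<close> says that the ring is the full ring of centre-linear maps of
  \<open>V\<close>. \<open>Q\<close> is a parameter so that the two-element centre can be treated as
  the instance with \<open>Q\<close> replaced by 2.\<close>

locale simple_ring_module =
  fixes V :: "'a::ring_1 set" and Q :: nat
  assumes Q_def: "Q = card (centre :: 'a set)"
    and fin: "finite (UNIV :: 'a set)" and simple: "simple_subring (UNIV :: 'a set)"
    and V_ideal: "left_ideal_of UNIV V" and V0: "V \<noteq> {0}"
    and faithful: "\<And>r. (\<And>v. v \<in> V \<Longrightarrow> r * v = 0) \<Longrightarrow> r = 0"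
    and End: "\<And>T. (\<And>v w. v \<in> V \<Longrightarrow> w \<in> V \<Longrightarrow> T (v + w) = T v + T w) \<Longrightarrow>
      (\<And>z v. z \<in> centre \<Longrightarrow> v \<in> V \<Longrightarrow> T (z * v) = z * T v) \<Longrightarrow>
      (\<And>v. v \<in> V \<Longrightarrow> T v \<in> V) \<Longrightarrow> \<exists>r. \<forall>v\<in>V. T v = r * v"
begin

lemma finite_set: "finite (X :: 'a set)"
  using fin by (rule rev_finite_subset) simp

lemma left_ideal_space:
  assumes "left_ideal_of R L" "F \<subseteq> R" "unital_subring R"
  shows "lsubspace 1 F L"
proof -
  note L = assms(1)[unfolded left_ideal_of_def]
  note R = unital_subringD[OF assms(3)]
  have "- w \<in> L" if "w \<in> L" for w using L R(1,5) that by (metis mult_minus1)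
  then have "v - w \<in> L" if "v \<in> L" "w \<in> L" for v w using L that by (metis diff_conv_add_uminus)
  then show ?thesis using L assms(2) by (auto simp: lsubspace_def)
qed

lemma unital_UNIV: "unital_subring (UNIV :: 'a set)"
  using simple by (simp add: simple_subring_def)

sublocale finite_lspace 1 centre V
  using centre_div_subring[OF simple] left_ideal_space[OF V_ideal _ unital_UNIV] finite_set
  by unfold_locales auto

lemma V_closed: "v \<in> V \<Longrightarrow> r * v \<in> V"
  using V_ideal by (simp add: left_ideal_of_def)

lemma eq_on_V: "(\<And>v. v \<in> V \<Longrightarrow> a * v = b * v) \<Longrightarrow> a = b"
  using faithful[of "a - b"] by (simp add: left_diff_distrib)

section \<open>Subrings acting irreducibly\<close>

definition stable :: "'a set \<Rightarrow> 'a set \<Rightarrow> bool" where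
  "stable B W \<longleftrightarrow> (\<forall>b\<in>B. \<forall>w\<in>W. b * w \<in> W)"

lemma card_centre [simp]: "card (centre :: 'a set) = Q"
  by (simp add: Q_def)

lemma Q_ge_2: "2 \<le> Q"
  using card_F by simp

definition dim :: nat where "dim = (THE n. card V = Q ^ n)"

lemma card_V: "card V = Q ^ dim"
proof -
  obtain vs where "set vs \<subseteq> V" "lindep centre vs" "lspan centre vs = V"
    and vs: "card V = card (centre :: 'a set) ^ length vs" by (rule ex_basis)
  have "1 < Q" using Q_ge_2 by simp
  then have "dim = length vs" unfolding dim_def vs by (intro the_equality) (auto simp: power_inject_exp)
  then show ?thesis using vs by simp
qed

lemma length_basis:
  assumes "set vs \<subseteq> V" "lindep centre vs" "lspan centre vs = V"
  shows "length vs = dim"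
proof -
  have "1 < Q" using Q_ge_2 by simp
  then show ?thesis using card_lspan[OF assms(1,2)] card_V assms(3) by (simp add: power_inject_exp)
qed

text \<open>Schur's lemma: the kernel on \<open>V\<close> of an element commuting with
  \<open>B\<close> is \<open>B\<close>-stable, so a nonzero such \<open>c\<close> is injective on
  \<open>V\<close>. Hence left multiplication by \<open>c\<close> is injective on the finite ring,
  therefore surjective, and \<open>c\<close> is invertible.\<close>

lemma centralizer_field:
  assumes irr: "\<And>W. lsubspace 1 centre W \<Longrightarrow> W \<subseteq> V \<Longrightarrow> stable B W \<Longrightarrow> W = {0} \<or> W = V"
  shows "div_subring 1 {c. \<forall>b\<in>B. c * b = b * c}" (is "div_subring 1 ?C")
proof -
  have inv: "\<exists>y\<in>?C. y * c = 1" if c: "c \<in> ?C" "c \<noteq> 0" for c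
  proof -
    let ?K = "{v \<in> V. c * v = 0}"
    have "lsubspace 1 centre ?K"
      using VD centre_commute[of _ c] by (auto simp: lsubspace_def right_diff_distrib) (metis mult.assoc mult_zero_right)
    moreover have "stable B ?K"
      using c V_closed by (auto simp: stable_def) (metis mult.assoc mult_zero_right)
    ultimately have "?K = {0} \<or> ?K = V" using irr by blast
    moreover have "?K \<noteq> V" using faithful[of c] c by blast
    ultimately have K: "?K = {0}" by blast
    have c0: "a = 0" if "c * a = 0" for a
    proof (rule faithful)
      fix v assume "v \<in> V"
      then have "a * v \<in> ?K" using V_closed that by (simp flip: mult.assoc)
      then show "a * v = 0" using K by blast
    qed
    have "inj (\<lambda>x. c * x)"
      by (rule injI) (use c0 right_diff_distrib in \<open>metis eq_iff_diff_eq_0\<close>)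
    then have "surj (\<lambda>x. c * x)" using fin by (simp add: finite_UNIV_inj_surj)
    then obtain y where y: "c * y = 1" by (metis surjD)
    have "c * (y * c - 1) = 0" using y by (simp add: right_diff_distrib flip: mult.assoc)
    then have yc: "y * c = 1" using c0[of "y * c - 1"] by simp
    have "y * b = b * y" if "b \<in> B" for b
    proof -
      have "y * b = y * (b * c) * y" using y by (simp add: mult.assoc)
      also have "\<dots> = y * c * b * y" using c that by (simp add: mult.assoc)
      finally show ?thesis using yc by simp
    qed
    then show ?thesis using yc by auto
  qed
  have "(x - y) * b = b * (x - y) \<and> (x * y) * b = b * (x * y)" if "x * b = b * x" "y * b = b * y" for x y b :: 'a
    using that by (simp add: left_diff_distrib right_diff_distrib) (metis mult.assoc)
  then have "\<forall>x\<in>?C. \<forall>y\<in>?C. x - y \<in> ?C \<and> x * y \<in> ?C" by blast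
  then show ?thesis using inv unfolding div_subring_def by auto
qed

text \<open>The vectors killed by \<open>a B\<close> form a stable subspace. It is not
  \<open>V\<close> since \<open>a \<noteq> 0\<close>, so it is zero; but if \<open>a B b\<close>
  vanished it would contain \<open>b V\<close>.\<close>

lemma irreducible_prime:
  assumes B: "unital_subring B"
    and irr: "\<And>W. lsubspace 1 centre W \<Longrightarrow> W \<subseteq> V \<Longrightarrow> stable B W \<Longrightarrow> W = {0} \<or> W = V"
  shows "prime_subring B"
  unfolding prime_subring_def
proof (intro conjI ballI impI)
  fix a b assume ab: "a \<in> B" "b \<in> B" "a \<noteq> 0" "b \<noteq> 0"
  note d = unital_subringD[OF B]
  show "\<exists>r\<in>B. a * r * b \<noteq> 0"
  proof (rule ccontr)
    assume n: "\<not> ?thesis"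
    let ?W = "{v \<in> V. \<forall>r\<in>B. a * r * v = 0}"
    have "a * r * (z * v) = z * (a * r * v)" if "z \<in> centre" for r z v
      using centre_commute[OF that] by (metis mult.assoc)
    then have "lsubspace 1 centre ?W" using VD by (simp add: lsubspace_def right_diff_distrib)
    moreover have "stable B ?W"
      unfolding stable_def
    proof (intro ballI)
      fix s w assume s: "s \<in> B" "w \<in> ?W"
      have "a * r * (s * w) = a * (r * s) * w" for r by (simp add: mult.assoc)
      then show "s * w \<in> ?W" using s d(6) V_closed by simp
    qed
    ultimately have "?W = {0} \<or> ?W = V" using irr by blast
    moreover have "?W \<noteq> V"
    proof
      assume "?W = V"
      then have "a * 1 * v = 0" if "v \<in> V" for v using that d(1) by blast
      then show False using faithful[of a] ab by simp
    qed
    moreover have "b * v \<in> ?W" if "v \<in> V" for v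
      using that n V_closed by (simp flip: mult.assoc)
    ultimately have "b * v = 0" if "v \<in> V" for v using that by blast
    then show False using faithful ab by blast
  qed
qed (rule B)

text \<open>A maximal idempotent of an ideal is central, hence a unit.\<close>

lemma irreducible_simple:
  assumes B: "unital_subring B"
    and irr: "\<And>W. lsubspace 1 centre W \<Longrightarrow> W \<subseteq> V \<Longrightarrow> stable B W \<Longrightarrow> W = {0} \<or> W = V"
  shows "simple_subring B"
  unfolding simple_subring_def
proof (intro conjI allI impI)
  note d = unital_subringD[OF B]
  have prime: "prime_subring B" by (rule irreducible_prime[OF B irr])
  fix I assume I: "ideal_of B I"
  note i = I[unfolded ideal_of_def]
  have IB: "x \<in> B" if "x \<in> I" for x using i that by blast
  have Ir: "x * b \<in> I" "b * x \<in> I" if "x \<in> I" "b \<in> B" for x b using i that by auto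
  have Im: "- x \<in> I" if "x \<in> I" for x using i that d(1,5) by (metis mult_minus1)
  have Id: "x - y \<in> I" if "x \<in> I" "y \<in> I" for x y using Im i that by (metis diff_conv_add_uminus)
  show "I = {0} \<or> I = B"
  proof (rule disjCI)
    assume "I \<noteq> B"
    \<comment> \<open>Maximality of an idempotent is measured by its annihilator in \<open>I\<close>
      being as small as possible.\<close>
    define ann where "ann f = {x \<in> I. x * f = 0}" for f
    define P where "P f \<longleftrightarrow> f \<in> I \<and> f * f = f" for f
    have "P 0" using i by (simp add: P_def)
    then obtain f where f: "P f" and least: "\<And>g. P g \<Longrightarrow> card (ann f) \<le> card (ann g)"
      using ex_has_least_nat[of P 0 "\<lambda>f. card (ann f)"] by blast
    have ff: "f \<in> I" "f * f = f" using f by (auto simp: P_def)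
    have "ann f = {0}"
    proof (rule ccontr)
      assume n: "ann f \<noteq> {0}"
      have "left_ideal_of B (ann f)"
        using i unfolding left_ideal_of_def ann_def by (auto simp: distrib_right mult.assoc)
      then obtain g where g: "g \<in> ann f" "g \<noteq> 0" "g * g = g"
        using brauer_idempotent[OF prime finite_set _ n] by metis
      have gI: "g \<in> I" "g * f = 0" using g by (auto simp: ann_def)
      \<comment> \<open>The join of \<open>f\<close> and \<open>g\<close>: as
        \<open>g * f = 0\<close>, it is an idempotent fixing both from the left, and its annihilator
        loses \<open>g\<close>.\<close>
      define h where "h = f + g - f * g"
      have hI: "h \<in> I" using ff gI Id i Ir(1)[OF ff(1) IB[OF gI(1)]] unfolding h_def by blast
      have hf: "h * f = f" using ff gI by (simp add: h_def left_diff_distrib distrib_right mult.assoc)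
      have hg: "h * g = g" using g by (simp add: h_def left_diff_distrib distrib_right mult.assoc)
      have "h * h = h * f + h * g - h * f * g"
        by (subst (2) h_def) (simp add: right_diff_distrib distrib_left mult.assoc)
      then have "P h" using hI hf hg by (simp add: P_def h_def)
      have "ann h \<subseteq> ann f"
      proof
        fix x assume "x \<in> ann h"
        then have "x \<in> I" "x * h * f = 0" by (auto simp: ann_def)
        then show "x \<in> ann f" using hf by (simp add: ann_def mult.assoc)
      qed
      moreover have "g * h = g" using g gI
        by (simp add: h_def right_diff_distrib distrib_left flip: mult.assoc)
      then have "g \<notin> ann h" using g by (simp add: ann_def)
      ultimately have "ann h \<subset> ann f" using g by blast
      then have "card (ann h) < card (ann f)" using finite_set by (simp add: psubset_card_mono)
      then show False using least[OF \<open>P h\<close>] by simp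
    qed
    have right: "y * f = y" if "y \<in> I" for y
    proof -
      have "y - y * f \<in> ann f"
        using that Id Ir(1)[OF that IB[OF ff(1)]] ff by (simp add: ann_def left_diff_distrib mult.assoc)
      then show ?thesis using \<open>ann f = {0}\<close> by simp
    qed
    \<comment> \<open>Primeness turns the right unit \<open>f\<close> of \<open>I\<close> into a
      left unit: \<open>f * x = 0\<close> gives \<open>x * r * x = x * f * r * f * x = 0\<close> for
      all \<open>r\<close>.\<close>
    have zero: "x = 0" if x: "x \<in> I" "f * x = 0" for x
    proof (rule ccontr)
      assume "x \<noteq> 0"
      then obtain r where r: "r \<in> B" "x * r * x \<noteq> 0" using prime IB x unfolding prime_subring_def by blast
      have "x * r * x = x * (f * r) * x" using right[OF x(1)] by (simp flip: mult.assoc)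
      also have "f * r = f * r * f" using right Ir(1)[OF ff(1) r(1)] by simp
      also have "x * (f * r * f) * x = 0" using x by (simp add: mult.assoc)
      finally show False using r by simp
    qed
    have left: "f * y = y" if "y \<in> I" for y
    proof -
      have "f * (y - f * y) = 0" using ff by (simp add: right_diff_distrib flip: mult.assoc)
      then show ?thesis using zero[of "y - f * y"] Id that Ir(2)[OF that IB[OF ff(1)]] by simp
    qed
    have fC: "f \<in> {c. \<forall>b\<in>B. c * b = b * c}"
    proof (intro CollectI ballI)
      fix b assume b: "b \<in> B"
      have "f * b = f * b * f" using right Ir(1)[OF ff(1) b] by simp
      also have "\<dots> = b * f" using left Ir(2)[OF ff(1) b] by (simp add: mult.assoc)
      finally show "f * b = b * f" .
    qed
    have field: "div_subring 1 {c. \<forall>b\<in>B. c * b = b * c}" by (rule centralizer_field[OF irr])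
    have "f = 0"
    proof (rule ccontr)
      assume "f \<noteq> 0"
      then obtain y where "y * f = 1" using div_subring_inv[OF field fC] by metis
      have "f = y * f * f" using \<open>y * f = 1\<close> by simp
      also have "\<dots> = y * f" using ff by (simp only: mult.assoc)
      also have "\<dots> = 1" by fact
      finally have "f = 1" .
      then have "I = B" using ff i by (metis mult_1_right subset_antisym subsetI)
      then show False using \<open>I \<noteq> B\<close> by simp
    qed
    then show "I = {0}" using right i by force
  qed
qed (rule B)

text \<open>Since the centre \<open>F\<close> of \<open>B\<close> lies in the centre of the ring, a minimal left ideal of
  \<open>B\<close> provides an \<open>F\<close>-form of \<open>V\<close>.\<close>

lemma irreducible_form:
  assumes B: "unital_subring B" "B \<noteq> UNIV"
    and irr: "\<And>W. lsubspace 1 centre W \<Longrightarrow> W \<subseteq> V \<Longrightarrow> stable B W \<Longrightarrow> W = {0} \<or> W = V"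
    and cent: "{c. \<forall>b\<in>B. c * b = b * c} = centre"
  obtains F bs where "div_subring 1 F" "F \<subset> centre" "set bs \<subseteq> V" "lindep centre bs"
    "length bs = dim" "stable B (lspan F bs)"
proof -
  have sB: "simple_subring B" by (rule irreducible_simple[OF B(1) irr])
  note dB = unital_subringD[OF B(1)]
  obtain M where M: "left_ideal_of B M" "M \<noteq> {0}"
    and trans: "\<And>v w. v \<in> M \<Longrightarrow> v \<noteq> 0 \<Longrightarrow> w \<in> M \<Longrightarrow> \<exists>r\<in>B. r * v = w"
    and EndM: "\<And>T. (\<And>v w. v \<in> M \<Longrightarrow> w \<in> M \<Longrightarrow> T (v + w) = T v + T w) \<Longrightarrow>
      (\<And>z v. z \<in> centre_of B \<Longrightarrow> v \<in> M \<Longrightarrow> T (z * v) = z * T v) \<Longrightarrow>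
      (\<And>v. v \<in> M \<Longrightarrow> T v \<in> M) \<Longrightarrow> \<exists>r\<in>B. \<forall>v\<in>M. T v = r * v"
  proof (rule simple_subring_structure[OF sB finite_set], goal_cases)
    case (1 L)
    from 1(1)[OF 1(2,3,5,6)] show ?case .
  qed
  define F where "F = centre_of B"
  have F: "div_subring 1 F" using centre_div_subring[OF sB] by (simp add: F_def)
  have FB: "F \<subseteq> B" by (auto simp: F_def centre_of_def)
  have FZ: "F \<subseteq> centre" unfolding cent[symmetric] by (auto simp: F_def centre_of_def)
  interpret M: finite_lspace 1 F M
    using F left_ideal_space[OF M(1) FB B(1)] finite_set by unfold_locales auto
  have BM: "b * m \<in> M" if "b \<in> B" "m \<in> M" for b m using M(1) that by (simp add: left_ideal_of_def)
  obtain m0 where m0: "m0 \<in> M" "m0 \<noteq> 0" using M by (auto simp: left_ideal_of_def)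
  then obtain v where v: "v \<in> V" "m0 * v \<noteq> 0" using faithful by blast
  \<comment> \<open>Multiplication by \<open>v\<close> embeds the minimal left ideal
    \<open>M\<close> in \<open>V\<close>: if it killed a nonzero \<open>m\<close>, then by
    transitivity of \<open>B\<close> on \<open>M\<close> it would kill \<open>m0\<close>.\<close>
  have inj: "m = 0" if m: "m \<in> M" "m * v = 0" for m
  proof (rule ccontr)
    assume "m \<noteq> 0"
    then obtain r where "r * m = m0" using trans[OF m(1) _ m0(1)] by blast
    then show False using v m by (metis mult.assoc mult_zero_right)
  qed
  obtain ls where ls: "set ls \<subseteq> M" "lindep F ls" "lspan F ls = M"
    "card M = card F ^ length ls" by (rule M.ex_basis)
  define bs where "bs = map (\<lambda>m. m * v) ls"
  have bV: "set bs \<subseteq> V" using v V_closed by (auto simp: bs_def)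
  \<comment> \<open>Independence survives the passage from \<open>F\<close> to the centre: some
    \<open>b\<close> in \<open>B\<close> fixes \<open>l\<close> and kills the later basis vectors,
    since all \<open>F\<close>-linear maps of \<open>M\<close> come from \<open>B\<close>. As
    \<open>b\<close> commutes with the centre, it kills the span of the later vectors in
    \<open>V\<close>, but it fixes \<open>l * v\<close>.\<close>
  have indep: "lindep centre (map (\<lambda>m. m * v) xs)" if "set xs \<subseteq> M" "lindep F xs" for xs
    using that
  proof (induction xs)
    case (Cons l xs)
    have "l * v \<notin> lspan centre (map (\<lambda>m. m * v) xs)"
    proof
      assume in_span: "l * v \<in> lspan centre (map (\<lambda>m. m * v) xs)"
      obtain us where us: "set us \<subseteq> M" "lindep F (us @ l # xs)" "lspan F (us @ l # xs) = M"
        using M.lindep_extend[OF Cons.prems] by metis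
      have zs: "set (map (\<lambda>_. 0) us @ l # map (\<lambda>_. 0) xs) \<subseteq> M" and us': "set (us @ l # xs) \<subseteq> M"
        using us Cons.prems M.VD(1) by auto
      obtain T where T: "\<And>x y. x \<in> M \<Longrightarrow> y \<in> M \<Longrightarrow> T (x + y) = T x + T y"
        "\<And>c x. c \<in> F \<Longrightarrow> x \<in> M \<Longrightarrow> T (c * x) = c * T x" "\<And>x. x \<in> M \<Longrightarrow> T x \<in> M"
        "map T (us @ l # xs) = map (\<lambda>_. 0) us @ l # map (\<lambda>_. 0) xs"
        by (rule M.ex_endomorphism[OF us' us(2,3) zs]) (use that in auto)
      obtain b where b: "b \<in> B" "\<forall>m\<in>M. T m = b * m" using EndM[of T] T(1-3) by (auto simp: F_def)
      have "T l = l" "\<forall>x\<in>set xs. T x = 0" using T(4) by auto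
      then have bl: "b * l = l" "\<And>x. x \<in> set xs \<Longrightarrow> b * x = 0"
      proof -
        have "l \<in> M" and xs: "set xs \<subseteq> M" using Cons.prems by auto
        then show "b * l = l" using b(2) \<open>T l = l\<close> by metis
        show "b * x = 0" if "x \<in> set xs" for x using b(2) xs that \<open>\<forall>x\<in>set xs. T x = 0\<close> by (metis subsetD)
      qed
      have "b * x = 0" if "x \<in> lspan centre (map (\<lambda>m. m * v) ys)" "\<forall>x\<in>set ys. b * x = 0" for x ys
        using that
      proof (induction ys arbitrary: x)
        case (Cons y ys)
        then obtain c s where cs: "x = c * (y * v) + s" "c \<in> centre" "s \<in> lspan centre (map (\<lambda>m. m * v) ys)" by auto
        have "b * (c * (y * v)) = c * (b * y * v)" using centre_commute[OF cs(2), of b] by (metis mult.assoc)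
        then show ?case using cs Cons by (simp add: distrib_left)
      qed simp
      then have "b * (l * v) = 0" using in_span bl by blast
      then have "l * v = 0" using bl by (simp flip: mult.assoc)
      then have "l = 0" using inj Cons.prems by auto
      then show False using Cons.prems zero_in_lspan[OF M.FD(3)] by auto
    qed
    then show ?case using Cons by simp
  qed simp
  have bi: "lindep centre bs" using indep ls by (simp add: bs_def)
  have spanF: "lspan F (map (\<lambda>m. m * v) xs) = (\<lambda>m. m * v) ` lspan F xs" for xs
  proof (induction xs)
    case (Cons x xs)
    have "(c * x + s) * v = c * (x * v) + s * v" for c s by (simp add: distrib_right mult.assoc)
    then show ?case using Cons by (auto 4 4 simp: image_iff)
  qed simp
  then have U: "lspan F bs = (\<lambda>m. m * v) ` M" using ls by (simp add: bs_def)
  have st: "stable B (lspan F bs)" unfolding U stable_def using BM by (auto simp flip: mult.assoc)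
  have mono: "lspan F xs \<subseteq> lspan centre xs" for xs
    using FZ by (induction xs) auto
  \<comment> \<open>The centre-span of the form is stable and nonzero, so irreducibility makes it
    all of \<open>V\<close>.\<close>
  have spanV: "lspan centre bs = V"
  proof -
    note sub = lsubspace_lspan[OF bV]
    have "stable B (lspan centre bs)"
    proof -
      let ?W = "{w \<in> V. \<forall>b\<in>B. b * w \<in> lspan centre bs}"
      note s = lsubspaceD[OF sub]
      have "b * (z * w) = z * (b * w)" if "z \<in> centre" for b z w
        using centre_commute[OF that] by (metis mult.assoc)
      then have "c * v \<in> ?W" if cv: "c \<in> centre" "v \<in> ?W" for c v
      proof (intro CollectI conjI ballI)
        show "c * v \<in> V" using cv VD(4) by simp
        fix b assume "b \<in> B"
        then have "c * (b * v) \<in> lspan centre bs" using cv s(4) by simp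
        then show "b * (c * v) \<in> lspan centre bs" using \<open>\<And>z b w. z \<in> centre \<Longrightarrow> b * (z * w) = z * (b * w)\<close> cv(1) by metis
      qed
      then have "lsubspace 1 centre ?W" using VD s by (simp add: lsubspace_def right_diff_distrib)
      moreover have "set bs \<subseteq> ?W"
      proof
        fix x assume x: "x \<in> set bs"
        have "x \<in> lspan F bs" unfolding U using x ls(1) unfolding bs_def by auto
        then have "b * x \<in> lspan centre bs" if "b \<in> B" for b
          using st that mono by (auto simp: stable_def)
        then show "x \<in> ?W" using x bV by auto
      qed
      ultimately have "lspan centre bs \<subseteq> ?W" by (rule lspan_subset)
      then show ?thesis by (auto simp: stable_def)
    qed
    then have "lspan centre bs = {0} \<or> lspan centre bs = V"
      using irr sub lspan_subset[OF V bV] by blast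
    moreover have "m0 * v \<in> lspan centre bs" using m0 mono U by blast
    ultimately show ?thesis using v by auto
  qed
  have len: "length bs = dim" using length_basis[OF bV bi spanV] .
  \<comment> \<open>Otherwise \<open>M\<close> is identified with \<open>V\<close>, every ring
    element becomes an \<open>F\<close>-linear map of \<open>M\<close>, and such maps come from
    \<open>B\<close>; so \<open>B\<close> would be everything.\<close>
  have "F \<noteq> centre"
  proof
    assume "F = centre"
    then have UV: "(\<lambda>m. m * v) ` M = V" using U spanV by simp
    have inj2: "m = m'" if "m \<in> M" "m' \<in> M" "m * v = m' * v" for m m'
      using inj[of "m - m'"] M.VD(2) that by (simp add: left_diff_distrib)
    have "a \<in> B" for a
    proof -
      define T where "T m = (THE m'. m' \<in> M \<and> m' * v = a * (m * v))" for m
      have T: "T m \<in> M \<and> T m * v = a * (m * v)" if "m \<in> M" for m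
        unfolding T_def
      proof (rule theI')
        have "m * v \<in> V" using v V_closed by blast
        then have "a * (m * v) \<in> V" by (rule V_closed)
        then obtain m' where "m' \<in> M" "m' * v = a * (m * v)" using UV by (metis imageE)
        then show "\<exists>!m'. m' \<in> M \<and> m' * v = a * (m * v)" using inj2 by metis
      qed
      have "T (x + y) = T x + T y" if "x \<in> M" "y \<in> M" for x y
      proof (rule inj2)
        show "T (x + y) * v = (T x + T y) * v"
          using T[OF that(1)] T[OF that(2)] T[OF M.VD(3)[OF that]] by (simp add: distrib_left distrib_right)
      qed (use T that M.VD(3) in blast)+
      moreover have "T (c * x) = c * T x" if c: "c \<in> F" and "x \<in> M" for c x
      proof (rule inj2)
        have "c * a = a * c" using centre_commute[of c a] c FZ by blast
        have "T (c * x) * v = a * c * (x * v)"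
          using T[OF M.VD(4)[OF c \<open>x \<in> M\<close>]] by (simp only: mult.assoc)
        also have "\<dots> = c * (a * (x * v))" unfolding \<open>c * a = a * c\<close>[symmetric] by (simp only: mult.assoc)
        also have "\<dots> = c * T x * v" using T[OF \<open>x \<in> M\<close>] by (simp only: mult.assoc)
        finally show "T (c * x) * v = c * T x * v" .
      qed (use T c \<open>x \<in> M\<close> M.VD(4) in blast)+
      ultimately obtain b where b: "b \<in> B" "\<forall>m\<in>M. T m = b * m"
        using EndM[of T] T by (auto simp: F_def)
      have "a = b"
      proof (rule eq_on_V)
        fix w assume "w \<in> V"
        then obtain m where m: "m \<in> M" "w = m * v" using UV by blast
        then have "a * w = T m * v" using T by simp
        then show "a * w = b * w" using b m by (simp add: mult.assoc)
      qed
      then show ?thesis using b by simp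
    qed
    then show False using B(2) by blast
  qed
  then show ?thesis using that F FZ bV bi len st by blast
qed

theorem proper_subring_cases:
  assumes B: "unital_subring B" "B \<noteq> UNIV"
  obtains (reducible) W where "lsubspace 1 centre W" "W \<subseteq> V" "W \<noteq> {0}" "W \<noteq> V" "stable B W"
  | (centralizes) R where "R \<in> minimal_fields" "\<And>b c. b \<in> B \<Longrightarrow> c \<in> R \<Longrightarrow> b * c = c * b"
  | (form) F bs where "div_subring 1 F" "F \<subset> centre" "set bs \<subseteq> V" "lindep centre bs"
      "length bs = dim" "stable B (lspan F bs)"
proof (cases "\<exists>W. lsubspace 1 centre W \<and> W \<subseteq> V \<and> W \<noteq> {0} \<and> W \<noteq> V \<and> stable B W")
  case True
  then show ?thesis using reducible by blast
next
  case False
  then have irr: "\<And>W. lsubspace 1 centre W \<Longrightarrow> W \<subseteq> V \<Longrightarrow> stable B W \<Longrightarrow> W = {0} \<or> W = V" by blast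
  define C where "C = {c. \<forall>b\<in>B. c * b = b * c}"
  have C: "div_subring 1 C" unfolding C_def by (rule centralizer_field[OF irr])
  have ZC: "centre \<subseteq> C" by (auto simp: C_def centre_of_def)
  show ?thesis
  proof (cases "C = centre")
    case True
    then have cent: "{c. \<forall>b\<in>B. c * b = b * c} = centre" by (simp add: C_def)
    show ?thesis by (rule irreducible_form[OF B irr cent]) (use form in blast)+
  next
    case False
    \<comment> \<open>A field between the centre and a member of \<open>P\<close> is itself a member
      of \<open>P\<close>, so smallest order inside \<open>C\<close> gives minimality
      outright.\<close>
    define P where "P R \<longleftrightarrow> div_subring 1 R \<and> centre \<subset> R \<and> R \<subseteq> C" for R
    have "P C" using C ZC False by (auto simp: P_def)
    then obtain R where R: "P R" and least: "\<And>R'. P R' \<Longrightarrow> card R \<le> card R'"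
      using ex_has_least_nat[of P C card] by blast
    have "R' = R" if "div_subring 1 R'" "centre \<subset> R'" "R' \<subseteq> R" for R'
    proof (rule card_seteq[OF finite_set that(3)])
      show "card R \<le> card R'" using least[of R'] that R by (auto simp: P_def)
    qed
    then have "R \<in> minimal_fields" using R by (auto simp: minimal_fields_def P_def)
    moreover have "b * c = c * b" if "b \<in> B" "c \<in> R" for b c using that R by (auto simp: P_def C_def)
    ultimately show ?thesis using centralizes by blast
  qed
qed

end

section \<open>Counting operators and subspaces\<close>

lemma card_list_all2_mem:
  "card {ws. list_all2 (\<in>) ws Ss} = prod_list (map card Ss)"
proof (induction Ss)
  case (Cons S Ss)
  have "{ws. list_all2 (\<in>) ws (S # Ss)} = (\<lambda>(w, ws). w # ws) ` (S \<times> {ws. list_all2 (\<in>) ws Ss})"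
    by (auto simp: list_all2_Cons2 image_iff)
  moreover have "inj_on (\<lambda>(w, ws). w # ws) (S \<times> {ws. list_all2 (\<in>) ws Ss})" by (auto intro!: inj_onI)
  ultimately show ?case using Cons by (simp add: card_image card_cartesian_product)
qed simp

lemma list_all2_replicate_iff:
  "n = length vs \<Longrightarrow> list_all2 P vs (replicate n S) \<longleftrightarrow> (\<forall>v\<in>set vs. P v S)"
  by (induction vs arbitrary: n) auto

lemma prod_list_replicate_nat: "prod_list (replicate k x) = (x :: nat) ^ k"
  by (induction k) auto

text \<open>Explicit coefficient lists, needed to compare the linear relations satisfied by two
  different field generators.\<close>

definition lcomb :: "'a::ring_1 list \<Rightarrow> 'a list \<Rightarrow> 'a" where
  "lcomb cs vs = sum_list (map2 (*) cs vs)"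

lemma lspan_eq_lcomb:
  "lspan F vs = {lcomb cs vs | cs. set cs \<subseteq> F \<and> length cs = length vs}"
proof (induction vs)
  case (Cons v vs)
  show ?case
  proof (intro equalityI subsetI)
    fix x assume "x \<in> lspan F (v # vs)"
    then obtain c cs where "x = c * v + lcomb cs vs" "c \<in> F" "set cs \<subseteq> F" "length cs = length vs"
      using Cons by auto
    then show "x \<in> {lcomb cs (v # vs) | cs. set cs \<subseteq> F \<and> length cs = length (v # vs)}"
      by (auto simp: lcomb_def intro!: exI[of _ "c # cs"])
  next
    fix x assume "x \<in> {lcomb cs (v # vs) | cs. set cs \<subseteq> F \<and> length cs = length (v # vs)}"
    then obtain c cs where "x = lcomb (c # cs) (v # vs)" "c \<in> F" "set cs \<subseteq> F" "length cs = length vs"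
      by (auto simp: length_Suc_conv)
    then show "x \<in> lspan F (v # vs)" using Cons by (auto simp: lcomb_def)
  qed
qed (auto simp: lcomb_def)

lemma lcomb_mult_right: "lcomb cs vs * w = lcomb cs (map (\<lambda>v. v * w) vs)"
  unfolding lcomb_def
  by (induction cs vs rule: list_induct2') (auto simp: distrib_right mult.assoc)

lemma lspan_mult_right: "x \<in> lspan F vs \<Longrightarrow> x * w \<in> lspan F (map (\<lambda>v. v * w) vs)"
  unfolding lspan_eq_lcomb using lcomb_mult_right by fastforce

lemma agree_on_lspan:
  assumes "\<And>c. c \<in> F \<Longrightarrow> a * c = c * a" "\<And>c. c \<in> F \<Longrightarrow> b * c = c * b"
    "\<And>v. v \<in> set vs \<Longrightarrow> a * v = b * v" "x \<in> lspan F vs"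
  shows "a * x = b * x"
  using assms(3,4)
proof (induction vs arbitrary: x)
  case (Cons v vs)
  then obtain c s where cs: "x = c * v + s" "c \<in> F" "s \<in> lspan F vs" by auto
  have "a * (c * v) = c * (a * v)" using assms(1)[OF cs(2)] by (metis mult.assoc)
  moreover have "b * (c * v) = c * (b * v)" using assms(2)[OF cs(2)] by (metis mult.assoc)
  ultimately show ?case using Cons cs by (simp add: distrib_left)
qed simp

lemma finite_subring_div_subring:
  assumes R: "div_subring 1 R" "finite R" and S: "unital_subring S" "S \<subseteq> R"
  shows "div_subring 1 S"
proof -
  note d = unital_subringD[OF S(1)]
  have "\<exists>y\<in>S. y * x = 1" if x: "x \<in> S" "x \<noteq> 0" for x
  proof -
    have "inj_on (\<lambda>y. y * x) S"
    proof (rule inj_onI)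
      fix y z assume yz: "y \<in> S" "z \<in> S" "y * x = z * x"
      then have "(y - z) * x = 0" by (simp add: left_diff_distrib)
      moreover have "y - z \<in> R" "x \<in> R" using d(3) yz x S by auto
      ultimately show "y = z" using div_subring_no_zero_divisors[OF R(1)] x by fastforce
    qed
    moreover have "(\<lambda>y. y * x) ` S \<subseteq> S" using d(6) x by auto
    moreover have "finite S" using S R by (auto intro: finite_subset)
    ultimately have "(\<lambda>y. y * x) ` S = S" by (simp add: endo_inj_surj)
    then show ?thesis using d(1) by (metis imageE)
  qed
  then show ?thesis using S(1) by (auto simp: div_subring_def unital_subring_def)
qed

context simple_ring_module
begin

lemma determined_by_basis:
  assumes "\<And>c. c \<in> F \<Longrightarrow> a * c = c * a" "\<And>c. c \<in> F \<Longrightarrow> b * c = c * b"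
    "\<And>v. v \<in> set vs \<Longrightarrow> a * v = b * v" "lspan F vs = V"
  shows "a = b"
  using eq_on_V agree_on_lspan[OF assms(1-3)] assms(4) by metis

text \<open>By \<open>End\<close> the images of a basis can be prescribed freely, and they determine
  the ring element, so the conditions on the basis vectors are independent.\<close>

lemma card_operators:
  assumes vs: "set vs \<subseteq> V" "lindep centre vs" "lspan centre vs = V"
    and Ss: "length Ss = length vs" "\<And>S. S \<in> set Ss \<Longrightarrow> S \<subseteq> V"
  shows "card {a. list_all2 (\<lambda>v S. a * v \<in> S) vs Ss} = prod_list (map card Ss)"
proof -
  have "bij_betw (\<lambda>a. map ((*) a) vs) {a. list_all2 (\<lambda>v S. a * v \<in> S) vs Ss} {ws. list_all2 (\<in>) ws Ss}"
    unfolding bij_betw_def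
  proof (intro conjI equalityI subsetI)
    show "inj_on (\<lambda>a. map ((*) a) vs) {a. list_all2 (\<lambda>v S. a * v \<in> S) vs Ss}"
    proof (rule inj_onI)
      fix a b assume "map ((*) a) vs = map ((*) b) vs"
      then have "\<And>v. v \<in> set vs \<Longrightarrow> a * v = b * v" by simp
      then show "a = b" using determined_by_basis[OF _ _ _ vs(3)] centre_commute by metis
    qed
  next
    fix ws assume "ws \<in> (\<lambda>a. map ((*) a) vs) ` {a. list_all2 (\<lambda>v S. a * v \<in> S) vs Ss}"
    then show "ws \<in> {ws. list_all2 (\<in>) ws Ss}" by (auto simp: list.rel_map)
  next
    fix ws assume "ws \<in> {ws. list_all2 (\<in>) ws Ss}"
    then have ws: "list_all2 (\<in>) ws Ss" by simp
    then have len: "length ws = length vs" using Ss by (auto dest: list_all2_lengthD)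
    have "set ws \<subseteq> V"
    proof
      fix w assume "w \<in> set ws"
      then obtain i where "i < length ws" "w = ws ! i" by (auto simp: in_set_conv_nth)
      then show "w \<in> V" using ws Ss list_all2_nthD[OF ws, of i] list_all2_lengthD[OF ws] nth_mem[of i Ss] by fastforce
    qed
    then have wsV: "set ws \<subseteq> V" .
    obtain T where T: "\<And>x y. x \<in> V \<Longrightarrow> y \<in> V \<Longrightarrow> T (x + y) = T x + T y"
      "\<And>c x. c \<in> centre \<Longrightarrow> x \<in> V \<Longrightarrow> T (c * x) = c * T x" "\<And>x. x \<in> V \<Longrightarrow> T x \<in> V" "map T vs = ws"
      by (rule ex_endomorphism[OF vs wsV len]) (use that in auto)
    obtain a where a: "\<forall>v\<in>V. T v = a * v" using End[of T] T(1-3) by blast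
    then have "map ((*) a) vs = ws" using T(4) vs(1) by (metis map_cong subsetD)
    moreover from this have "list_all2 (\<lambda>v S. a * v \<in> S) vs Ss" using ws by (auto simp: list.rel_map)
    ultimately show "ws \<in> (\<lambda>a. map ((*) a) vs) ` {a. list_all2 (\<lambda>v S. a * v \<in> S) vs Ss}" by blast
  qed
  then show ?thesis using card_list_all2_mem by (metis bij_betw_same_card)
qed

text \<open>Serves two purposes: for centralizers, \<open>F\<close> is an extension field and its
  bases of \<open>V\<close> are short; for stabilizers of forms, \<open>F\<close> is the centre and
  the images are confined to a small \<open>S\<close>.\<close>

lemma card_operators_le:
  assumes "\<And>a c. a \<in> X \<Longrightarrow> c \<in> F \<Longrightarrow> a * c = c * a" "lspan F vs = V"
    "\<And>a v. a \<in> X \<Longrightarrow> v \<in> set vs \<Longrightarrow> a * v \<in> S"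
  shows "card X \<le> card S ^ length vs"
proof -
  let ?L = "{ws. set ws \<subseteq> S \<and> length ws = length vs}"
  have "inj_on (\<lambda>a. map ((*) a) vs) X"
  proof (rule inj_onI)
    fix a b assume ab: "a \<in> X" "b \<in> X" "map ((*) a) vs = map ((*) b) vs"
    then have "\<And>v. v \<in> set vs \<Longrightarrow> a * v = b * v" by simp
    then show "a = b" using determined_by_basis[OF assms(1)[OF ab(1)] assms(1)[OF ab(2)] _ assms(2)] by blast
  qed
  moreover have "(\<lambda>a. map ((*) a) vs) ` X \<subseteq> ?L" using assms(3) by auto
  ultimately have "card X \<le> card ?L"
    by (rule card_inj_on_le[OF _ _ finite_lists_length_eq[OF finite_set]])
  then show ?thesis by (simp add: card_lists_length_eq finite_set)
qed

lemma obtain_basis: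
  obtains vs where "set vs \<subseteq> V" "lindep centre vs" "lspan centre vs = V" "length vs = dim"
proof -
  obtain vs where vs: "set vs \<subseteq> V" "lindep centre vs" "lspan centre vs = V"
    "card V = card (centre :: 'a set) ^ length vs" by (rule ex_basis)
  then show ?thesis using that length_basis by blast
qed

lemma card_ring: "card (UNIV :: 'a set) = Q ^ (dim * dim)"
proof -
  obtain vs where vs: "set vs \<subseteq> V" "lindep centre vs" "lspan centre vs = V" "length vs = dim"
    by (rule obtain_basis)
  have "card {a. list_all2 (\<lambda>v S. a * v \<in> S) vs (replicate dim V)} = prod_list (map card (replicate dim V))"
    using vs by (intro card_operators) auto
  moreover have "{a. list_all2 (\<lambda>v S. a * v \<in> S) vs (replicate dim V)} = UNIV"
    using vs V_closed by (auto simp: list_all2_replicate_iff subset_iff)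
  ultimately show ?thesis by (simp add: prod_list_replicate_nat card_V power_mult)
qed

section \<open>Stabilizers and numbers of subspaces\<close>

definition stabilizer :: "'a set \<Rightarrow> 'a set" where
  "stabilizer W = {a. \<forall>w\<in>W. a * w \<in> W}"

definition subspaces :: "nat \<Rightarrow> 'a set set" where
  "subspaces d = {W. lsubspace 1 centre W \<and> W \<subseteq> V \<and> card W = Q ^ d}"

lemma subspace_lspace: "W \<in> subspaces d \<Longrightarrow> finite_lspace 1 centre W"
  using finite_lspace_subspace[OF finite_lspace_axioms] by (auto simp: subspaces_def)

lemma subspace_basis:
  assumes "W \<in> subspaces d"
  obtains us ws where "set ws \<subseteq> W" "lindep centre ws" "lspan centre ws = W" "length ws = d"
    "set us \<subseteq> V" "lindep centre (us @ ws)" "lspan centre (us @ ws) = V" "length us + d = dim"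
proof -
  interpret W: finite_lspace 1 centre W using subspace_lspace[OF assms] .
  have WV: "W \<subseteq> V" "card W = Q ^ d" using assms by (auto simp: subspaces_def)
  obtain ws where ws: "set ws \<subseteq> W" "lindep centre ws" "lspan centre ws = W"
    "card W = card (centre :: 'a set) ^ length ws"
    by (rule W.ex_basis)
  have "1 < Q" using Q_ge_2 by simp
  then have len: "length ws = d" using WV ws by (simp add: power_inject_exp)
  obtain us where us: "set us \<subseteq> V" "lindep centre (us @ ws)" "lspan centre (us @ ws) = V"
    using lindep_extend[of ws] ws WV by auto
  have "length (us @ ws) = dim" using us ws WV by (intro length_basis) auto
  then show ?thesis using that ws us len by simp
qed

text \<open>Block triangular matrices: in a basis extending one of \<open>W\<close>, each of the
  \<open>dim - d\<close> added vectors may go anywhere in \<open>V\<close>, and each of the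
  \<open>d\<close> others anywhere in \<open>W\<close>.\<close>

lemma card_stabilizer:
  assumes "W \<in> subspaces d"
  shows "card (stabilizer W) = Q ^ (dim * (dim - d) + d * d)"
proof -
  obtain us ws where ws: "set ws \<subseteq> W" "lindep centre ws" "lspan centre ws = W" "length ws = d"
    "set us \<subseteq> V" "lindep centre (us @ ws)" "lspan centre (us @ ws) = V" "length us + d = dim"
    by (rule subspace_basis[OF assms])
  have W: "W \<subseteq> V" "card W = Q ^ d" "lsubspace 1 centre W" using assms by (auto simp: subspaces_def)
  let ?Ss = "replicate (length us) V @ replicate d W"
  have "stabilizer W = {a. list_all2 (\<lambda>v S. a * v \<in> S) (us @ ws) ?Ss}"
  proof (intro equalityI subsetI)
    fix a assume "a \<in> stabilizer W"
    then have "\<forall>v\<in>set us. a * v \<in> V" "\<forall>v\<in>set ws. a * v \<in> W"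
      using ws V_closed by (auto simp: stabilizer_def)
    then show "a \<in> {a. list_all2 (\<lambda>v S. a * v \<in> S) (us @ ws) ?Ss}"
      using ws(4) by (auto simp: list_all2_append list_all2_replicate_iff)
  next
    fix a assume "a \<in> {a. list_all2 (\<lambda>v S. a * v \<in> S) (us @ ws) ?Ss}"
    then have a: "\<And>w. w \<in> set ws \<Longrightarrow> a * w \<in> W"
      using ws(4) by (auto simp: list_all2_append list_all2_replicate_iff)
    let ?W = "{w \<in> W. a * w \<in> W}"
    note d = lsubspaceD[OF W(3)]
    have "a * (z * w) = z * (a * w)" if "z \<in> centre" for z w
      using centre_commute[OF that] by (metis mult.assoc)
    then have "z * w \<in> ?W" if zw: "z \<in> centre" "w \<in> ?W" for z w
    proof -
      have "z * (a * w) \<in> W" "z * w \<in> W" using zw d(4) by auto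
      then show ?thesis using \<open>\<And>z w. z \<in> centre \<Longrightarrow> a * (z * w) = z * (a * w)\<close> zw(1) by simp
    qed
    then have "lsubspace 1 centre ?W" using d by (simp add: lsubspace_def right_diff_distrib)
    moreover have "set ws \<subseteq> ?W" using a ws by auto
    ultimately have "lspan centre ws \<subseteq> ?W" by (rule lspan_subset)
    then show "a \<in> stabilizer W" using ws by (auto simp: stabilizer_def)
  qed
  also have "card \<dots> = prod_list (map card ?Ss)"
    using ws W by (intro card_operators) (auto split: if_splits)
  also have "\<dots> = Q ^ (dim * (dim - d) + d * d)"
  proof -
    have "length us = dim - d" using ws(8) by simp
    then show ?thesis using W by (simp add: prod_list_replicate_nat card_V power_add power_mult)
  qed
  finally show ?thesis .
qed

text \<open>The Gaussian binomial coefficient, kept as a product to stay within \<open>nat\<close>: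
  independent lists of length \<open>d\<close> are sorted by their span.\<close>

lemma card_subspaces:
  "card (subspaces d) * (\<Prod>i<d. Q ^ d - Q ^ i) = (\<Prod>i<d. Q ^ dim - Q ^ i)"
proof -
  let ?S = "{vs. length vs = d \<and> set vs \<subseteq> V \<and> lindep centre vs}"
  have fin: "finite ?S" by (rule finite_subset[OF _ finite_lists_V[of d]]) auto
  have img: "lspan centre ` ?S = subspaces d"
  proof (intro equalityI subsetI)
    fix W assume "W \<in> lspan centre ` ?S"
    then show "W \<in> subspaces d"
      using lsubspace_lspan lspan_subset[OF V] card_lspan by (auto simp: subspaces_def)
  next
    fix W assume "W \<in> subspaces d"
    then obtain us ws where "set ws \<subseteq> W" "lindep centre ws" "lspan centre ws = W" "length ws = d"
      by (rule subspace_basis)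
    moreover have "W \<subseteq> V" using \<open>W \<in> subspaces d\<close> by (simp add: subspaces_def)
    ultimately show "W \<in> lspan centre ` ?S" by blast
  qed
  have "card ?S = card (lspan centre ` ?S) * (\<Prod>i<d. Q ^ d - Q ^ i)"
  proof (rule card_fibre_sum[OF fin])
    fix W assume "W \<in> lspan centre ` ?S"
    then have W: "W \<in> subspaces d" using img by simp
    interpret W: finite_lspace 1 centre W using subspace_lspace[OF W] .
    have WV: "W \<subseteq> V" "card W = Q ^ d" using W by (auto simp: subspaces_def)
    have "{vs \<in> ?S. lspan centre vs = W} = {vs. length vs = d \<and> set vs \<subseteq> W \<and> lindep centre vs}"
      using set_subset_lspan W.basis_if_length WV by auto
    then show "card {vs \<in> ?S. lspan centre vs = W} = (\<Prod>i<d. Q ^ d - Q ^ i)"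
      using W.card_lindep_lists[of d] WV by simp
  qed
  then show ?thesis unfolding img using card_lindep_lists[of d] card_V by simp
qed

end

section \<open>Counting field extensions and forms\<close>

text \<open>By Lagrange the nonzero elements of a subfield of order m satisfy x^(m-1) = 1, an
  equation with at most m - 1 solutions in \<open>Z\<close>; so they are exactly its solutions, and
  m determines them.\<close>

lemma subfield_eq_if_card_eq:
  fixes Z :: "'a::ring_1 set"
  assumes Z: "div_subring 1 Z" "finite Z" and F: "div_subring 1 F" "F \<subseteq> Z"
    and F': "div_subring 1 F'" "F' \<subseteq> Z" "card F = card F'"
  shows "F = F'"
proof -
  \<comment> \<open>The sets are packed into \<open>HOL-Algebra\<close> records to make the bound on
    the number of roots and the order theorem for groups applicable.\<close>
  define R :: "'a ring" where "R = \<lparr>carrier = Z, monoid.mult = (*), one = 1, zero = 0, add = (+)\<rparr>"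
  note d = div_subringD[OF Z(1)]
  have comm: "x * y = y * x" if "x \<in> Z" "y \<in> Z" for x y using wedderburn_little[OF Z(2,1)] that by blast
  have "cring R"
  proof (rule cringI)
    show "abelian_group R"
      by (rule abelian_groupI) (use d in \<open>auto simp: R_def algebra_simps intro!: bexI[of _ "- _"]\<close>)
    show "comm_monoid R"
      by (rule comm_monoidI) (use d comm in \<open>auto simp: R_def algebra_simps\<close>)
  qed (auto simp: R_def algebra_simps)
  then have "domain R"
    using div_subring_no_zero_divisors[OF Z(1)] d
    by (auto simp: domain_def domain_axioms_def R_def)
  then interpret R: domain R .
  have powR: "x [^]\<^bsub>R\<^esub> n = x ^ n" for x and n :: nat
    by (induction n) (simp_all add: R_def nat_pow_def power_Suc2 del: power_Suc)
  have sub: "H - {0} \<subseteq> {x \<in> Z. x ^ (card H - 1) = 1}" if H: "div_subring 1 H" "H \<subseteq> Z" for H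
  proof
    fix x assume x: "x \<in> H - {0}"
    define G :: "'a monoid" where "G = \<lparr>carrier = H - {0}, monoid.mult = (*), one = 1\<rparr>"
    note h = div_subringD[OF H(1)]
    have "group G"
    proof (rule groupI)
      fix y assume "y \<in> carrier G"
      then obtain z where "z \<in> H" "z \<noteq> 0" "z * y = 1" using div_subring_inv[OF H(1)] unfolding G_def
        by (metis DiffE insertCI partial_object.select_convs(1))
      then show "\<exists>z\<in>carrier G. z \<otimes>\<^bsub>G\<^esub> y = \<one>\<^bsub>G\<^esub>" by (auto simp: G_def)
    next
      fix y z assume "y \<in> carrier G" "z \<in> carrier G"
      then show "y \<otimes>\<^bsub>G\<^esub> z \<in> carrier G"
        using h(7) div_subring_no_zero_divisors[OF H(1), of y z] by (auto simp: G_def)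
    qed (use h in \<open>auto simp: G_def mult.assoc\<close>)
    then interpret G: group G .
    have powG: "x [^]\<^bsub>G\<^esub> n = x ^ n" for n :: nat
      by (induction n) (simp_all add: G_def nat_pow_def power_Suc2 del: power_Suc)
    have "x [^]\<^bsub>G\<^esub> order G = \<one>\<^bsub>G\<^esub>" using x by (intro G.pow_order_eq_1) (simp add: G_def)
    moreover have "order G = card H - 1" using h(3) by (simp add: order_def G_def card_Diff_singleton)
    moreover have "\<one>\<^bsub>G\<^esub> = 1" by (simp add: G_def)
    ultimately have "x ^ (card H - 1) = 1" by (simp only: powG)
    then show "x \<in> {x \<in> Z. x ^ (card H - 1) = 1}" using x H by auto
  qed
  have eq: "H - {0} = {x \<in> Z. x ^ (card H - 1) = 1}" if H: "div_subring 1 H" "H \<subseteq> Z" for H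
  proof (rule card_seteq[OF _ sub[OF H]])
    show "finite {x \<in> Z. x ^ (card H - 1) = 1}" using Z by simp
    have finH: "finite H" using H Z by (auto intro: finite_subset)
    have "card {0, 1 :: 'a} \<le> card H"
      using finH div_subringD(1,3)[OF H(1)] by (intro card_mono) auto
    then have "card H - 1 \<noteq> 0" by simp
    then have "card {x \<in> carrier R. x [^]\<^bsub>R\<^esub> (card H - 1) = \<one>\<^bsub>R\<^esub>} \<le> card H - 1"
      using Z by (intro R.num_roots_le_deg) (auto simp: R_def)
    then show "card {x \<in> Z. x ^ (card H - 1) = 1} \<le> card (H - {0})"
      using div_subringD(3)[OF H(1)] unfolding powR by (simp add: R_def card_Diff_singleton)
  qed
  have "F - {0} = F' - {0}" using eq[OF F] eq[OF F'(1,2)] F'(3) by simp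
  then show ?thesis using div_subringD(3)[OF F(1)] div_subringD(3)[OF F'(1)] by blast
qed

context simple_ring_module
begin

lemma finite_set_set: "finite (X :: 'a set set)"
  by (rule finite_subset[of X "Pow UNIV"]) (simp, simp only: finite_Pow_iff fin)

lemma centre_field: "div_subring 1 (centre :: 'a set)"
  by (rule F)

text \<open>Descending order: the highest power is the head, so \<open>lindep\<close> tests it
  against the lower powers.\<close>

definition pows :: "'a \<Rightarrow> nat \<Rightarrow> 'a list" where
  "pows c t = map (\<lambda>i. c ^ i) (rev [0..<t])"

lemma pows_simps [simp]: "pows c 0 = []" "pows c (Suc t) = c ^ t # pows c t"
  by (simp_all add: pows_def)

lemma length_pows [simp]: "length (pows c t) = t"
  by (simp add: pows_def)

lemma power_in_pows: "i < t \<Longrightarrow> c ^ i \<in> set (pows c t)"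
  by (auto simp: pows_def)

lemma field_lspace:
  assumes "div_subring 1 R"
  shows "finite_lspace 1 R V"
  using assms left_ideal_space[OF V_ideal _ unital_UNIV, of R] finite_set by unfold_locales auto

lemma subfield_lspace:
  fixes F R :: "'a set"
  assumes "div_subring 1 F" "div_subring 1 R" "F \<subseteq> R"
  shows "finite_lspace 1 F R"
  using assms finite_set div_subringD[OF assms(2)]
  by unfold_locales (auto simp: lsubspace_def)

text \<open>Let \<open>c ^ t\<close> be the first power depending on the lower ones. The span
  \<open>P\<close> of these lower powers is closed under multiplication, hence a field, and equals
  \<open>R\<close> by minimality; comparing orders gives \<open>t = d\<close>.\<close>

lemma minimal_field_powers:
  assumes R: "R \<in> minimal_fields" "card R = Q ^ d" and c: "c \<in> R" "c \<notin> centre"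
  shows "lspan centre (pows c d) = R" "lindep centre (pows c d)"
proof -
  have Rf: "div_subring 1 R" "centre \<subset> R" and
    min: "\<And>R'. div_subring 1 R' \<Longrightarrow> centre \<subset> R' \<Longrightarrow> R' \<subseteq> R \<Longrightarrow> R' = R"
    using R by (auto simp: minimal_fields_def)
  note r = div_subringD[OF Rf(1)]
  interpret R: finite_lspace 1 centre R using subfield_lspace[OF F Rf(1)] Rf(2) by auto
  have cp: "c ^ i \<in> R" for i using r(1,7) c by (induction i) auto
  have pR: "set (pows c t) \<subseteq> R" for t using cp by (auto simp: pows_def)
  have "\<exists>t. c ^ t \<in> lspan centre (pows c t)"
  proof (rule ccontr)
    assume n: "\<not> ?thesis"
    have "lindep centre (pows c t)" for t by (induction t) (use n in auto)
    then have "Q ^ t \<le> card R" for t using R.length_le_if_lindep[OF pR] by simp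
    moreover have "card R < 2 ^ card R" by (rule less_exp)
    moreover have "2 ^ card R \<le> Q ^ card R" using Q_ge_2 by (rule power_mono) simp
    ultimately show False by (meson leD le_trans less_le_trans)
  qed
  then obtain t where t: "c ^ t \<in> lspan centre (pows c t)" "\<And>s. s < t \<Longrightarrow> c ^ s \<notin> lspan centre (pows c s)"
    using exists_least_iff[of "\<lambda>t. c ^ t \<in> lspan centre (pows c t)"] by blast
  have "lindep centre (pows c s)" if "s \<le> t" for s
    using that by (induction s) (use t(2) in auto)
  then have ind: "lindep centre (pows c t)" by simp
  define P where "P = lspan centre (pows c t)"
  have PR: "P \<subseteq> R" unfolding P_def by (rule lspan_subset[OF R.V pR])
  have Psub: "lsubspace 1 centre P" unfolding P_def by (rule R.lsubspace_lspan[OF pR])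
  note p = lsubspaceD[OF Psub]
  have "c * x \<in> lspan centre (pows c (Suc s))" if "x \<in> lspan centre (pows c s)" for x s
    using that
  proof (induction s arbitrary: x)
    case 0
    then show ?case using zero_in_lspan[OF FD(3)] by (simp del: lspan.simps(2))
  next
    case (Suc s)
    then obtain z y where zy: "x = z * c ^ s + y" "z \<in> centre" "y \<in> lspan centre (pows c s)" by auto
    have "c * x = z * c ^ Suc s + c * y"
      using centre_commute[OF zy(2), of c] by (simp add: zy distrib_left) (metis mult.assoc)
    then show ?case using lspan_ConsI[OF zy(2) Suc.IH[OF zy(3)]] by simp
  qed
  moreover have "lspan centre (pows c (Suc t)) = P"
    using R.lspan_Cons_eq[OF pR t(1)] by (simp add: P_def del: lspan.simps)
  ultimately have cP: "c * x \<in> P" if "x \<in> P" for x using that unfolding P_def by metis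
  have "t \<noteq> 0" using t(1) by (metis lspan.simps(1) pows_simps(1) power_0 singletonD zero_neq_one)
  then have oneP: "1 \<in> P"
    using power_in_pows[of 0 t c] R.set_subset_lspan[OF pR, of t] by (auto simp: P_def)
  \<comment> \<open>The multipliers of \<open>P\<close> form a subspace containing all powers of
    \<open>c\<close>, hence \<open>P\<close> itself: this is closure under multiplication.\<close>
  let ?W = "{x \<in> R. \<forall>y\<in>P. x * y \<in> P}"
  have "c ^ i * y \<in> P" if "y \<in> P" for i y using that cP by (induction i) (auto simp: mult.assoc)
  then have "set (pows c t) \<subseteq> ?W" using cp by (auto simp: pows_def)
  moreover have "lsubspace 1 centre ?W"
    using p R.VD by (auto simp: lsubspace_def left_diff_distrib mult.assoc)
  ultimately have "P \<subseteq> ?W" unfolding P_def by (intro lspan_subset)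
  then have "unital_subring P" using oneP p(2) by (auto simp: unital_subring_def)
  then have "div_subring 1 P" by (rule finite_subring_div_subring[OF Rf(1) finite_set _ PR])
  moreover have "centre \<subseteq> P" using p(4)[OF _ oneP] by auto
  moreover have "c \<in> P" using cP[OF oneP] by simp
  ultimately have "P = R" using min PR c by blast
  moreover have "card P = Q ^ t" unfolding P_def using R.card_lspan[OF pR ind] by simp
  moreover have "1 < Q" using Q_ge_2 by simp
  ultimately have "t = d" using R(2) by (simp add: power_inject_exp)
  then show "lspan centre (pows c d) = R" "lindep centre (pows c d)"
    using \<open>P = R\<close> ind by (simp_all add: P_def)
qed

text \<open>The tower basis of all \<open>c ^ i * w\<close>, in one block of length \<open>d\<close>
  for each \<open>w\<close>. The block structure allows the vectors \<open>w\<close> to be read off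
  again.\<close>

definition field_basis :: "'a \<Rightarrow> nat \<Rightarrow> 'a list \<Rightarrow> 'a list" where
  "field_basis c d ws = concat (map (\<lambda>w. map (\<lambda>x. x * w) (pows c d)) ws)"

lemma field_basis:
  assumes R: "R \<in> minimal_fields" "card R = Q ^ d" and c: "c \<in> R" "c \<notin> centre"
    and ws: "set ws \<subseteq> V" "lspan R ws = V" "dim = d * length ws"
  shows "set (field_basis c d ws) \<subseteq> V" "length (field_basis c d ws) = dim"
    "lindep centre (field_basis c d ws)" "lspan centre (field_basis c d ws) = V"
proof -
  let ?bs = "field_basis c d ws"
  show bV: "set ?bs \<subseteq> V" using ws V_closed by (auto simp: field_basis_def)
  show len: "length ?bs = dim" using ws(3)
    by (simp add: field_basis_def length_concat comp_def sum_list_triv mult.commute)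
  note sub = lsubspaceD[OF lsubspace_lspan[OF bV]]
  have "x * w \<in> lspan centre ?bs" if "x \<in> R" "w \<in> set ws" for x w
  proof -
    have "x * w \<in> lspan centre (map (\<lambda>x. x * w) (pows c d))"
      using that minimal_field_powers(1)[OF R c] by (intro lspan_mult_right) simp
    also have "\<dots> \<subseteq> lspan centre ?bs"
    proof (rule lspan_subset[OF lsubspace_lspan[OF bV]])
      have "set (map (\<lambda>x. x * w) (pows c d)) \<subseteq> set ?bs" using that by (auto simp: field_basis_def)
      then show "set (map (\<lambda>x. x * w) (pows c d)) \<subseteq> lspan centre ?bs"
        using set_subset_lspan[OF bV] by blast
    qed
    finally show ?thesis .
  qed
  then have "v \<in> lspan centre ?bs" if "v \<in> lspan R us" "set us \<subseteq> set ws" for v us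
    using that sub(1,3) by (induction us arbitrary: v) auto
  then have "V \<subseteq> lspan centre ?bs" using ws(2) by blast
  then show sp: "lspan centre ?bs = V" using lspan_subset[OF V bV] by blast
  show "lindep centre ?bs" using bV sp len card_V by (intro lindepI_card) auto
qed

section \<open>Numbers of minimal extension fields and sizes of centralizers\<close>

definition fields_of_degree :: "nat \<Rightarrow> 'a set set" where
  "fields_of_degree d = {R \<in> minimal_fields. card R = Q ^ d}"

lemma minimal_field_degree:
  assumes "R \<in> minimal_fields"
  obtains d where "R \<in> fields_of_degree d" "2 \<le> d" "d dvd dim"
proof -
  have R: "div_subring 1 R" "centre \<subset> R" using assms by (auto simp: minimal_fields_def)
  interpret R: finite_lspace 1 centre R using subfield_lspace[OF F R(1)] R(2) by auto
  obtain d where d: "card R = Q ^ d" using R.ex_basis by (metis card_centre)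
  have "Q ^ 1 < Q ^ d" using psubset_card_mono[OF finite_set R(2)] d by simp
  moreover have "1 < Q" using Q_ge_2 by simp
  ultimately have "1 < d" by (simp only: power_strict_increasing_iff)
  interpret RV: finite_lspace 1 R V using field_lspace[OF R(1)] .
  obtain r where "card V = card R ^ r" using RV.ex_basis by metis
  then have "dim = d * r" using \<open>1 < Q\<close> d card_V by (simp add: power_inject_exp flip: power_mult)
  then show ?thesis using that[of d] d assms \<open>1 < d\<close> by (auto simp: fields_of_degree_def)
qed

text \<open>Consider triples of a field \<open>R\<close>, a noncentral \<open>c\<close> in
  \<open>R\<close> and an \<open>R\<close>-basis of \<open>V\<close>. Map each to the coefficients
  expressing \<open>c ^ d\<close> by lower powers and to the tower basis over the centre. The map is
  injective: \<open>c\<close> acts on the tower basis by companion blocks, so coefficients and basis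
  determine \<open>c\<close>, and \<open>c\<close> generates \<open>R\<close>. The left side counts
  the triples, the right side the possible images.\<close>

lemma card_fields_of_degree:
  assumes dim: "dim = d * r" and d: "2 \<le> d"
  shows "card (fields_of_degree d) * ((Q ^ d - Q) * (\<Prod>i<r. Q ^ dim - (Q ^ d) ^ i)) \<le>
    Q ^ d * (\<Prod>i<dim. Q ^ dim - Q ^ i)"
proof -
  let ?W = "\<lambda>R. {ws. length ws = r \<and> set ws \<subseteq> V \<and> lindep R ws}"
  let ?S = "SIGMA R:fields_of_degree d. (R - centre) \<times> ?W R"
  let ?C = "{as. set as \<subseteq> (centre :: 'a set) \<and> length as = d}"
  let ?B = "{bs. length bs = dim \<and> set bs \<subseteq> V \<and> lindep centre bs}"
  have R: "div_subring 1 R" "centre \<subseteq> R" "R \<in> minimal_fields" "card R = Q ^ d"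
    if "R \<in> fields_of_degree d" for R
    using that by (auto simp: fields_of_degree_def minimal_fields_def)
  have finW: "finite (?W R)" for R :: "'a set"
    by (rule finite_subset[OF _ finite_lists_V[of r]]) auto
  have W: "card (?W R) = (\<Prod>i<r. Q ^ dim - (Q ^ d) ^ i)" "\<And>ws. ws \<in> ?W R \<Longrightarrow> lspan R ws = V"
    if "R \<in> fields_of_degree d" for R
  proof -
    interpret RV: finite_lspace 1 R V using field_lspace[OF R(1)[OF that]] .
    show "card (?W R) = (\<Prod>i<r. Q ^ dim - (Q ^ d) ^ i)"
      using RV.card_lindep_lists[of r] R(4)[OF that] card_V by simp
    show "lspan R ws = V" if "ws \<in> ?W R" for ws
      using that RV.basis_if_length[of ws] R(4)[OF \<open>R \<in> fields_of_degree d\<close>] card_V dim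
      by (simp add: power_mult)
  qed
  have "card ?S = (\<Sum>R\<in>fields_of_degree d. card ((R - centre) \<times> ?W R))"
    using finite_set finite_set_set finW by (intro card_SigmaI) auto
  also have "\<dots> = (\<Sum>R\<in>fields_of_degree d. (Q ^ d - Q) * (\<Prod>i<r. Q ^ dim - (Q ^ d) ^ i))"
    using R W by (intro sum.cong[OF refl])
      (simp add: card_cartesian_product card_Diff_subset finite_set)
  finally have cS: "card ?S = card (fields_of_degree d) * ((Q ^ d - Q) * (\<Prod>i<r. Q ^ dim - (Q ^ d) ^ i))"
    by simp
  \<comment> \<open>The coefficients of the monic relation of degree \<open>d\<close> satisfied by
    \<open>c\<close> over the centre.\<close>
  define co where "co c = (SOME as. as \<in> ?C \<and> c ^ d = lcomb as (pows c d))" for c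
  have co: "co c \<in> ?C \<and> c ^ d = lcomb (co c) (pows c d)"
    if "R \<in> fields_of_degree d" "c \<in> R - centre" for R c
    unfolding co_def
  proof (rule someI_ex)
    have "c ^ i \<in> R" for i
      using div_subringD(1,7)[OF R(1)[OF that(1)]] that(2) by (induction i) auto
    then have "c ^ d \<in> lspan centre (pows c d)"
      using minimal_field_powers(1)[OF R(3,4)[OF that(1)]] that(2) by simp
    then show "\<exists>as. as \<in> ?C \<and> c ^ d = lcomb as (pows c d)" unfolding lspan_eq_lcomb by auto
  qed
  define g where "g = (\<lambda>(R :: 'a set, c, ws). (co c, field_basis c d ws))"
  have "inj_on g ?S"
  proof (rule inj_onI)
    fix p p' assume p: "p \<in> ?S" "p' \<in> ?S" "g p = g p'"
    obtain R c ws where pR: "p = (R, c, ws)" by (cases p)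
    obtain R' c' ws' where pR': "p' = (R', c', ws')" by (cases p')
    have R1: "R \<in> fields_of_degree d" and c: "c \<in> R - centre" and ws: "ws \<in> ?W R"
      and R2: "R' \<in> fields_of_degree d" and c': "c' \<in> R' - centre" and ws': "ws' \<in> ?W R'"
      and eq: "co c = co c'" "field_basis c d ws = field_basis c' d ws'"
      using p by (auto simp: pR pR' g_def)
    have len: "length ws = r" "length ws' = r" using ws ws' by auto
    have "map (\<lambda>w. map (\<lambda>x. x * w) (pows c d)) ws = map (\<lambda>w. map (\<lambda>x. x * w) (pows c' d)) ws'"
      using eq(2) len unfolding field_basis_def
      by (subst (asm) concat_eq_concat_iff) (auto simp: set_zip simp del: map_eq_conv)
    then have blocks: "map (\<lambda>x. x * ws ! j) (pows c d) = map (\<lambda>x. x * ws' ! j) (pows c' d)" if "j < r" for j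
    proof -
      assume eq: "map (\<lambda>w. map (\<lambda>x. x * w) (pows c d)) ws = map (\<lambda>w. map (\<lambda>x. x * w) (pows c' d)) ws'"
      show ?thesis using arg_cong[OF eq, of "\<lambda>l. l ! j"] that len by (simp del: map_eq_conv)
    qed
    have pw: "c ^ i * ws ! j = c' ^ i * ws' ! j" if "j < r" "i < d" for i j
    proof -
      have "map (\<lambda>x. x * ws ! j) (pows c d) ! (d - Suc i) = map (\<lambda>x. x * ws' ! j) (pows c' d) ! (d - Suc i)"
        using blocks[OF that(1)] by simp
      then show ?thesis using that(2) by (simp add: pows_def rev_nth)
    qed
    have wseq: "ws = ws'"
      using pw[of _ 0] d len by (intro nth_equalityI) auto
    \<comment> \<open>For \<open>i < d\<close> the vectors are entries of the common basis; only
      \<open>i = d\<close> uses that the two coefficient lists agree.\<close>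
    have pd: "c ^ i * w = c' ^ i * w" if "w \<in> set ws" "i \<le> d" for i w
    proof -
      obtain j where j: "j < r" "w = ws ! j" using \<open>w \<in> set ws\<close> len by (auto simp: in_set_conv_nth)
      show ?thesis
      proof (cases "i = d")
        case True
        have "c ^ d * w = lcomb (co c) (map (\<lambda>x. x * w) (pows c d))"
          using co[OF R1 c] lcomb_mult_right by metis
        also have "\<dots> = lcomb (co c') (map (\<lambda>x. x * w) (pows c' d))"
          using blocks[OF j(1)] j(2) wseq eq(1) by simp
        also have "\<dots> = c' ^ d * w" using co[OF R2 c'] lcomb_mult_right by metis
        finally show ?thesis using True by simp
      next
        case False
        then show ?thesis using pw[OF j(1), of i] j that wseq by simp
      qed
    qed
    have fb: "lspan centre (field_basis c d ws) = V"
      using ws W(2)[OF R1 ws] dim c by (intro field_basis(4)[OF R(3,4)[OF R1]]) auto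
    have "c = c'"
    proof (rule determined_by_basis[OF _ _ _ fb])
      show "\<And>z. z \<in> centre \<Longrightarrow> c * z = z * c" "\<And>z. z \<in> centre \<Longrightarrow> c' * z = z * c'"
        using centre_commute by metis+
      fix v assume "v \<in> set (field_basis c d ws)"
      then obtain w i where w: "w \<in> set ws" "i < d" "v = c ^ i * w" by (auto simp: field_basis_def pows_def)
      have "c * v = c ^ Suc i * w" using w by (simp add: mult.assoc)
      also have "\<dots> = c' ^ Suc i * w" using w by (intro pd) auto
      also have "\<dots> = c' * (c' ^ i * w)" by (simp add: mult.assoc)
      also have "c' ^ i * w = v" using pd[of w i] w by simp
      finally show "c * v = c' * v" .
    qed
    moreover have "R = R'"
      using minimal_field_powers(1)[OF R(3,4)[OF R1]] minimal_field_powers(1)[OF R(3,4)[OF R2]] c c' \<open>c = c'\<close>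
      by (metis DiffE)
    ultimately show "p = p'" using wseq by (simp add: pR pR')
  qed
  moreover have "g ` ?S \<subseteq> ?C \<times> ?B"
  proof
    fix x assume "x \<in> g ` ?S"
    then obtain R c ws where x: "x = (co c, field_basis c d ws)" "R \<in> fields_of_degree d"
      "c \<in> R - centre" "ws \<in> ?W R" by (auto simp: g_def)
    note fb = field_basis[OF R(3,4)[OF x(2)], of c ws]
    show "x \<in> ?C \<times> ?B" using co[OF x(2,3)] fb(1-3) x W(2)[OF x(2,4)] dim by auto
  qed
  moreover have finC: "finite ?C" using finite_lists_length_eq[OF finite_set] .
  moreover have finB: "finite ?B" by (rule finite_subset[OF _ finite_lists_V[of dim]]) auto
  ultimately have "card ?S \<le> card (?C \<times> ?B)" by (intro card_inj_on_le) auto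
  also have "\<dots> = Q ^ d * (\<Prod>i<dim. Q ^ dim - Q ^ i)"
    using card_lindep_lists[of dim] by (simp add: card_cartesian_product card_lists_length_eq finite_set card_V)
  finally show ?thesis using cS by simp
qed

definition centralizer :: "'a set \<Rightarrow> 'a set" where
  "centralizer R = {a. \<forall>c\<in>R. a * c = c * a}"

lemma card_centralizer_le:
  assumes "R \<in> fields_of_degree d" "dim = d * r" "d > 0"
  shows "card (centralizer R) \<le> Q ^ (dim * r)"
proof -
  have R: "div_subring 1 R" "card R = Q ^ d" using assms by (auto simp: fields_of_degree_def minimal_fields_def)
  interpret RV: finite_lspace 1 R V using field_lspace[OF R(1)] .
  obtain vs where vs: "set vs \<subseteq> V" "lindep R vs" "lspan R vs = V" "card V = card R ^ length vs"
    by (rule RV.ex_basis)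
  have "1 < Q" using Q_ge_2 by simp
  then have "length vs = r" using vs(4) card_V R assms by (simp add: power_inject_exp flip: power_mult)
  moreover have "card (centralizer R) \<le> card V ^ length vs"
    using vs V_closed by (intro card_operators_le[of _ R]) (auto simp: centralizer_def)
  ultimately show ?thesis by (simp add: card_V power_mult)
qed

section \<open>Proper subfields of the centre and forms over them\<close>

definition proper_subfields :: "'a set set" where
  "proper_subfields = {F. div_subring 1 F \<and> F \<subset> centre}"

text \<open>The centre is a vector space of dimension at least 2 over \<open>F\<close>.\<close>

lemma card_proper_subfield:
  assumes "F \<in> proper_subfields"
  shows "2 \<le> card F" "(card F)\<^sup>2 \<le> Q"
proof -
  have F: "div_subring 1 F" "F \<subset> centre" using assms by (auto simp: proper_subfields_def)
  interpret FZ: finite_lspace 1 F centre using subfield_lspace[OF F(1) centre_field] F(2) by auto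
  show 2: "2 \<le> card F" by (rule FZ.card_F)
  obtain t where t: "Q = card F ^ t" using FZ.ex_basis by (metis card_centre)
  have "card F ^ 1 < card F ^ t" using psubset_card_mono[OF finite_set F(2)] t by simp
  then have "1 < t" using 2 by (subst (asm) power_strict_increasing_iff) auto
  then have "card F ^ 2 \<le> card F ^ t" using 2 by (intro power_increasing) auto
  then show "(card F)\<^sup>2 \<le> Q" using t by simp
qed

lemma inj_on_card_proper_subfields: "inj_on card proper_subfields"
  using subfield_eq_if_card_eq[OF F finite_set]
  by (intro inj_onI) (auto simp: proper_subfields_def)

definition forms :: "'a set \<Rightarrow> 'a set set" where
  "forms F = lspan F ` {bs. length bs = dim \<and> set bs \<subseteq> V \<and> lindep centre bs}"

text \<open>Every \<open>F\<close>-basis of a form is also a basis of \<open>V\<close> over the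
  centre, so bases of \<open>V\<close> are sorted by their \<open>F\<close>-span into classes of the
  size of the general linear group over \<open>F\<close>.\<close>

lemma card_forms:
  assumes "F \<in> proper_subfields"
  shows "card (forms F) * (\<Prod>i<dim. card F ^ dim - card F ^ i) = (\<Prod>i<dim. Q ^ dim - Q ^ i)"
proof -
  let ?S = "{bs. length bs = dim \<and> set bs \<subseteq> V \<and> lindep centre bs}"
  have F: "div_subring 1 F" "F \<subseteq> centre" using assms by (auto simp: proper_subfields_def)
  interpret FV: finite_lspace 1 F V using field_lspace[OF F(1)] .
  have mono: "lspan F xs \<subseteq> lspan centre xs" for xs :: "'a list"
    using F(2) by (induction xs) auto
  have ind: "lindep F xs" if "lindep centre xs" for xs using that mono by (induction xs) auto
  have fin: "finite ?S" by (rule finite_subset[OF _ finite_lists_V[of dim]]) auto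
  have "card ?S = card (lspan F ` ?S) * (\<Prod>i<dim. card F ^ dim - card F ^ i)"
  proof (rule card_fibre_sum[OF fin])
    fix U assume "U \<in> lspan F ` ?S"
    then obtain us where us: "U = lspan F us" "us \<in> ?S" by blast
    have UV: "U \<subseteq> V" unfolding us(1) using us(2) by (intro lspan_subset[OF FV.V]) auto
    have sub: "lsubspace 1 F U" unfolding us(1) using us(2) by (intro FV.lsubspace_lspan) auto
    have cU: "card U = card F ^ dim" unfolding us(1) using us(2) ind FV.card_lspan by auto
    interpret FU: finite_lspace 1 F U
      using finite_lspace_subspace[OF FV.finite_lspace_axioms sub UV] .
    have usV: "lspan centre us = V" using us(2) card_V by (intro basis_if_length) auto
    have "{bs \<in> ?S. lspan F bs = U} = {bs. length bs = dim \<and> set bs \<subseteq> U \<and> lindep F bs}"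
    proof (intro equalityI subsetI)
      fix bs assume "bs \<in> {bs \<in> ?S. lspan F bs = U}"
      then show "bs \<in> {bs. length bs = dim \<and> set bs \<subseteq> U \<and> lindep F bs}"
        using ind FV.set_subset_lspan by auto
    next
      fix bs assume "bs \<in> {bs. length bs = dim \<and> set bs \<subseteq> U \<and> lindep F bs}"
      then have bs: "length bs = dim" "set bs \<subseteq> U" "lindep F bs" by auto
      have bsV: "set bs \<subseteq> V" using bs UV by blast
      have spU: "lspan F bs = U" using bs cU by (intro FU.basis_if_length) auto
      have "set us \<subseteq> U" unfolding us(1) using us(2) by (intro FV.set_subset_lspan) auto
      then have "set us \<subseteq> lspan centre bs" using spU mono by blast
      then have "V \<subseteq> lspan centre bs"
        using lspan_subset[OF lsubspace_lspan[OF bsV]] usV by blast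
      then have "lspan centre bs = V" using lspan_subset[OF V bsV] by blast
      then have "lindep centre bs" using bsV bs card_V by (intro lindepI_card) auto
      then show "bs \<in> {bs \<in> ?S. lspan F bs = U}" using bs bsV spU by auto
    qed
    then show "card {bs \<in> ?S. lspan F bs = U} = (\<Prod>i<dim. card F ^ dim - card F ^ i)"
      using FU.card_lindep_lists[of dim] cU by simp
  qed
  then show ?thesis using card_lindep_lists[of dim] card_V by (simp add: forms_def)
qed

lemma card_stabilizer_form_le:
  assumes "F \<in> proper_subfields" "U \<in> forms F"
  shows "card (stabilizer U) \<le> card F ^ (dim * dim)"
proof -
  have F: "div_subring 1 F" using assms by (auto simp: proper_subfields_def)
  interpret FV: finite_lspace 1 F V using field_lspace[OF F] .
  obtain bs where bs: "U = lspan F bs" "length bs = dim" "set bs \<subseteq> V" "lindep centre bs"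
    using assms by (auto simp: forms_def)
  have "lspan centre bs = V" using bs card_V by (intro basis_if_length) auto
  moreover have "set bs \<subseteq> U" using FV.set_subset_lspan bs by simp
  ultimately have "card (stabilizer U) \<le> card U ^ length bs"
    by (intro card_operators_le[of _ centre]) (auto simp: stabilizer_def centre_commute)
  also have "\<dots> \<le> (card F ^ dim) ^ dim"
    using FV.card_lspan_le[OF bs(3)] unfolding bs(1,2) by (intro power_mono) auto
  finally show ?thesis by (simp add: power_mult)
qed

section \<open>Pairs in a common proper subring\<close>

definition bad_pairs :: "('a \<times> 'a) set" where
  "bad_pairs = {(x, y). \<exists>B. unital_subring B \<and> B \<noteq> UNIV \<and> x \<in> B \<and> y \<in> B}"

definition reducible_pairs :: "('a \<times> 'a) set" where
  "reducible_pairs = (\<Union>d\<in>{1..<dim}. \<Union>W\<in>subspaces d. stabilizer W \<times> stabilizer W)"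

definition centralizing_pairs :: "('a \<times> 'a) set" where
  "centralizing_pairs = (\<Union>d\<in>{d. d dvd dim \<and> 2 \<le> d}. \<Union>R\<in>fields_of_degree d. centralizer R \<times> centralizer R)"

definition form_pairs :: "('a \<times> 'a) set" where
  "form_pairs = (\<Union>F\<in>proper_subfields. \<Union>U\<in>forms F. stabilizer U \<times> stabilizer U)"

lemma bad_pairs_subset: "bad_pairs \<subseteq> reducible_pairs \<union> centralizing_pairs \<union> form_pairs"
proof (clarsimp simp: bad_pairs_def)
  fix x y B assume B: "unital_subring B" "B \<noteq> UNIV" and xy: "x \<in> B" "y \<in> B"
    and n: "(x, y) \<notin> form_pairs" "(x, y) \<notin> centralizing_pairs"
  show "(x, y) \<in> reducible_pairs"
  proof (rule proper_subring_cases[OF B])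
    fix W assume W: "lsubspace 1 centre W" "W \<subseteq> V" "W \<noteq> {0}" "W \<noteq> V" "stable B W"
    interpret W: finite_lspace 1 centre W using finite_lspace_subspace[OF finite_lspace_axioms W(1,2)] .
    obtain d where d: "card W = Q ^ d" using W.ex_basis by (metis card_centre)
    have "card W < card V" using W finite_set by (intro psubset_card_mono) auto
    then have "d < dim" using d card_V Q_ge_2 by (simp add: power_strict_increasing_iff)
    moreover have "d \<noteq> 0"
    proof
      assume "d = 0"
      then have "card W = 1" using d by simp
      then show False using W(3) W.VD(1) by (metis card_1_singletonE singletonD)
    qed
    moreover have "W \<in> subspaces d" using W d by (simp add: subspaces_def)
    moreover have "x \<in> stabilizer W" "y \<in> stabilizer W" using W(5) xy by (auto simp: stabilizer_def stable_def)
    ultimately show ?thesis by (auto simp: reducible_pairs_def intro!: bexI[of _ d] bexI[of _ W])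
  next
    fix R assume R: "R \<in> minimal_fields" "\<And>b c. b \<in> B \<Longrightarrow> c \<in> R \<Longrightarrow> b * c = c * b"
    obtain d where d: "R \<in> fields_of_degree d" "2 \<le> d" "d dvd dim" by (rule minimal_field_degree[OF R(1)])
    have "x \<in> centralizer R" "y \<in> centralizer R" using R(2) xy by (auto simp: centralizer_def)
    then have "(x, y) \<in> centralizing_pairs" using d unfolding centralizing_pairs_def by blast
    then show ?thesis using n by simp
  next
    fix F bs assume F: "div_subring 1 F" "F \<subset> centre" "set bs \<subseteq> V" "lindep centre bs"
      "length bs = dim" "stable B (lspan F bs)"
    have "F \<in> proper_subfields" using F by (simp add: proper_subfields_def)
    moreover have "lspan F bs \<in> forms F" using F by (auto simp: forms_def)
    moreover have "x \<in> stabilizer (lspan F bs)" "y \<in> stabilizer (lspan F bs)"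
      using F(6) xy by (auto simp: stabilizer_def stable_def)
    ultimately have "(x, y) \<in> form_pairs" unfolding form_pairs_def by blast
    then show ?thesis using n by simp
  qed
qed

end

section \<open>Densities\<close>

text \<open>1 - t - t^2 is the beginning of Euler's pentagonal series. The induction carries the
  surplus \<open>t ^ Suc (Suc r)\<close>, because the bare bound would not survive another
  factor.\<close>

lemma prod_one_minus_powers_ge:
  fixes t :: real
  assumes "0 \<le> t" "t \<le> 1"
  shows "1 - t - t\<^sup>2 \<le> (\<Prod>j<r. 1 - t ^ Suc j)"
proof -
  have "1 - t - t\<^sup>2 + t ^ Suc (Suc r) \<le> (\<Prod>j<Suc r. 1 - t ^ Suc j)" for r
  proof (induction r)
    case 0 then show ?case by (simp add: power2_eq_square)
  next
    case (Suc r)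
    let ?u = "t ^ Suc (Suc r)"
    have u: "0 \<le> ?u" "?u \<le> 1" using zero_le_power[OF assms(1)] power_le_one[OF assms] by blast+
    have "?u * ?u \<le> t\<^sup>2 * ?u"
      using assms u by (intro mult_right_mono power_decreasing) auto
    then have "1 - t - t\<^sup>2 + t * ?u \<le> (1 - t - t\<^sup>2 + ?u) * (1 - ?u)"
      by (simp add: algebra_simps power2_eq_square del: power_Suc)
    also have "\<dots> \<le> (\<Prod>j<Suc r. 1 - t ^ Suc j) * (1 - ?u)"
      using Suc u by (intro mult_right_mono) auto
    finally show ?case by (simp add: mult_ac)
  qed
  moreover have "0 \<le> t ^ Suc (Suc s)" for s using assms by simp
  ultimately have "1 - t - t\<^sup>2 \<le> (\<Prod>j<Suc s. 1 - t ^ Suc j)" for s by (meson add_increasing2 dual_order.trans order_refl)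
  moreover have "1 - t - t\<^sup>2 \<le> 1" using assms zero_le_power2[of t] by linarith
  ultimately show ?thesis by (cases r) auto
qed

text \<open>When \<open>R\<close> is a prime power, the last product is the proportion of invertible
  matrices among all \<open>r\<close> by \<open>r\<close> matrices over the field of order
  \<open>R\<close>.\<close>

lemma real_prod_power_diff:
  fixes R :: nat
  assumes "1 \<le> R"
  shows "real (\<Prod>i<r. R ^ r - R ^ i) = real R ^ (r * r) * (\<Prod>j<r. 1 - (1 / real R) ^ Suc j)"
proof -
  have "real (\<Prod>i<r. R ^ r - R ^ i) = (\<Prod>i<r. real R ^ r * (1 - (1 / real R) ^ Suc (r - Suc i)))"
    unfolding of_nat_prod
  proof (rule prod.cong[OF refl])
    fix i assume "i \<in> {..<r}"
    then have i: "i < r" by simp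
    have "R ^ i \<le> R ^ r" using i assms by (intro power_increasing) auto
    then have "real (R ^ r - R ^ i) = real R ^ r - real R ^ i" by (simp add: of_nat_diff)
    also have "real R ^ r = real R ^ i * real R ^ (r - i)" using i by (simp flip: power_add)
    then have "real R ^ i = real R ^ r * (1 / real R) ^ (r - i)"
      using assms by (simp add: power_one_over)
    then have "real R ^ r - real R ^ i = real R ^ r * (1 - (1 / real R) ^ Suc (r - Suc i))"
      using i by (simp add: right_diff_distrib Suc_diff_Suc del: power_Suc)
    finally show "real (R ^ r - R ^ i) = real R ^ r * (1 - (1 / real R) ^ Suc (r - Suc i))" .
  qed
  also have "\<dots> = (real R ^ r) ^ r * (\<Prod>i<r. 1 - (1 / real R) ^ Suc (r - Suc i))"
    by (simp add: prod.distrib)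
  also have "(\<Prod>i<r. 1 - (1 / real R) ^ Suc (r - Suc i)) = (\<Prod>j<r. 1 - (1 / real R) ^ Suc j)"
    by (rule prod.nat_diff_reindex)
  finally show ?thesis by (simp add: power_mult)
qed

text \<open>The bound depends only on a lower bound \<open>m\<close> for \<open>R\<close>. It is
  used for m = 2 with constant 1/4 and for m = 4 with constant 11/16.\<close>

lemma prod_power_diff_ge:
  assumes "m \<le> R" "2 \<le> m"
  shows "(1 - 1 / real m - (1 / real m)\<^sup>2) * real R ^ (r * r) \<le> real (\<Prod>i<r. R ^ r - R ^ i)"
proof -
  have t: "0 \<le> 1 / real R" "1 / real R \<le> 1" using assms by auto
  have le: "1 / real R \<le> 1 / real m" using assms by (simp add: frac_le)
  have "(1 / real R)\<^sup>2 \<le> (1 / real m)\<^sup>2" using le by (intro power_mono) auto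
  then have "1 - 1 / real m - (1 / real m)\<^sup>2 \<le> 1 - 1 / real R - (1 / real R)\<^sup>2" using le by linarith
  also have "\<dots> \<le> (\<Prod>j<r. 1 - (1 / real R) ^ Suc j)" by (rule prod_one_minus_powers_ge[OF t])
  finally show ?thesis using assms by (subst real_prod_power_diff) (auto simp: mult.commute mult_left_mono)
qed

text \<open>Only the factor j = 0 is retained. It cancels when fields are counted and survives in
  the estimate for forms.\<close>

lemma prod_power_diff_le:
  assumes "2 \<le> R" "1 \<le> r"
  shows "real (\<Prod>i<r. R ^ r - R ^ i) \<le> (1 - 1 / real R) * real R ^ (r * r)"
proof -
  have "(\<Prod>j<r. 1 - (1 / real R) ^ Suc j) = (1 - 1 / real R) * (\<Prod>j\<in>{..<r} - {0}. 1 - (1 / real R) ^ Suc j)"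
    using assms by (subst prod.remove[of _ 0]) auto
  also have "\<dots> \<le> (1 - 1 / real R) * 1"
  proof (rule mult_left_mono)
    show "(\<Prod>j\<in>{..<r} - {0}. 1 - (1 / real R) ^ Suc j) \<le> 1"
      using assms by (intro prod_le_1) (auto intro!: power_le_one simp del: power_Suc)
  qed (use assms in auto)
  finally show ?thesis using assms by (subst real_prod_power_diff) (auto simp: mult.commute mult_left_mono)
qed

context simple_ring_module
begin

section \<open>Density estimates for the three families\<close>

lemma card_UN_squares_le:
  assumes "finite I" "\<And>i. i \<in> I \<Longrightarrow> finite (K i)" "\<And>i k. i \<in> I \<Longrightarrow> k \<in> K i \<Longrightarrow> card (f k :: 'a set) \<le> m i"
  shows "card (\<Union>i\<in>I. \<Union>k\<in>K i. f k \<times> f k) \<le> (\<Sum>i\<in>I. card (K i) * (m i)\<^sup>2)"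
proof -
  have "card (\<Union>i\<in>I. \<Union>k\<in>K i. f k \<times> f k) \<le> (\<Sum>i\<in>I. card (\<Union>k\<in>K i. f k \<times> f k))"
    by (rule card_UN_le[OF assms(1)])
  also have "\<dots> \<le> (\<Sum>i\<in>I. \<Sum>k\<in>K i. card (f k \<times> f k))"
    by (intro sum_mono card_UN_le assms(2))
  also have "\<dots> \<le> (\<Sum>i\<in>I. \<Sum>k\<in>K i. (m i)\<^sup>2)"
    unfolding card_cartesian_product power2_eq_square using assms(3) by (intro sum_mono mult_le_mono) auto
  finally show ?thesis by simp
qed

lemma q_pos [simp]: "0 < Q" using Q_ge_2 by simp

lemma q_ge: "2 \<le> real Q" using Q_ge_2 by simp

lemma dim_pos: "0 < dim"
proof (rule ccontr)
  assume "\<not> 0 < dim"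
  then have "card V = 1" using card_V by simp
  then show False using V0 VD(1) by (metis card_1_singletonE singletonD)
qed

definition density :: "('a \<times> 'a) set \<Rightarrow> real" where
  "density X = real (card X) / real Q ^ (2 * dim * dim)"

lemma density_leI:
  assumes "card X \<le> (\<Sum>i\<in>I. N i)"
    "\<And>i. i \<in> I \<Longrightarrow> real (N i) \<le> c i * real Q ^ (2 * dim * dim)"
  shows "density X \<le> (\<Sum>i\<in>I. c i)"
proof -
  have "real (card X) \<le> (\<Sum>i\<in>I. real (N i))" using assms(1) by (metis of_nat_le_iff of_nat_sum)
  also have "\<dots> \<le> (\<Sum>i\<in>I. c i * real Q ^ (2 * dim * dim))" by (intro sum_mono assms(2))
  finally show ?thesis by (simp add: density_def sum_distrib_right divide_le_eq)
qed

text \<open>The index of the stabilizer of a \<open>d\<close>-dimensional subspace is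
  \<open>Q ^ (d * (dim - d))\<close>; its square enters since both members of a pair must lie in the
  stabilizer.\<close>

definition subspace_weight :: "nat \<Rightarrow> real" where
  "subspace_weight d = real (card (subspaces d)) / real Q ^ (2 * (d * (dim - d)))"

lemma density_reducible: "density reducible_pairs \<le> (\<Sum>d\<in>{1..<dim}. subspace_weight d)"
proof (rule density_leI)
  show "card reducible_pairs \<le> (\<Sum>d\<in>{1..<dim}. card (subspaces d) * (Q ^ (dim * (dim - d) + d * d))\<^sup>2)"
    unfolding reducible_pairs_def using finite_set_set card_stabilizer
    by (intro card_UN_squares_le) auto
  fix d assume "d \<in> {1..<dim}"
  then obtain k where k: "dim = d + k" by (metis atLeastLessThan_iff le_iff_add less_imp_le)
  have "2 * dim * dim = 2 * (dim * (dim - d) + d * d) + 2 * (d * (dim - d))"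
    unfolding k by (simp add: algebra_simps)
  then have "real Q ^ (2 * dim * dim) = (real Q ^ (dim * (dim - d) + d * d))\<^sup>2 * real Q ^ (2 * (d * (dim - d)))"
    by (simp only: power_add power_even_eq)
  then show "real (card (subspaces d) * (Q ^ (dim * (dim - d) + d * d))\<^sup>2) \<le>
      subspace_weight d * real Q ^ (2 * dim * dim)"
    using q_ge by (simp add: subspace_weight_def)
qed

lemma card_subspaces_1: "card (subspaces 1) * (Q - 1) = Q ^ dim - 1"
  using card_subspaces[of 1] by simp

text \<open>Taken from the product formula instead of duality: with dim = m + 2, both sides share
  the factor \<open>Q ^ m\<close> times a product over i < m, and cancelling it leaves the number of
  lines.\<close>

lemma card_subspaces_hyper: "card (subspaces (dim - 1)) * (Q - 1) = Q ^ dim - 1"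
proof (cases "dim = 1")
  case True
  then show ?thesis using card_subspaces[of 0] by simp
next
  case False
  then obtain m where m: "dim = Suc (Suc m)" using dim_pos by (metis One_nat_def gr0_implies_Suc not0_implies_Suc)
  let ?A = "\<Prod>i<m. Q ^ Suc m - Q ^ i"
  have "Q ^ Suc m - Q ^ m = (Q - 1) * Q ^ m" by (simp add: diff_mult_distrib)
  then have "(card (subspaces (Suc m)) * (Q - 1)) * (Q ^ m * ?A) =
      card (subspaces (Suc m)) * (\<Prod>i<Suc m. Q ^ Suc m - Q ^ i)"
    by (simp only: prod.lessThan_Suc mult_ac)
  also have "\<dots> = (\<Prod>i<Suc m. Q ^ Suc (Suc m) - Q ^ i)"
    using card_subspaces[of "Suc m"] m by simp
  also have "\<dots> = (Q ^ Suc (Suc m) - 1) * (\<Prod>i<m. Q ^ Suc (Suc m) - Q ^ Suc i)"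
    by (subst prod.lessThan_Suc_shift) simp
  also have "(\<Prod>i<m. Q ^ Suc (Suc m) - Q ^ Suc i) = (\<Prod>i<m. Q * (Q ^ Suc m - Q ^ i))"
    by (simp add: diff_mult_distrib2)
  also have "\<dots> = Q ^ m * ?A" by (simp add: prod.distrib)
  finally have eq: "(card (subspaces (Suc m)) * (Q - 1)) * (Q ^ m * ?A) = (Q ^ Suc (Suc m) - 1) * (Q ^ m * ?A)"
    by (simp only: mult.assoc)
  have nz: "Q ^ m * ?A \<noteq> 0"
  proof -
    have "Q ^ i < Q ^ Suc m" if "i < m" for i using that Q_ge_2 by (intro power_strict_increasing) auto
    then show ?thesis by (auto simp: not_le)
  qed
  from eq nz have "card (subspaces (Suc m)) * (Q - 1) = Q ^ Suc (Suc m) - 1"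
    unfolding mult_cancel2 by blast
  then show ?thesis unfolding m by simp
qed

text \<open>The exact value serves the small cases. The constant 2 in the bound comes from
  \<open>Q \<le> 2 * (Q - 1)\<close>.\<close>

lemma subspace_weight_end:
  assumes "d = 1 \<or> d = dim - 1" "1 < dim"
  shows "subspace_weight d = (real Q ^ dim - 1) / (real Q - 1) / real Q ^ (2 * (dim - 1))"
    "subspace_weight d \<le> 2 / real Q ^ (dim - 1)"
proof -
  have "card (subspaces d) * (Q - 1) = Q ^ dim - 1"
    using assms card_subspaces_1 card_subspaces_hyper by auto
  then have "real (card (subspaces d)) * real (Q - 1) = real (Q ^ dim - 1)"
    by (simp only: flip: of_nat_mult)
  moreover have "1 \<le> Q" "1 \<le> Q ^ dim" using Q_ge_2 by auto
  ultimately have "real (card (subspaces d)) * (real Q - 1) = real Q ^ dim - 1"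
    by (simp add: of_nat_diff)
  then have c: "real (card (subspaces d)) = (real Q ^ dim - 1) / (real Q - 1)"
    using q_ge by (simp add: field_simps)
  have "d * (dim - d) = dim - 1" using assms by auto
  then show eq: "subspace_weight d = (real Q ^ dim - 1) / (real Q - 1) / real Q ^ (2 * (dim - 1))"
    by (simp add: subspace_weight_def c)
  have "real Q ^ dim = real Q * real Q ^ (dim - 1)" using dim_pos by (metis Suc_pred' power_Suc)
  moreover have "2 * real Q ^ (dim - 1) \<le> real Q * real Q ^ (dim - 1)" using q_ge by (intro mult_right_mono) auto
  moreover have "2 * real Q ^ (dim - 1) * (real Q - 1) = 2 * (real Q * real Q ^ (dim - 1)) - 2 * real Q ^ (dim - 1)"
    by (simp add: algebra_simps)
  ultimately have "real Q ^ dim - 1 \<le> 2 * real Q ^ (dim - 1) * (real Q - 1)" by linarith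
  then have "(real Q ^ dim - 1) / (real Q - 1) \<le> 2 * real Q ^ (dim - 1)"
    using q_ge by (simp add: divide_le_eq)
  then have "subspace_weight d \<le> 2 * real Q ^ (dim - 1) / real Q ^ (2 * (dim - 1))"
    unfolding eq by (intro divide_right_mono) auto
  also have "real Q ^ (2 * (dim - 1)) = real Q ^ (dim - 1) * real Q ^ (dim - 1)" by (simp add: mult_2 power_add)
  finally show "subspace_weight d \<le> 2 / real Q ^ (dim - 1)" by simp
qed

text \<open>4 is the reciprocal of the lower bound 1/4 for the proportion of invertible matrices,
  valid for every \<open>Q \<ge> 2\<close>.\<close>

lemma subspace_weight_le:
  assumes "d \<le> dim"
  shows "subspace_weight d \<le> 4 / real Q ^ (d * (dim - d))"
proof -
  let ?c = "real (card (subspaces d))"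
  have "(\<Prod>i<d. Q ^ dim - Q ^ i) \<le> (\<Prod>i<d. Q ^ dim)" by (intro prod_mono) auto
  then have "card (subspaces d) * (\<Prod>i<d. Q ^ d - Q ^ i) \<le> (Q ^ dim) ^ d" using card_subspaces[of d] by simp
  then have "?c * real (\<Prod>i<d. Q ^ d - Q ^ i) \<le> (real Q ^ dim) ^ d"
    by (metis of_nat_le_iff of_nat_mult of_nat_power)
  moreover have "(1 / 4) * real Q ^ (d * d) \<le> real (\<Prod>i<d. Q ^ d - Q ^ i)"
    using prod_power_diff_ge[of 2 Q d] Q_ge_2 by (simp add: power2_eq_square)
  then have "?c * ((1 / 4) * real Q ^ (d * d)) \<le> ?c * real (\<Prod>i<d. Q ^ d - Q ^ i)"
    by (rule mult_left_mono) simp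
  ultimately have "?c * real Q ^ (d * d) \<le> 4 * real Q ^ (dim * d)" by (simp add: power_mult)
  also have "dim * d = d * d + d * (dim - d)"
  proof -
    obtain k where "dim = d + k" using assms le_iff_add by blast
    then show ?thesis by (simp add: algebra_simps)
  qed
  then have "real Q ^ (dim * d) = real Q ^ (d * d) * real Q ^ (d * (dim - d))" by (simp add: power_add)
  finally have "?c \<le> 4 * real Q ^ (d * (dim - d))" by simp
  then have "subspace_weight d \<le> 4 * real Q ^ (d * (dim - d)) / real Q ^ (2 * (d * (dim - d)))"
    unfolding subspace_weight_def by (intro divide_right_mono) auto
  also have "real Q ^ (2 * (d * (dim - d))) = real Q ^ (d * (dim - d)) * real Q ^ (d * (dim - d))"
    by (simp add: mult_2 power_add)
  finally show ?thesis by simp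
qed

text \<open>3/2 rounds up 16/11, the reciprocal of the bound 11/16 available because
  \<open>Q ^ d \<ge> 4\<close>. The factor 1 - 1/Q in the number of bases cancels against the
  proportion of noncentral elements in a field.\<close>

lemma card_fields_le:
  assumes dim: "dim = d * r" and d: "2 \<le> d"
  shows "real (card (fields_of_degree d)) * real Q ^ (dim * r) \<le> 3 / 2 * real Q ^ (dim * dim)"
proof -
  let ?c = "real (card (fields_of_degree d))"
  let ?a = "1 - 1 / real Q"
  have a: "0 < ?a" using q_ge by simp
  have D: "4 \<le> Q ^ d"
  proof -
    have "(2::nat) ^ 2 \<le> Q ^ 2" using Q_ge_2 by (rule power_mono) simp
    also have "\<dots> \<le> Q ^ d" using d Q_ge_2 by (intro power_increasing) auto
    finally show ?thesis by simp
  qed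
  have "real (card (fields_of_degree d) * ((Q ^ d - Q) * (\<Prod>i<r. Q ^ dim - (Q ^ d) ^ i))) \<le>
      real (Q ^ d * (\<Prod>i<dim. Q ^ dim - Q ^ i))"
    using card_fields_of_degree[OF dim d] of_nat_le_iff by blast
  then have 1: "?c * (real (Q ^ d - Q) * real (\<Prod>i<r. (Q ^ d) ^ r - (Q ^ d) ^ i)) \<le>
      real Q ^ d * real (\<Prod>i<dim. Q ^ dim - Q ^ i)"
    by (simp add: dim power_mult)
  have "Q ^ 1 \<le> Q ^ d" using d Q_ge_2 by (intro power_increasing) auto
  then have "real (Q ^ d - Q) = real Q ^ d - real Q" by (simp add: of_nat_diff)
  moreover have "real Q ^ d * ?a = real Q ^ d - real Q ^ (d - 1)"
    using d by (cases d) (auto simp: field_simps)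
  moreover have "real Q ^ 1 \<le> real Q ^ (d - 1)" using d q_ge by (intro power_increasing) auto
  ultimately have 2: "real Q ^ d * ?a \<le> real (Q ^ d - Q)" by simp
  have "real (\<Prod>i<r. (Q ^ d) ^ r - (Q ^ d) ^ i) \<ge> 11 / 16 * real (Q ^ d) ^ (r * r)"
    using prod_power_diff_ge[OF D, of r] by (simp add: power2_eq_square)
  also have "real (Q ^ d) ^ (r * r) = real Q ^ (dim * r)" by (simp add: dim flip: power_mult) (simp add: mult.assoc)
  finally have 3: "11 / 16 * real Q ^ (dim * r) \<le> real (\<Prod>i<r. (Q ^ d) ^ r - (Q ^ d) ^ i)" .
  have 4: "real (\<Prod>i<dim. Q ^ dim - Q ^ i) \<le> ?a * real Q ^ (dim * dim)"
    using prod_power_diff_le[OF Q_ge_2, of dim] dim_pos by simp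
  have "?c * ((real Q ^ d * ?a) * (11 / 16 * real Q ^ (dim * r))) \<le>
      ?c * (real (Q ^ d - Q) * real (\<Prod>i<r. (Q ^ d) ^ r - (Q ^ d) ^ i))"
    using 2 3 a by (intro mult_left_mono mult_mono) auto
  also note 1
  also have "real Q ^ d * real (\<Prod>i<dim. Q ^ dim - Q ^ i) \<le> real Q ^ d * (?a * real Q ^ (dim * dim))"
    using 4 by (intro mult_left_mono) auto
  finally have "(real Q ^ d * ?a) * (?c * (11 / 16 * real Q ^ (dim * r))) \<le> (real Q ^ d * ?a) * real Q ^ (dim * dim)"
    by (simp only: mult_ac)
  moreover have "0 < real Q ^ d * ?a" using a q_ge by simp
  ultimately have "?c * (11 / 16 * real Q ^ (dim * r)) \<le> real Q ^ (dim * dim)"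
    by (rule mult_left_le_imp_le)
  then have "11 / 16 * (?c * real Q ^ (dim * r)) \<le> real Q ^ (dim * dim)"
    unfolding mult.left_commute[of ?c] .
  moreover have "0 \<le> real Q ^ (dim * dim)" by simp
  ultimately show ?thesis by linarith
qed

lemma density_centralizing:
  "density centralizing_pairs \<le> (\<Sum>d\<in>{d. d dvd dim \<and> 2 \<le> d}. 3 / 2 / real Q ^ (dim * (dim - dim div d)))"
proof (rule density_leI)
  have fin: "finite {d. d dvd dim \<and> 2 \<le> d}" using dim_pos by simp
  show "card centralizing_pairs \<le> (\<Sum>d\<in>{d. d dvd dim \<and> 2 \<le> d}. card (fields_of_degree d) * (Q ^ (dim * (dim div d)))\<^sup>2)"
    unfolding centralizing_pairs_def
  proof (rule card_UN_squares_le[OF fin])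
    fix d R assume "d \<in> {d. d dvd dim \<and> 2 \<le> d}" "R \<in> fields_of_degree d"
    then show "card (centralizer R) \<le> Q ^ (dim * (dim div d))"
      by (intro card_centralizer_le[of R d]) auto
  qed (rule finite_set_set)
  fix d assume d: "d \<in> {d. d dvd dim \<and> 2 \<le> d}"
  let ?r = "dim div d" and ?q = "real Q"
  have dr: "dim = d * ?r" using d by simp
  have rd: "?r \<le> dim" by simp
  have "dim * dim = dim * ?r + dim * (dim - ?r)" using rd by (simp flip: add_mult_distrib2)
  then have s: "?q ^ (dim * dim) = ?q ^ (dim * ?r) * ?q ^ (dim * (dim - ?r))" by (simp flip: power_add)
  have "real (card (fields_of_degree d) * (Q ^ (dim * ?r))\<^sup>2) = real (card (fields_of_degree d)) * ?q ^ (dim * ?r) * ?q ^ (dim * ?r)"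
    by (simp add: power2_eq_square)
  also have "\<dots> \<le> (3 / 2 * ?q ^ (dim * dim)) * ?q ^ (dim * ?r)"
    using card_fields_le[OF dr] d by (intro mult_right_mono) auto
  also have "\<dots> = 3 / 2 / ?q ^ (dim * (dim - ?r)) * (?q ^ (dim * dim) * ?q ^ (dim * dim))"
    unfolding s using q_ge by simp
  also have "?q ^ (dim * dim) * ?q ^ (dim * dim) = ?q ^ (2 * dim * dim)" by (simp flip: power_add) (simp add: mult_2 distrib_right)
  finally show "real (card (fields_of_degree d) * (Q ^ (dim * ?r))\<^sup>2) \<le> 3 / 2 / ?q ^ (dim * (dim - ?r)) * ?q ^ (2 * dim * dim)" .
qed

text \<open>Proper subfields have distinct orders between 2 and the largest order M, so there are at
  most M - 1 of them, and 4 (M - 1) \<le> M^2 \<le> Q.\<close>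

lemma card_proper_subfields: "4 * card proper_subfields \<le> Q"
proof (cases "proper_subfields = {}")
  case False
  let ?C = "card ` proper_subfields"
  have fin: "finite proper_subfields" by (rule finite_set_set)
  have C: "finite ?C" "?C \<noteq> {}" using fin False by auto
  let ?M = "Max ?C"
  obtain F where F: "F \<in> proper_subfields" "?M = card F" using Max_in[OF C] by auto
  have "?C \<subseteq> {2..?M}" using card_proper_subfield(1) C by auto
  then have "card ?C \<le> ?M - 1" using card_mono[of "{2..?M}" ?C] by simp
  moreover have "card ?C = card proper_subfields" by (rule card_image[OF inj_on_card_proper_subfields])
  moreover have "4 * (?M - 1) \<le> ?M\<^sup>2"
  proof -
    have "0 \<le> (int ?M - 2)\<^sup>2" by simp
    then have "4 * (int ?M - 1) \<le> (int ?M)\<^sup>2" by (simp add: power2_eq_square algebra_simps)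
    moreover have "1 \<le> ?M" using card_proper_subfield(1)[OF F(1)] F(2) by simp
    ultimately have "int (4 * (?M - 1)) \<le> int (?M\<^sup>2)" by (simp add: of_nat_diff)
    then show ?thesis by (simp only: of_nat_le_iff)
  qed
  moreover have "?M\<^sup>2 \<le> Q" using card_proper_subfield(2)[OF F(1)] F(2) by simp
  ultimately show ?thesis by linarith
qed simp

text \<open>For a subfield of order f the number of forms times the squared size of a stabilizer,
  relative to all pairs, is at most 4 (1 - 1/Q) (f/Q)^(n^2) with n = \<open>dim\<close>; the last
  factor is at most 1/Q^2.\<close>

lemma density_form:
  assumes "2 \<le> dim"
  shows "density form_pairs \<le> 4 * real (card proper_subfields) * (1 - 1 / real Q) / (real Q)\<^sup>2"
proof -
  have "density form_pairs \<le> (\<Sum>F\<in>proper_subfields. 4 * (1 - 1 / real Q) / (real Q)\<^sup>2)"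
  proof (rule density_leI)
    show "card form_pairs \<le> (\<Sum>F\<in>proper_subfields. card (forms F) * (card F ^ (dim * dim))\<^sup>2)"
      unfolding form_pairs_def using finite_set_set card_stabilizer_form_le
      by (intro card_UN_squares_le) auto
    fix F assume F: "F \<in> proper_subfields"
    let ?f = "real (card F)" and ?q = "real Q" and ?n = "dim * dim"
    have f: "2 \<le> card F" "?f\<^sup>2 \<le> ?q"
      using card_proper_subfield[OF F] by (simp_all flip: of_nat_power)
    have "real (card (forms F)) * (1 / 4 * ?f ^ ?n) \<le> real (card (forms F)) * real (\<Prod>i<dim. card F ^ dim - card F ^ i)"
      using prod_power_diff_ge[of 2 "card F" dim] f by (intro mult_left_mono) (auto simp: power2_eq_square)
    also have "\<dots> = real (\<Prod>i<dim. Q ^ dim - Q ^ i)"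
      using card_forms[OF F] by (metis of_nat_mult)
    also have "\<dots> \<le> (1 - 1 / ?q) * ?q ^ ?n"
      using prod_power_diff_le[OF Q_ge_2, of dim] dim_pos by simp
    finally have X: "real (card (forms F)) * ?f ^ ?n \<le> 4 * (1 - 1 / ?q) * ?q ^ ?n" by (simp add: algebra_simps)
    \<comment> \<open>Four of the n^2 factors are used for f^4 \<le> Q^2, the others only for f
      \<le> Q; \<open>2 \<le> dim\<close> provides the four.\<close>
    have fn: "?f ^ ?n * ?q\<^sup>2 \<le> ?q ^ ?n"
    proof -
      have fq: "?f \<le> ?q" using f card_mono[OF finite_set, of F centre] F by (auto simp: proper_subfields_def)
      have "2 * 2 \<le> ?n" using assms by (intro mult_le_mono)
      then have n4: "?n = 4 + (?n - 4)" by simp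
      have "?f ^ 4 * ?q\<^sup>2 \<le> ?q ^ 4"
      proof -
        have "?f ^ 4 = (?f\<^sup>2)\<^sup>2" by (simp flip: power_mult)
        also have "\<dots> \<le> ?q\<^sup>2" using f by (intro power_mono) auto
        finally have "?f ^ 4 * ?q\<^sup>2 \<le> ?q\<^sup>2 * ?q\<^sup>2" by (intro mult_right_mono) auto
        then show ?thesis by (simp flip: power_add)
      qed
      then have "(?f ^ 4 * ?q\<^sup>2) * ?f ^ (?n - 4) \<le> ?q ^ 4 * ?q ^ (?n - 4)"
        using fq by (intro mult_mono power_mono) auto
      then show ?thesis by (subst (1 2) n4) (simp add: power_add mult_ac)
    qed
    have "real (card (forms F) * (card F ^ ?n)\<^sup>2) * ?q\<^sup>2 = (real (card (forms F)) * ?f ^ ?n) * (?f ^ ?n * ?q\<^sup>2)"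
      by (simp add: power2_eq_square)
    also have "\<dots> \<le> (4 * (1 - 1 / ?q) * ?q ^ ?n) * ?q ^ ?n"
    proof (rule mult_mono[OF X fn])
      have "0 \<le> 1 - 1 / ?q" using q_ge by simp
      then show "0 \<le> 4 * (1 - 1 / ?q) * ?q ^ ?n" by (intro mult_nonneg_nonneg) auto
    qed simp
    also have "\<dots> = 4 * (1 - 1 / ?q) * ?q ^ (2 * dim * dim)" by (simp add: mult_2 distrib_right power_add)
    finally show "real (card (forms F) * (card F ^ ?n)\<^sup>2) \<le> 4 * (1 - 1 / ?q) / ?q\<^sup>2 * ?q ^ (2 * dim * dim)"
      using q_ge by (simp add: pos_le_divide_eq)
  qed
  then show ?thesis by (simp add: algebra_simps)
qed

lemma density_mono: "X \<subseteq> Y \<Longrightarrow> density X \<le> density Y"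
proof -
  assume "X \<subseteq> Y"
  moreover have "finite Y" by (rule finite_subset[OF _ finite_cartesian_product[OF fin fin]]) simp
  ultimately show ?thesis unfolding density_def by (intro divide_right_mono) (auto intro: card_mono)
qed

lemma density_Un_le: "density (X \<union> Y) \<le> density X + density Y"
  unfolding density_def using card_Un_le[of X Y]
  by (simp add: divide_right_mono flip: add_divide_distrib of_nat_add)

lemma density_bad:
  "density bad_pairs \<le> density reducible_pairs + density centralizing_pairs + density form_pairs"
  using density_mono[OF bad_pairs_subset] density_Un_le[of "reducible_pairs \<union> centralizing_pairs" form_pairs]
    density_Un_le[of reducible_pairs centralizing_pairs] by linarith

end

context simple_ring_module
begin

section \<open>The bound 5/8 by dimension and order of the centre\<close>

lemma density_form_le:
  assumes "2 \<le> dim"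
  shows "density form_pairs \<le> (1 - 1 / real Q) / real Q" "Q < 4 \<Longrightarrow> density form_pairs \<le> 0"
proof -
  let ?m = "real (card proper_subfields)" and ?q = "real Q"
  have m: "4 * ?m \<le> ?q" using card_proper_subfields by linarith
  have a: "0 \<le> 1 - 1 / ?q" using q_ge by simp
  have "4 * ?m * (1 - 1 / ?q) / ?q\<^sup>2 \<le> ?q * (1 - 1 / ?q) / ?q\<^sup>2"
    using m a by (intro divide_right_mono mult_right_mono) auto
  also have "\<dots> = (1 - 1 / ?q) / ?q" using q_ge by (simp add: power2_eq_square)
  finally show "density form_pairs \<le> (1 - 1 / ?q) / ?q" using density_form[OF assms] by linarith
  assume "Q < 4"
  then have "card proper_subfields = 0" using card_proper_subfields by simp
  then show "density form_pairs \<le> 0" using density_form[OF assms] by simp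
qed

text \<open>In dimension 1 an element preserving an \<open>F\<close>-form lies in \<open>F\<close>,
  so bad pairs lie in squares of proper subfields: at most Q/4 subfields with at most Q pairs
  each.\<close>

lemma density_bad_dim_1:
  assumes "dim = 1"
  shows "density bad_pairs \<le> 1 / 4"
proof -
  have "reducible_pairs = {}" using assms by (simp add: reducible_pairs_def)
  moreover have "{d. d dvd dim \<and> 2 \<le> d} = {}" using assms by auto
  then have "centralizing_pairs = {}" unfolding centralizing_pairs_def by (simp only: UN_empty)
  moreover have "stabilizer U \<subseteq> F" if F: "F \<in> proper_subfields" and U: "U \<in> forms F" for F U
  proof
    fix x assume x: "x \<in> stabilizer U"
    obtain bs where bs: "U = lspan F bs" "length bs = 1" "set bs \<subseteq> V" "lindep centre bs"
      using U assms by (auto simp: forms_def)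
    then obtain b where b: "bs = [b]" by (auto simp: length_Suc_conv)
    have sp: "lspan centre bs = V" using bs card_V assms by (intro basis_if_length) auto
    have dF: "div_subring 1 F" and FZ: "F \<subseteq> centre" using F by (auto simp: proper_subfields_def)
    have "1 * b + 0 \<in> U" unfolding bs(1) b using div_subringD(1)[OF dF] by (intro lspan_ConsI) auto
    then have "x * b \<in> U" using x by (simp add: stabilizer_def)
    then obtain c where c: "c \<in> F" "x * b = c * b" by (auto simp: bs(1) b)
    have "x = c"
    proof (rule determined_by_basis[OF _ _ _ sp])
      show "x * z = z * x" "c * z = z * c" if "z \<in> centre" for z
        using centre_commute[OF that] by simp_all
    qed (use c b in auto)
    then show "x \<in> F" using c by simp
  qed
  then have "form_pairs \<subseteq> (\<Union>F\<in>proper_subfields. F \<times> F)" unfolding form_pairs_def by blast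
  ultimately have sub: "bad_pairs \<subseteq> (\<Union>F\<in>proper_subfields. F \<times> F)" using bad_pairs_subset by auto
  have "card (\<Union>F\<in>proper_subfields. F \<times> F) \<le> (\<Sum>F\<in>proper_subfields. card (F \<times> F))"
    by (rule card_UN_le[OF finite_set_set])
  also have "\<dots> \<le> (\<Sum>F\<in>proper_subfields. Q)"
    using card_proper_subfield(2) by (intro sum_mono) (simp add: card_cartesian_product power2_eq_square)
  finally have "card (\<Union>F\<in>proper_subfields. F \<times> F) \<le> card proper_subfields * Q" by simp
  then have "4 * card (\<Union>F\<in>proper_subfields. F \<times> F) \<le> Q * Q"
    using mult_right_mono[OF card_proper_subfields, of Q] by linarith
  then have "real (4 * card (\<Union>F\<in>proper_subfields. F \<times> F)) \<le> real (Q * Q)"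
    by (simp only: of_nat_le_iff)
  then have "density (\<Union>F\<in>proper_subfields. F \<times> F) \<le> 1 / 4"
    using assms q_ge by (simp add: density_def power2_eq_square divide_le_eq)
  then show ?thesis using density_mono[OF sub] by linarith
qed

text \<open>For Q = 3 the first two families already give up to 4/9 + 1/6 = 11/18, but there are no
  proper subfields. From Q = 4 on, the three bounds add up to (2 Q + 3/2) / Q^2.\<close>

lemma density_bad_dim_2:
  assumes "dim = 2" "3 \<le> Q"
  shows "density bad_pairs < 5 / 8"
proof -
  let ?q = "real Q"
  have q: "3 \<le> ?q" using assms by simp
  have "{1..<dim} = {1}" using assms by auto
  then have "density reducible_pairs \<le> subspace_weight 1" using density_reducible by simp
  also have "\<dots> = (?q ^ 2 - 1) / (?q - 1) / ?q ^ 2" using subspace_weight_end(1)[of 1] assms by simp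
  also have "?q ^ 2 - 1 = (?q + 1) * (?q - 1)" by (simp add: power2_eq_square algebra_simps)
  then have "(?q ^ 2 - 1) / (?q - 1) / ?q ^ 2 = (?q + 1) / ?q ^ 2" using q by simp
  finally have 1: "density reducible_pairs \<le> (?q + 1) / ?q ^ 2" .
  have "{d. d dvd dim \<and> 2 \<le> d} = {2}" using assms by (auto dest: dvd_imp_le)
  then have 2: "density centralizing_pairs \<le> 3 / 2 / ?q ^ 2"
    using density_centralizing assms by simp
  show ?thesis
  proof (cases "Q = 3")
    case True
    then show ?thesis using 1 2 density_form_le(2) assms density_bad by simp
  next
    case False
    then have q4: "4 \<le> ?q" using assms by simp
    have "density bad_pairs \<le> (?q + 1) / ?q ^ 2 + 3 / 2 / ?q ^ 2 + (1 - 1 / ?q) / ?q"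
      using 1 2 density_form_le(1) assms density_bad by simp
    also have "\<dots> = (2 * ?q + 3 / 2) / ?q ^ 2" using q by (simp add: field_simps power2_eq_square)
    also have "\<dots> < 5 / 8"
    proof -
      have "4 * ?q \<le> ?q * ?q" using q4 by (intro mult_right_mono) auto
      then have "2 * ?q + 3 / 2 < 5 / 8 * (?q * ?q)" using q4 by linarith
      then show ?thesis using q by (simp add: power2_eq_square divide_less_eq)
    qed
    finally show ?thesis .
  qed
qed

lemma density_form_le_quarter:
  assumes "2 \<le> dim"
  shows "density form_pairs \<le> 1 / 4"
proof -
  have "0 \<le> (1 / real Q - 1 / 2)\<^sup>2" by simp
  then have "(1 - 1 / real Q) * (1 / real Q) \<le> 1 / 4" by (simp add: power2_eq_square algebra_simps)
  moreover have "(1 - 1 / real Q) / real Q = (1 - 1 / real Q) * (1 / real Q)" by simp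
  ultimately show ?thesis using density_form_le(1)[OF assms] by linarith
qed

lemma density_bad_dim_3:
  assumes "dim = 3" "3 \<le> Q"
  shows "density bad_pairs < 5 / 8"
proof -
  let ?q = "real Q"
  have q: "3 \<le> ?q" using assms by simp
  have "{1..<dim} = {1, 2}" using assms by auto
  then have "density reducible_pairs \<le> subspace_weight 1 + subspace_weight 2" using density_reducible by simp
  also have "\<dots> \<le> 2 / ?q ^ 2 + 2 / ?q ^ 2"
    using subspace_weight_end(2)[of 1] subspace_weight_end(2)[of 2] assms by simp
  finally have 1: "density reducible_pairs \<le> 4 / ?q ^ 2" by simp
  have "{d. d dvd dim \<and> 2 \<le> d} = {3}"
  proof -
    have "d = 3" if "d dvd 3" "2 \<le> d" for d :: nat
    proof -
      have "d \<le> 3" using that by (auto dest: dvd_imp_le)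
      then have "d = 2 \<or> d = 3" using that by auto
      then show ?thesis using that by auto
    qed
    then show ?thesis using assms by auto
  qed
  then have 2: "density centralizing_pairs \<le> 3 / 2 / ?q ^ 6" using density_centralizing assms by simp
  have "(3::real) ^ 6 \<le> ?q ^ 6" using q by (intro power_mono) auto
  then have "3 / 2 / ?q ^ 6 \<le> 3 / 2 / 3 ^ 6" by (intro divide_left_mono) auto
  also have "\<dots> \<le> (1 / 100 :: real)" by simp
  finally have 2: "density centralizing_pairs \<le> 1 / 100" using 2 by linarith
  show ?thesis
  \<comment> \<open>Here too Q = 3 is saved by the absence of proper subfields: 4/9 + 1/4 would
    exceed 5/8.\<close>
  proof (cases "Q = 3")
    case True
    then show ?thesis using 1 2 density_form_le(2) assms density_bad by simp
  next
    case False
    then have "4 ^ 2 \<le> ?q ^ 2" using assms by (intro power_mono) auto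
    then have "4 / ?q ^ 2 \<le> 4 / 4 ^ 2" by (intro divide_left_mono) auto
    then have "4 / ?q ^ 2 \<le> 1 / 4" by simp
    moreover have "density form_pairs \<le> 1 / 4" using assms by (intro density_form_le_quarter) auto
    ultimately show ?thesis using 1 2 density_bad by linarith
  qed
qed

text \<open>Lines and hyperplanes contribute at most 2 / Q^(dim - 1) each; the other
  \<open>dim - 3\<close> dimensions share one bound, that of d = 2.\<close>

lemma density_reducible_le:
  assumes "4 \<le> dim"
  shows "density reducible_pairs \<le> 4 / real Q ^ (dim - 1) + real (dim - 3) * (4 / real Q ^ (2 * (dim - 2)))"
proof -
  have split: "{1..<dim} = insert 1 (insert (dim - 1) {2..<dim - 1})" using assms by auto
  have mid: "subspace_weight d \<le> 4 / real Q ^ (2 * (dim - 2))" if "d \<in> {2..<dim - 1}" for d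
  proof -
    \<comment> \<open>Measuring \<open>d\<close> and \<open>dim - d\<close> from 2 turns the
      inequality into \<open>0 \<le> i * j\<close>.\<close>
    define i where "i = d - 2"
    define j where "j = dim - d - 2"
    have ij: "d = i + 2" "dim - d = j + 2" using that by (auto simp: i_def j_def)
    then have "dim - 2 = i + j + 2" using that by simp
    then have "2 * (dim - 2) \<le> (i + 2) * (j + 2)" by (simp add: algebra_simps)
    also have "\<dots> = d * (dim - d)" using arg_cong2[where f="(*)", OF ij] by (rule sym)
    finally have "2 * (dim - 2) \<le> d * (dim - d)" .
    then have "real Q ^ (2 * (dim - 2)) \<le> real Q ^ (d * (dim - d))" using q_ge by (intro power_increasing) auto
    then have "4 / real Q ^ (d * (dim - d)) \<le> 4 / real Q ^ (2 * (dim - 2))"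
      using q_ge by (intro divide_left_mono) auto
    moreover have "subspace_weight d \<le> 4 / real Q ^ (d * (dim - d))"
      using that by (intro subspace_weight_le) auto
    ultimately show ?thesis by linarith
  qed
  have "(\<Sum>d\<in>{1..<dim}. subspace_weight d) =
      subspace_weight 1 + (subspace_weight (dim - 1) + (\<Sum>d\<in>{2..<dim - 1}. subspace_weight d))"
    unfolding split using assms by simp
  also have "(\<Sum>d\<in>{2..<dim - 1}. subspace_weight d) \<le> real (dim - 3) * (4 / real Q ^ (2 * (dim - 2)))"
    using sum_bounded_above[of "{2..<dim - 1}" subspace_weight, OF mid] by (simp add: numeral_3_eq_3)
  finally show ?thesis
    using density_reducible subspace_weight_end(2)[of 1] subspace_weight_end(2)[of "dim - 1"] assms by simp
qed

text \<open>Each exponent is at least \<open>2 * dim\<close>, and half of that power absorbs the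
  number of divisors.\<close>

lemma density_centralizing_le:
  assumes "4 \<le> dim"
  shows "density centralizing_pairs \<le> 3 / 2 / real Q ^ dim"
proof -
  let ?D = "{d. d dvd dim \<and> 2 \<le> d}"
  have "3 / 2 / real Q ^ (dim * (dim - dim div d)) \<le> 3 / 2 / real Q ^ (dim * 2)" if "d \<in> ?D" for d
  proof -
    have "dim div d \<le> dim div 2" using that by (intro div_le_mono2) auto
    then have "2 \<le> dim - dim div d" using assms by linarith
    then have "dim * 2 \<le> dim * (dim - dim div d)" by simp
    then have "real Q ^ (dim * 2) \<le> real Q ^ (dim * (dim - dim div d))" using q_ge by (intro power_increasing) auto
    then show ?thesis using q_ge by (intro divide_left_mono) auto
  qed
  then have "(\<Sum>d\<in>?D. 3 / 2 / real Q ^ (dim * (dim - dim div d))) \<le> real (card ?D) * (3 / 2 / real Q ^ (dim * 2))"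
    by (rule sum_bounded_above)
  also have "\<dots> \<le> real Q ^ dim * (3 / 2 / real Q ^ (dim * 2))"
  proof (rule mult_right_mono)
    have "?D \<subseteq> {1..dim}" using assms by (auto dest: dvd_imp_le)
    then have "card ?D \<le> dim" using card_mono[of "{1..dim}" ?D] by simp
    also have "dim \<le> 2 ^ dim" by (simp add: less_imp_le)
    also have "\<dots> \<le> Q ^ dim" using Q_ge_2 by (intro power_mono) auto
    finally show "real (card ?D) \<le> real Q ^ dim" by (simp flip: of_nat_power)
  qed auto
  also have "\<dots> = 3 / 2 / real Q ^ dim" using q_ge by (simp add: mult_2_right power_add)
  finally show ?thesis using density_centralizing by linarith
qed

lemma Suc_le_power: "2 \<le> (b :: nat) \<Longrightarrow> Suc m \<le> b ^ m"
  by (metis Suc_leI less_exp le_trans power_mono zero_le)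

text \<open>The case dim = 4, Q = 2 is left out because these bounds would give 1/2 + 1/4 + 3/32
  there.\<close>

lemma density_bad_large:
  assumes "4 \<le> dim" "3 \<le> Q \<or> 5 \<le> dim"
  shows "density bad_pairs < 5 / 8"
proof -
  let ?q = "real Q"
  have bound: "density bad_pairs \<le> 4 / ?q ^ (dim - 1) + real (dim - 3) * (4 / ?q ^ (2 * (dim - 2))) +
      3 / 2 / ?q ^ dim + density form_pairs"
    using density_bad density_reducible_le[OF assms(1)] density_centralizing_le[OF assms(1)] by linarith
  have inv: "c / ?q ^ k \<le> c / m ^ l" if "m \<le> ?q" "1 \<le> m" "l \<le> k" "0 \<le> c" for c m :: real and k l
  proof -
    have "m ^ l \<le> m ^ k" using that by (intro power_increasing) auto
    also have "\<dots> \<le> ?q ^ k" using that by (intro power_mono) auto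
    finally show ?thesis using that by (intro divide_left_mono) auto
  qed
  show ?thesis
  proof (cases "3 \<le> Q")
    case True
    then have q: "3 \<le> ?q" by simp
    obtain m where m: "dim = m + 4" using assms(1) by (metis add.commute le_Suc_ex)
    \<comment> \<open>The number m + 1 of middle dimensions is absorbed by the factor 3^(2 m) of the
      denominator.\<close>
    have "real (Suc m) \<le> real (9 ^ m)" using Suc_le_power[of 9 m] of_nat_le_iff by fastforce
    then have "real (Suc m) * (4 / ?q ^ (2 * (m + 2))) \<le> 9 ^ m * (4 / 3 ^ (2 * (m + 2)))"
      using inv[of 3 "2 * (m + 2)" "2 * (m + 2)" 4] q by (intro mult_mono) auto
    also have "\<dots> = 4 / 81" by (simp add: power_add power_mult)
    finally have "real (dim - 3) * (4 / ?q ^ (2 * (dim - 2))) \<le> 4 / 81" by (simp add: m)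
    moreover have "4 / ?q ^ (dim - 1) \<le> 4 / 27" using inv[of 3 3 "dim - 1" 4] assms q by simp
    moreover have "3 / 2 / ?q ^ dim \<le> 1 / 54" using inv[of 3 4 dim "3 / 2"] assms q by simp
    moreover have "density form_pairs \<le> 1 / 4" using assms by (intro density_form_le_quarter) auto
    ultimately show ?thesis using bound by linarith
  next
    case False
    then have Q: "Q = 2" using Q_ge_2 by simp
    then have "5 \<le> dim" using assms by simp
    then obtain m where m: "dim = m + 5" by (metis add.commute le_Suc_ex)
    have "Suc (Suc m) \<le> 2 * 4 ^ m" using Suc_le_power[of 4 m] by linarith
    then have "real (Suc (Suc m)) \<le> real (2 * 4 ^ m)" by (simp only: of_nat_le_iff)
    then have "real (Suc (Suc m)) * (4 / ?q ^ (2 * (m + 3))) \<le> (2 * 4 ^ m) * (4 / 2 ^ (2 * (m + 3)))"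
      using Q by (intro mult_mono) auto
    also have "\<dots> = 1 / 8" by (simp add: power_add power_mult)
    finally have "real (Suc (Suc m)) * (4 / ?q ^ (2 * (m + 3))) \<le> 1 / 8" .
    moreover have "dim - 3 = Suc (Suc m)" "dim - 2 = m + 3" using m by simp_all
    ultimately have "real (dim - 3) * (4 / ?q ^ (2 * (dim - 2))) \<le> 1 / 8" by (simp only:)
    moreover have "4 / ?q ^ (dim - 1) \<le> 1 / 4" using inv[of 2 4 "dim - 1" 4] m q_ge by simp
    moreover have "3 / 2 / ?q ^ dim \<le> 3 / 64" using inv[of 2 5 dim "3 / 2"] m q_ge by simp
    moreover have "density form_pairs \<le> 0" using assms Q by (intro density_form_le) auto
    ultimately show ?thesis using bound by linarith
  qed
qed

text \<open>Exact numbers of subspaces are used: they yield 15/64 + 35/256 + 15/64 = 155/256, just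
  below the allowed 160/256, and the centralizers fit into the gap.\<close>

lemma density_bad_dim_4_Q_2:
  assumes "dim = 4" "Q = 2"
  shows "density bad_pairs < 5 / 8"
proof -
  have "{1..<dim} = {1, 2, 3}" using assms by auto
  then have "density reducible_pairs \<le> subspace_weight 1 + subspace_weight 2 + subspace_weight 3"
    using density_reducible by simp
  moreover have "subspace_weight 1 = 15 / 64" "subspace_weight 3 = 15 / 64"
    using subspace_weight_end(1)[of 1] subspace_weight_end(1)[of 3] assms by simp_all
  moreover have "card (subspaces 2) = 35"
  proof -
    have "{..<2::nat} = {0, 1}" by auto
    then have "card (subspaces 2) * (\<Prod>i\<in>{0, 1}. 2 ^ 2 - 2 ^ i) = (\<Prod>i\<in>{0, 1}. 2 ^ 4 - 2 ^ i)"
      using card_subspaces[of 2] assms by (simp only:)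
    then show ?thesis by simp
  qed
  then have "subspace_weight 2 = 35 / real Q ^ (2 * (2 * (dim - 2)))" by (simp only: subspace_weight_def of_nat_numeral)
  then have "subspace_weight 2 = 35 / 256" unfolding assms(1) by (simp add: \<open>Q = 2\<close>)
  moreover have "{d. d dvd dim \<and> 2 \<le> d} = {2, 4}"
  proof -
    have "d = 2 \<or> d = 4" if "d dvd 4" "2 \<le> d" for d :: nat
    proof -
      have "d \<le> 4" using that by (auto dest: dvd_imp_le)
      then have "d = 2 \<or> d = 3 \<or> d = 4" using that by auto
      then show ?thesis using that by auto
    qed
    then show ?thesis using assms by auto
  qed
  then have "density centralizing_pairs \<le> 3 / 2 / 2 ^ 8 + 3 / 2 / 2 ^ 12"
    using density_centralizing assms by simp
  moreover have "density form_pairs \<le> 0" using assms by (intro density_form_le) auto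
  ultimately show ?thesis using density_bad by simp
qed

end

section \<open>The two-element field in dimensions two and three\<close>

locale simple_ring_module_2 = simple_ring_module V 2 for V :: "'a::ring_1 set"
begin

lemma centre_eq: "centre = {0, 1 :: 'a}"
proof -
  have "{0, 1 :: 'a} = centre" by (rule card_seteq[OF finite_set]) (use FD(1,3) in auto)
  then show ?thesis by simp
qed

lemma double [simp]: "x + x = (0 :: 'a)"
proof -
  have "(1 :: 'a) + 1 \<in> {0, 1}" using FD(1,5) unfolding centre_eq[symmetric] by blast
  moreover have "(1 :: 'a) + 1 \<noteq> 1" by (metis add_cancel_right_right zero_neq_one)
  ultimately have "(1 :: 'a) + 1 = 0" by blast
  moreover have "x + x = (1 + 1) * x" by (simp only: distrib_right mult_1)
  ultimately show ?thesis by simp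
qed

lemma add_cancel [simp]: "x + (x + y) = (y :: 'a)"
  by (simp flip: add.assoc)

lemma add_cancel' [simp]: "x + (y + x) = (y :: 'a)"
  by (simp add: add.left_commute)

lemma add_eq_0_iff_eq: "x + y = 0 \<longleftrightarrow> x = (y :: 'a)"
  by (metis add_cancel add_0_right double)

lemma minus_eq [simp]: "- x = (x :: 'a)" "x - y = x + (y :: 'a)"
proof -
  show 1: "- x = x" for x :: 'a by (rule minus_unique) simp
  show "x - y = x + y" using 1[of y] by (metis diff_conv_add_uminus)
qed

lemma lspan_Cons_2:
  "lspan centre (v # vs) = lspan centre vs \<union> (\<lambda>s. v + s) ` lspan centre (vs :: 'a list)"
proof (intro equalityI subsetI)
  fix x assume "x \<in> lspan centre vs \<union> (\<lambda>s. v + s) ` lspan centre vs"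
  then obtain s where "s \<in> lspan centre vs" "x = 0 * v + s \<or> x = 1 * v + s" by auto
  then show "x \<in> lspan centre (v # vs)" using FD(1,3) lspan_ConsI by metis
qed (auto simp: centre_eq)

lemma lspan_1: "lspan centre [v] = {0, v :: 'a}"
  unfolding lspan_Cons_2 by auto

lemma lspan_2: "lspan centre [v, w] = {0, v, w, v + w :: 'a}"
  unfolding lspan_Cons_2 by auto

lemma lindep_2: "lindep centre [v, w] \<longleftrightarrow> v \<noteq> 0 \<and> w \<noteq> 0 \<and> v \<noteq> (w :: 'a)"
  using lspan_1[of w] by auto

text \<open>Elements having \<open>v\<close> as an eigenvector; the eigenvalue may be 0 as well as
  1, so \<open>v\<close> is not necessarily fixed.\<close>

definition fixing :: "'a \<Rightarrow> 'a set" where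
  "fixing v = {x. x * v \<in> {0, v}}"

text \<open>After extension to a basis, each listed vector has two possible images and each added
  one has all of \<open>V\<close>.\<close>

lemma card_fixing_list:
  assumes "set vs \<subseteq> V" "lindep centre vs"
  shows "card {x. \<forall>v\<in>set vs. x \<in> fixing v} = 2 ^ length vs * (2 ^ dim) ^ (dim - length vs)"
proof -
  obtain us where us: "set us \<subseteq> V" "lindep centre (us @ vs)" "lspan centre (us @ vs) = V"
    using lindep_extend[OF assms] by metis
  have len: "length us = dim - length vs" using length_basis[of "us @ vs"] us assms by simp
  let ?Ss = "replicate (length us) V @ map (\<lambda>v. {0, v}) vs"
  have "{x. \<forall>v\<in>set vs. x \<in> fixing v} = {a. list_all2 (\<lambda>v S. a * v \<in> S) (us @ vs) ?Ss}"
  proof (rule Set.set_eqI)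
    fix x
    have "list_all2 (\<lambda>v S. x * v \<in> S) us (replicate (length us) V)"
      using us(1) V_closed by (auto simp: list_all2_replicate_iff)
    moreover have "list_all2 (\<lambda>v S. x * v \<in> S) ws (map (\<lambda>v. {0, v}) ws) \<longleftrightarrow> (\<forall>v\<in>set ws. x \<in> fixing v)" for ws
      by (induction ws) (simp_all add: fixing_def)
    ultimately show "x \<in> {x. \<forall>v\<in>set vs. x \<in> fixing v} \<longleftrightarrow> x \<in> {a. list_all2 (\<lambda>v S. a * v \<in> S) (us @ vs) ?Ss}"
      by (simp add: list_all2_append)
  qed
  also have "card \<dots> = prod_list (map card ?Ss)"
  proof (rule card_operators)
    show "set (us @ vs) \<subseteq> V" using us(1) assms(1) by simp
    show "S \<subseteq> V" if "S \<in> set ?Ss" for S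
    proof -
      have "S = V \<or> (\<exists>v\<in>set vs. S = {0, v})" using that by (auto split: if_splits)
      then show ?thesis using assms(1) VD(1) by auto
    qed
  qed (use us in simp_all)
  also have "\<dots> = (2 ^ dim) ^ (dim - length vs) * prod_list (map (\<lambda>v. card {0, v}) vs)"
    by (simp add: prod_list_replicate_nat card_V len comp_def)
  also have "prod_list (map (\<lambda>v. card {0, v}) vs) = 2 ^ length vs"
    using assms
  proof (induction vs)
    case (Cons v vs)
    have "v \<noteq> 0" using Cons.prems zero_in_lspan[OF FD(3)] by auto
    then show ?case using Cons by simp
  qed simp
  finally show ?thesis by (simp add: mult.commute)
qed

lemma card_fixing: "v \<in> V \<Longrightarrow> v \<noteq> 0 \<Longrightarrow> card (fixing v) = 2 * (2 ^ dim) ^ (dim - 1)"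
  using card_fixing_list[of "[v]"] by simp

lemma card_fixing_Int:
  assumes "v \<in> V" "w \<in> V" "v \<noteq> 0" "w \<noteq> 0" "v \<noteq> w"
  shows "card (fixing v \<inter> fixing w) = 4 * (2 ^ dim) ^ (dim - 2)"
proof -
  have "lindep centre [v, w]" unfolding lindep_2 using assms by blast
  then have "card {x. \<forall>v\<in>set [v, w]. x \<in> fixing v} = 2 ^ length [v, w] * (2 ^ dim) ^ (dim - length [v, w])"
    by (intro card_fixing_list) (use assms(1,2) in simp_all)
  moreover have "{x. \<forall>v\<in>set [v, w]. x \<in> fixing v} = fixing v \<inter> fixing w" by auto
  ultimately show ?thesis by (simp add: numeral_2_eq_2)
qed

lemma subspaces_1: "subspaces 1 = (\<lambda>v. {0, v}) ` (V - {0})"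
proof (intro equalityI subsetI)
  fix W assume W: "W \<in> subspaces 1"
  then have sub: "lsubspace 1 centre W" "W \<subseteq> V" "card W = 2" by (auto simp: subspaces_def)
  have "0 \<in> W" using lsubspaceD(1)[OF sub(1)] .
  moreover obtain x y where "W = {x, y}" "x \<noteq> y" using sub(3) by (auto simp: card_2_iff)
  ultimately obtain v where "W = {0, v}" "v \<noteq> 0" by auto
  then show "W \<in> (\<lambda>v. {0, v}) ` (V - {0})" using sub by auto
next
  fix W assume "W \<in> (\<lambda>v. {0, v}) ` (V - {0})"
  then obtain v where v: "v \<in> V" "v \<noteq> 0" "W = {0, v}" by auto
  have "lsubspace 1 centre (lspan centre [v])" using v by (intro lsubspace_lspan) auto
  then show "W \<in> subspaces 1" using v VD(1) by (simp add: lspan_1 subspaces_def del: lspan.simps)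
qed

lemma stabilizer_line: "stabilizer {0, v} = fixing v"
  by (auto simp: stabilizer_def fixing_def)

lemma form_pairs_empty: "form_pairs = {}"
proof -
  have "card proper_subfields = 0" using card_proper_subfields by simp
  then have "proper_subfields = {}" using finite_set_set by simp
  then show ?thesis by (simp add: form_pairs_def)
qed

section \<open>Pairs with a common eigenvector, and dimension three\<close>

definition line_pairs :: "('a \<times> 'a) set" where
  "line_pairs = (\<Union>v\<in>V - {0}. fixing v \<times> fixing v)"

lemma line_pairs_eq: "line_pairs = (\<Union>W\<in>subspaces 1. stabilizer W \<times> stabilizer W)"
  unfolding line_pairs_def subspaces_1 by (simp add: stabilizer_line)

lemma stabilizer_iff:
  assumes "lsubspace 1 centre W" "set ws \<subseteq> W" "lspan centre ws = W"
  shows "a \<in> stabilizer W \<longleftrightarrow> (\<forall>w\<in>set ws. a * w \<in> W)"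
proof
  assume a: "\<forall>w\<in>set ws. a * w \<in> W"
  have "a * x \<in> W" if "x \<in> lspan centre us" "set us \<subseteq> set ws" for x us
    using that a lsubspaceD(1,3)[OF assms(1)]
    by (induction us arbitrary: x) (auto simp: centre_eq distrib_left)
  then show "a \<in> stabilizer W" using assms(3) by (auto simp: stabilizer_def)
qed (use assms(2) in \<open>auto simp: stabilizer_def\<close>)

text \<open>Bonferroni's inequality, with the pairwise intersections moved to the other side to
  avoid subtraction in \<open>nat\<close>.\<close>

lemma card_prod_Un3_ge:
  fixes A B C :: "'b set"
  assumes "finite A" "finite B" "finite C"
  shows "card A * card A + card B * card B + card C * card C \<le>
    card (A \<times> A \<union> B \<times> B \<union> C \<times> C) + card (A \<inter> B) * card (A \<inter> B) +
    card (A \<inter> C) * card (A \<inter> C) + card (B \<inter> C) * card (B \<inter> C)"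
proof -
  let ?A = "A \<times> A" and ?B = "B \<times> B" and ?C = "C \<times> C"
  have "card ?A + card ?B = card (?A \<union> ?B) + card (?A \<inter> ?B)"
    using assms by (intro card_Un_Int) auto
  moreover have "card (?A \<union> ?B) + card ?C = card (?A \<union> ?B \<union> ?C) + card ((?A \<union> ?B) \<inter> ?C)"
    using assms by (intro card_Un_Int) auto
  moreover have "(?A \<union> ?B) \<inter> ?C = ?A \<inter> ?C \<union> ?B \<inter> ?C" by blast
  then have "card ((?A \<union> ?B) \<inter> ?C) \<le> card (?A \<inter> ?C) + card (?B \<inter> ?C)" by (simp add: card_Un_le)
  ultimately show ?thesis by (simp add: card_cartesian_product Times_Int_Times)
qed

text \<open>The stabilizer of \<open>W\<close> has 128 elements. For each of the three lines of
  \<open>W\<close>, 64 of them also preserve the line, and at most 32 preserve two given lines. So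
  at least 3 * 64^2 - 3 * 32^2 = 9216 of the 128^2 pairs are already in
  \<open>line_pairs\<close>.\<close>

lemma card_plane_pairs:
  assumes dim: "dim = 3" and W: "W \<in> subspaces 2"
  shows "card (stabilizer W \<times> stabilizer W - line_pairs) \<le> 7168"
proof -
  obtain us ws where ws: "set ws \<subseteq> W" "lindep centre ws" "lspan centre ws = W" "length ws = 2"
    "set us \<subseteq> V" "lindep centre (us @ ws)" "lspan centre (us @ ws) = V" "length us + 2 = dim"
    by (rule subspace_basis[OF W])
  obtain a b where ab: "ws = [a, b]" using ws(4) by (auto simp: length_Suc_conv numeral_2_eq_2)
  obtain u where u: "us = [u]" using ws(8) dim by (auto simp: length_Suc_conv)
  have sub: "lsubspace 1 centre W" "W \<subseteq> V" "card W = 4" using W by (auto simp: subspaces_def)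
  have Weq: "W = {0, a, b, a + b}" using ws(3) unfolding ab lspan_2 by simp
  have ne: "a \<noteq> 0" "b \<noteq> 0" "a \<noteq> b" using ws(2) unfolding ab lindep_2 by blast+
  have nab: "a + b \<noteq> 0" "a \<noteq> a + b" "b \<noteq> a + b"
    using ne add_cancel[of a b] by (metis add_0_right, auto)
  \<comment> \<open>In a basis consisting of one vector outside \<open>W\<close>, then
    \<open>w\<close> and \<open>v\<close>, the numbers of possible images are 8, 4 and 2.\<close>
  have card64: "card (fixing v \<inter> stabilizer W) = 64"
    if v: "v \<in> W" "w \<in> W" "v \<noteq> 0" "w \<noteq> 0" "v \<noteq> w" for v w
  proof -
    have i: "lindep centre [w, v]" unfolding lindep_2 using v by blast
    interpret W: finite_lspace 1 centre W using subspace_lspace[OF W] .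
    have sp: "lspan centre [w, v] = W" using v i sub by (intro W.basis_if_length) auto
    have "set [w, v] \<subseteq> V" using v sub by auto
    then obtain xs where xs: "set xs \<subseteq> V" "lindep centre (xs @ [w, v])" "lspan centre (xs @ [w, v]) = V"
      using lindep_extend[OF _ i] by metis
    have len: "length (xs @ [w, v]) = dim" using xs v sub by (intro length_basis) auto
    then have len: "length xs = 1" using dim by simp
    let ?Ss = "replicate (length xs) V @ [W, {0, v}]"
    have "fixing v \<inter> stabilizer W = {a. list_all2 (\<lambda>v S. a * v \<in> S) (xs @ [w, v]) ?Ss}"
    proof (rule Set.set_eqI)
      fix x
      have "x \<in> stabilizer W \<longleftrightarrow> x * w \<in> W \<and> x * v \<in> W"
        using stabilizer_iff[OF sub(1) _ sp, of x] v by auto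
      moreover have "{0, v} \<subseteq> W" using v W.VD(1) by auto
      ultimately show "x \<in> fixing v \<inter> stabilizer W \<longleftrightarrow>
          x \<in> {a. list_all2 (\<lambda>v S. a * v \<in> S) (xs @ [w, v]) ?Ss}"
        using xs V_closed by (auto simp: fixing_def list_all2_append list_all2_replicate_iff)
    qed
    also have "card \<dots> = prod_list (map card ?Ss)"
      using xs v sub VD(1) by (intro card_operators) auto
    also have "\<dots> = 64" using len sub v card_V dim by simp
    finally show ?thesis .
  qed
  have card32: "card ((fixing v \<inter> stabilizer W) \<inter> (fixing w \<inter> stabilizer W)) \<le> 32"
    if "v \<in> W" "w \<in> W" "v \<noteq> 0" "w \<noteq> 0" "v \<noteq> w" for v w
  proof -
    have "card ((fixing v \<inter> stabilizer W) \<inter> (fixing w \<inter> stabilizer W)) \<le> card (fixing v \<inter> fixing w)"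
      by (intro card_mono finite_set) auto
    moreover have "v \<in> V" "w \<in> V" using that sub(2) by blast+
    ultimately show ?thesis using card_fixing_Int[of v w] that dim by simp
  qed
  let ?A = "fixing a \<inter> stabilizer W" and ?B = "fixing b \<inter> stabilizer W" and ?C = "fixing (a + b) \<inter> stabilizer W"
  have inW: "a \<in> W" "b \<in> W" "a + b \<in> W" by (auto simp: Weq)
  have c: "card ?A = 64" "card ?B = 64" "card ?C = 64"
    using card64[OF inW(1,2) ne] card64[OF inW(2,1) ne(2,1)] card64[OF inW(3,1) nab(1) ne(1)] ne nab by auto
  have i: "card (?A \<inter> ?B) \<le> 32" "card (?A \<inter> ?C) \<le> 32" "card (?B \<inter> ?C) \<le> 32"
    using card32[OF inW(1,2) ne] card32[OF inW(1,3) ne(1) nab(1,2)] card32[OF inW(2,3) ne(2) nab(1,3)] by auto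
  have sq: "x * x \<le> 1024" if "x \<le> 32" for x :: nat using mult_le_mono[OF that that] by simp
  have U: "9216 \<le> card (?A \<times> ?A \<union> ?B \<times> ?B \<union> ?C \<times> ?C)"
    using card_prod_Un3_ge[of ?A ?B ?C] finite_set c sq[OF i(1)] sq[OF i(2)] sq[OF i(3)] by simp
  have sW: "card (stabilizer W) = 128" using card_stabilizer[OF W] dim by simp
  have "stabilizer W \<times> stabilizer W - line_pairs \<subseteq>
      stabilizer W \<times> stabilizer W - (?A \<times> ?A \<union> ?B \<times> ?B \<union> ?C \<times> ?C)"
    using inW ne nab sub(2) by (auto simp: line_pairs_def)
  then have "card (stabilizer W \<times> stabilizer W - line_pairs) \<le>
      card (stabilizer W \<times> stabilizer W - (?A \<times> ?A \<union> ?B \<times> ?B \<union> ?C \<times> ?C))"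
    using finite_set by (intro card_mono) auto
  also have "\<dots> = card (stabilizer W \<times> stabilizer W) - card (?A \<times> ?A \<union> ?B \<times> ?B \<union> ?C \<times> ?C)"
    using finite_set by (intro card_Diff_subset) auto
  also have "\<dots> \<le> 7168" using U sW by (simp add: card_cartesian_product)
  finally show ?thesis .
qed

text \<open>It suffices to remove overlaps with one line: \<open>v0\<close> counts in full and each
  of the other six only outside of it, 128^2 + 6 * (128^2 - 32^2) = 108544.\<close>

lemma card_line_pairs_dim_3:
  assumes dim: "dim = 3"
  shows "card line_pairs \<le> 108544"
proof -
  obtain v0 where v0: "v0 \<in> V" "v0 \<noteq> 0" using V0 VD(1) by auto
  let ?A = "fixing v0 \<times> fixing v0"
  let ?D = "\<lambda>v. fixing v \<times> fixing v - ?A"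
  have fin2: "finite (X :: ('a \<times> 'a) set)" for X
    by (rule finite_subset[OF _ finite_cartesian_product[OF fin fin]]) simp
  have "card (?D v) = 15360" if "v \<in> V - {0, v0}" for v
  proof -
    have "card (?D v) = card (fixing v \<times> fixing v) - card (fixing v \<times> fixing v \<inter> ?A)"
      using fin2 by (intro card_Diff_subset_Int) auto
    also have "fixing v \<times> fixing v \<inter> ?A = (fixing v \<inter> fixing v0) \<times> (fixing v \<inter> fixing v0)" by auto
    finally show ?thesis
      using card_fixing[of v] card_fixing_Int[of v v0] that v0 dim by (simp add: card_cartesian_product)
  qed
  then have "(\<Sum>v\<in>V - {0, v0}. card (?D v)) = card (V - {0, v0}) * 15360" by simp
  moreover have "card (V - {0, v0}) = 6"
  proof -
    have "card (V - {0, v0}) = card V - card {0, v0}" using v0 VD(1) finite_set by (intro card_Diff_subset) auto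
    then show ?thesis using v0 card_V dim by simp
  qed
  moreover have "line_pairs \<subseteq> ?A \<union> (\<Union>v\<in>V - {0, v0}. ?D v)" by (auto simp: line_pairs_def)
  then have "card line_pairs \<le> card (?A \<union> (\<Union>v\<in>V - {0, v0}. ?D v))" using fin2 by (intro card_mono)
  moreover have "card (?A \<union> (\<Union>v\<in>V - {0, v0}. ?D v)) \<le> card ?A + card (\<Union>v\<in>V - {0, v0}. ?D v)"
    by (rule card_Un_le)
  moreover have "card (\<Union>v\<in>V - {0, v0}. ?D v) \<le> (\<Sum>v\<in>V - {0, v0}. card (?D v))"
    using finite_set by (intro card_UN_le) auto
  moreover have "card ?A = 16384" using card_fixing[OF v0] dim by (simp add: card_cartesian_product)
  ultimately show ?thesis by linarith
qed

lemma density_bad_dim_3_Q_2: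
  assumes dim: "dim = 3"
  shows "density bad_pairs < 5 / 8"
proof -
  have fin2: "finite (X :: ('a \<times> 'a) set)" for X
    by (rule finite_subset[OF _ finite_cartesian_product[OF fin fin]]) simp
  let ?P = "\<Union>W\<in>subspaces 2. stabilizer W \<times> stabilizer W - line_pairs"
  let ?C = "\<Union>R\<in>fields_of_degree 3. centralizer R \<times> centralizer R"
  have set01: "{..<2::nat} = {0, 1}" "{..<3::nat} = {0, 1, 2}" "{..<1::nat} = {0}" by auto
  have c7: "card (subspaces 2) = 7"
  proof -
    have "card (subspaces 2) * (\<Prod>i\<in>{0, 1}. 2 ^ 2 - 2 ^ i) = (\<Prod>i\<in>{0, 1}. 2 ^ 3 - 2 ^ i)"
      using card_subspaces[of 2] dim set01 by (simp only:)
    then show ?thesis by simp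
  qed
  have "card ?P \<le> (\<Sum>W\<in>subspaces 2. card (stabilizer W \<times> stabilizer W - line_pairs))"
    by (rule card_UN_le[OF finite_set_set])
  also have "\<dots> \<le> (\<Sum>W\<in>subspaces 2. 7168)" by (intro sum_mono card_plane_pairs[OF dim])
  finally have cP: "card ?P \<le> 50176" using c7 by simp
  have "card (fields_of_degree 3) * ((2 ^ 3 - 2) * (\<Prod>i\<in>{0}. 2 ^ 3 - (2 ^ 3) ^ i)) \<le>
    2 ^ 3 * (\<Prod>i\<in>{0, 1, 2}. 2 ^ 3 - 2 ^ i)"
    using card_fields_of_degree[of 3 1] dim set01 by simp
  then have c32: "card (fields_of_degree 3) \<le> 32" by simp
  have "card ?C \<le> (\<Sum>R\<in>fields_of_degree 3. card (centralizer R \<times> centralizer R))"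
    by (rule card_UN_le[OF finite_set_set])
  also have "\<dots> \<le> (\<Sum>R\<in>fields_of_degree 3. 64)"
  proof (rule sum_mono)
    fix R assume "R \<in> fields_of_degree 3"
    then have "card (centralizer R) \<le> 8" using card_centralizer_le[of R 3 1] dim by simp
    from mult_le_mono[OF this this] show "card (centralizer R \<times> centralizer R) \<le> 64"
      by (simp add: card_cartesian_product)
  qed
  finally have cC: "card ?C \<le> 2048" using c32 by simp
  have "{1..<dim} = {1, 2}" using dim by auto
  then have red: "reducible_pairs \<subseteq> line_pairs \<union> ?P" by (auto simp: reducible_pairs_def line_pairs_eq)
  have cen: "centralizing_pairs = ?C"
  proof -
    have "d = 3" if "d dvd 3" "2 \<le> d" for d :: nat
    proof -
      have "d \<le> 3" using that by (auto dest: dvd_imp_le)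
      then have "d = 2 \<or> d = 3" using that by auto
      then show ?thesis using that by auto
    qed
    then have "{d. d dvd dim \<and> 2 \<le> d} = {3}" using dim by auto
    then show ?thesis by (simp add: centralizing_pairs_def)
  qed
  have "bad_pairs \<subseteq> reducible_pairs \<union> centralizing_pairs" using bad_pairs_subset form_pairs_empty by simp
  also have "\<dots> \<subseteq> (line_pairs \<union> ?P) \<union> ?C" using red unfolding cen by (rule Un_mono) simp
  finally have "bad_pairs \<subseteq> line_pairs \<union> ?P \<union> ?C" .
  then have "card bad_pairs \<le> card (line_pairs \<union> ?P \<union> ?C)" using fin2 by (intro card_mono)
  also have "\<dots> \<le> card line_pairs + card ?P + card ?C"
    using card_Un_le[of "line_pairs \<union> ?P" ?C] card_Un_le[of line_pairs ?P] by linarith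
  also have "\<dots> \<le> 160768" using card_line_pairs_dim_3[OF dim] cP cC by linarith
  finally have "real (card bad_pairs) \<le> 160768" by simp
  then show ?thesis using dim by (simp add: density_def)
qed

section \<open>The exact count in dimension two\<close>

lemma unital_stabilizer:
  assumes "lsubspace 1 centre W"
  shows "unital_subring (stabilizer W)"
  using lsubspaceD(2,3)[OF assms] by (auto simp: unital_subring_def stabilizer_def distrib_right mult.assoc)

text \<open>Inclusion-exclusion over the three lines gives 3 * 64 - 3 * 16 + 4 = 148. The only
  further maximal source of bad pairs is the field \<open>R\<close> of order 4, with 16 pairs, of
  which the 4 with entries in {0, 1} are already counted.\<close>

lemma card_bad_dim_2:
  assumes dim: "dim = 2"
  shows "card bad_pairs = 160"
proof -
  have fin2: "finite (X :: ('a \<times> 'a) set)" for X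
    by (rule finite_subset[OF _ finite_cartesian_product[OF fin fin]]) simp
  obtain vs where vs: "set vs \<subseteq> V" "lindep centre vs" "lspan centre vs = V" "length vs = dim"
    by (rule obtain_basis)
  obtain a b where ab: "vs = [a, b]" using vs(4) dim by (auto simp: length_Suc_conv numeral_2_eq_2)
  have Veq: "V = {0, a, b, a + b}" using vs(3) unfolding ab lspan_2 by simp
  have ne: "a \<noteq> 0" "b \<noteq> 0" "a \<noteq> b" using vs(2) unfolding ab lindep_2 by blast+
  have nab: "a + b \<noteq> 0" "a \<noteq> a + b" "b \<noteq> a + b"
    using ne add_cancel[of a b] by (metis add_0_right, auto)
  have inV: "a \<in> V" "b \<in> V" "a + b \<in> V" by (auto simp: Veq)
  have eqI: "x = y" if "x * a = y * a" "x * b = y * b" for x y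
    by (rule determined_by_basis[OF _ _ _ vs(3)]) (use that ab centre_eq in auto)
  define A where "A = fixing a"
  define B where "B = fixing b"
  define C where "C = fixing (a + b)"
  have card8: "card A = 8" "card B = 8" "card C = 8"
    using card_fixing inV ne nab dim by (auto simp: A_def B_def C_def)
  have card4: "card (A \<inter> B) = 4" "card (A \<inter> C) = 4" "card (B \<inter> C) = 4"
    using card_fixing_Int[OF inV(1,2) ne] card_fixing_Int[OF inV(1,3) ne(1) nab(1,2)]
      card_fixing_Int[OF inV(2,3) ne(2) nab(1,3)] dim
    by (auto simp: A_def B_def C_def)
  \<comment> \<open>An element with eigenvectors \<open>a\<close>, \<open>b\<close> and
    \<open>a + b\<close> has the same eigenvalue on all of them, hence is 0 or 1.\<close>
  have triple: "A \<inter> B \<inter> C = {0, 1}"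
  proof (intro equalityI subsetI)
    fix x assume "x \<in> A \<inter> B \<inter> C"
    then have "x * a \<in> {0, a}" "x * b \<in> {0, b}" "x * a + x * b \<in> {0, a + b}"
      by (auto simp: A_def B_def C_def fixing_def distrib_left)
    then have "x * a = 0 \<and> x * b = 0 \<or> x * a = a \<and> x * b = b" using ne nab by auto
    then show "x \<in> {0, 1}" using eqI[of x 0] eqI[of x 1] by auto
  qed (auto simp: A_def B_def C_def fixing_def)
  have lines: "line_pairs = A \<times> A \<union> B \<times> B \<union> C \<times> C"
  proof -
    have "V - {0} = {a, b, a + b}" using Veq ne nab by auto
    then show ?thesis by (auto simp: line_pairs_def A_def B_def C_def)
  qed
  have c148: "card line_pairs = 148"
  proof -
    let ?A = "A \<times> A" and ?B = "B \<times> B" and ?C = "C \<times> C"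
    have "card ?A + card ?B = card (?A \<union> ?B) + card (?A \<inter> ?B)" using fin2 by (intro card_Un_Int)
    moreover have "card (?A \<union> ?B) + card ?C = card (?A \<union> ?B \<union> ?C) + card ((?A \<union> ?B) \<inter> ?C)"
      using fin2 by (intro card_Un_Int)
    moreover have "(?A \<union> ?B) \<inter> ?C = ?A \<inter> ?C \<union> ?B \<inter> ?C" by blast
    moreover have "card (?A \<inter> ?C) + card (?B \<inter> ?C) = card (?A \<inter> ?C \<union> ?B \<inter> ?C) + card ((?A \<inter> ?C) \<inter> (?B \<inter> ?C))"
      using fin2 by (intro card_Un_Int)
    moreover have "A \<inter> C \<inter> (B \<inter> C) = {0, 1}" using triple by blast
    ultimately show ?thesis unfolding lines
      using card8 card4 triple by (simp add: card_cartesian_product Times_Int_Times)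
  qed
  \<comment> \<open>\<open>g\<close> permutes the three nonzero vectors cyclically; from g^2 = g + 1
    it generates a field of order 4.\<close>
  obtain g where g: "g * a = b" "g * b = a + b"
  proof -
    have wsV: "set [b, a + b] \<subseteq> V" and len: "length [b, a + b] = length vs" using inV ab by auto
    obtain T where T: "\<And>x y. x \<in> V \<Longrightarrow> y \<in> V \<Longrightarrow> T (x + y) = T x + T y"
      "\<And>c x. c \<in> centre \<Longrightarrow> x \<in> V \<Longrightarrow> T (c * x) = c * T x" "\<And>x. x \<in> V \<Longrightarrow> T x \<in> V"
      "map T vs = [b, a + b]"
    proof (rule ex_endomorphism[OF vs(1-3) wsV len], goal_cases)
      case (1 T)
      from 1(1)[OF 1(2-5)] show ?case .
    qed
    obtain r where "\<forall>v\<in>V. T v = r * v" using End[of T] T(1-3) by blast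
    then show ?thesis using that[of r] T(4) ab inV by auto
  qed
  define R where "R = {0, 1, g, g + 1}"
  have gg: "g * g = g + 1" by (rule eqI) (use g in \<open>simp_all add: mult.assoc distrib_left distrib_right add_ac\<close>)
  have Rring: "unital_subring R"
    unfolding unital_subring_def R_def
    by (auto simp: distrib_left distrib_right gg add_ac)
  have gout: "x \<notin> A \<union> B \<union> C" if "x \<in> {g, g + 1}" for x
  proof -
    have "g * a \<notin> {0, a}" "g * b \<notin> {0, b}" "g * (a + b) \<notin> {0, a + b}"
      using g ne nab by (auto simp: distrib_left)
    moreover have "(g + 1) * v \<in> {0, v} \<longleftrightarrow> g * v \<in> {0, v}" for v
      using add_eq_0_iff_eq[of v "g * v"] by (auto simp: distrib_right add.commute)
    ultimately show ?thesis using that by (auto simp: A_def B_def C_def fixing_def)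
  qed
  have gne: "g \<noteq> 0" "g \<noteq> 1" using g ne by auto
  have cR: "card R = 4"
  proof -
    have "g + 1 \<noteq> 0" "g + 1 \<noteq> 1" "g + 1 \<noteq> g" using gne add_eq_0_iff_eq[of g 1] by auto
    then show ?thesis using gne by (auto simp: R_def card_insert_if)
  qed
  have int: "line_pairs \<inter> R \<times> R = {0, 1} \<times> {0, 1}"
  proof -
    have "x \<in> {0, 1}" if "x \<in> R" "x \<in> A \<union> B \<union> C" for x using gout[of x] that by (auto simp: R_def)
    moreover have "{0, 1} \<subseteq> A" by (auto simp: A_def fixing_def)
    ultimately show ?thesis unfolding lines by (auto simp: R_def)
  qed
  have "card line_pairs + card (R \<times> R) = card (line_pairs \<union> R \<times> R) + card (line_pairs \<inter> R \<times> R)"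
    using fin2 by (intro card_Un_Int)
  then have c160: "card (line_pairs \<union> R \<times> R) = 160"
    using c148 cR unfolding int by (simp add: card_cartesian_product)
  have "bad_pairs = line_pairs \<union> R \<times> R"
  proof (intro equalityI)
    have "{1..<dim} = {1}" using dim by auto
    then have "reducible_pairs = line_pairs" by (simp add: reducible_pairs_def line_pairs_eq)
    moreover have "centralizer S \<subseteq> R" if S: "S \<in> fields_of_degree d" "2 \<le> d" "d dvd dim" for S d
    proof -
      have "d = 2" using S dim by (auto dest: dvd_imp_le)
      have Sd: "div_subring 1 S" "centre \<subset> S" "card S = 4"
        using S \<open>d = 2\<close> by (auto simp: fields_of_degree_def minimal_fields_def)
      obtain c where c: "c \<in> S" "c \<notin> {0, 1}" using Sd(2) centre_eq by blast
      have noeig: "c * v \<notin> {0, v}" if v: "v \<noteq> 0" for v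
      proof
        assume "c * v \<in> {0, v}"
        then have "c * v = 0 \<or> (c - 1) * v = 0" by (auto simp: distrib_right)
        moreover have zero: "v = 0" if k: "k \<in> S" "k \<noteq> 0" "k * v = 0" for k
        proof -
          obtain y where "y * k = 1" using div_subring_inv[OF Sd(1) k(1,2)] by metis
          then have "v = y * (k * v)" by (simp flip: mult.assoc)
          then show ?thesis using k by simp
        qed
        moreover have "c - 1 \<in> S" using div_subringD(1,4)[OF Sd(1)] c by blast
        moreover have "c - 1 \<noteq> 0" "c \<noteq> 0" using c add_eq_0_iff_eq[of c 1] by auto
        ultimately show False using c v by blast
      qed
      \<comment> \<open>Without an eigenvector \<open>c\<close> must move every nonzero vector to
        another one, and the only such maps are the two 3-cycles \<open>g\<close> and
        \<open>g + 1\<close>. So every field of order 4 is \<open>R\<close>.\<close>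
      have "c * a \<in> {b, a + b}" "c * b \<in> {a, a + b}" "c * a + c * b \<in> {a, b}"
        using noeig[OF ne(1)] noeig[OF ne(2)] noeig[OF nab(1)] V_closed[OF inV(1), of c]
          V_closed[OF inV(2), of c] V_closed[OF inV(3), of c]
        by (auto simp: Veq distrib_left)
      then have "c * a = b \<and> c * b = a + b \<or> c * a = a + b \<and> c * b = a"
        using ne nab by (auto simp: add_ac)
      then have "c = g \<or> c = g + 1"
        using eqI[of c g] eqI[of c "g + 1"] g by (auto simp: distrib_right add_ac)
      then have RS: "R \<subseteq> S"
      proof
        have one: "1 \<in> S" "0 \<in> S" using div_subringD[OF Sd(1)] by auto
        show ?thesis if "c = g" using that c one div_subringD(5)[OF Sd(1)] by (auto simp: R_def)
        show ?thesis if "c = g + 1"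
        proof -
          have "c + 1 \<in> S" using c one div_subringD(5)[OF Sd(1)] by blast
          moreover have "g + 1 + 1 = g" unfolding add.assoc by (subst double) simp
          then have "c + 1 = g" using that by metis
          ultimately have "g \<in> S" by metis
          then show ?thesis using c one that by (auto simp: R_def)
        qed
      qed
      have "R = S" using RS cR Sd(3) finite_set by (intro card_seteq) auto
      \<comment> \<open>The field is commutative, so it lies in its own centralizer, and the bound
        on orders makes them equal.\<close>
      have "card (centralizer S) \<le> 4" using card_centralizer_le[of S 2 1] S \<open>d = 2\<close> dim by simp
      moreover have "S \<subseteq> centralizer S"
        using wedderburn_little[OF finite_set Sd(1)] by (auto simp: centralizer_def)
      ultimately have "S = centralizer S" using Sd(3) finite_set by (intro card_seteq) auto
      then show ?thesis using \<open>R = S\<close> by simp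
    qed
    then have "centralizing_pairs \<subseteq> R \<times> R" unfolding centralizing_pairs_def by blast
    ultimately show "bad_pairs \<subseteq> line_pairs \<union> R \<times> R" using bad_pairs_subset form_pairs_empty by auto
  next
    have cU: "card (UNIV :: 'a set) = 16" using card_ring dim by simp
    have "fixing v \<times> fixing v \<subseteq> bad_pairs" if "v \<in> V - {0}" for v
    proof -
      have "{0, v} \<in> subspaces 1" using that unfolding subspaces_1 by blast
      then have "unital_subring (fixing v)"
        using unital_stabilizer[of "{0, v}"] by (simp add: stabilizer_line subspaces_def)
      moreover have "fixing v \<noteq> UNIV" using card_fixing[of v] that dim cU by auto
      ultimately show ?thesis unfolding bad_pairs_def by blast
    qed
    then have "line_pairs \<subseteq> bad_pairs" by (auto simp: line_pairs_def)
    moreover have "R \<noteq> UNIV" using cR cU by auto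
    then have "R \<times> R \<subseteq> bad_pairs" using Rring unfolding bad_pairs_def by blast
    ultimately show "line_pairs \<union> R \<times> R \<subseteq> bad_pairs" by blast
  qed
  then show ?thesis using c160 by simp
qed

end

context simple_ring_module
begin

theorem density_bad_pairs:
  "density bad_pairs \<le> 5 / 8" "density bad_pairs = 5 / 8 \<longleftrightarrow> Q = 2 \<and> dim = 2"
proof -
  have two: "simple_ring_module_2 V" if "Q = 2"
    using simple_ring_module_axioms that by (simp add: simple_ring_module_2_def)
  have eq: "density bad_pairs = 5 / 8" if "Q = 2" "dim = 2"
  proof -
    have "card bad_pairs = 160" using simple_ring_module_2.card_bad_dim_2[OF two] that by simp
    then show ?thesis unfolding density_def that(2) by (simp add: \<open>Q = 2\<close>)
  qed
  have less: "density bad_pairs < 5 / 8" if n: "\<not> (Q = 2 \<and> dim = 2)"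
  proof -
    consider "dim = 1" | "dim = 2" | "dim = 3" | "dim = 4" | "5 \<le> dim" using dim_pos by linarith
    then show ?thesis
    proof cases
      case 1 then show ?thesis using density_bad_dim_1 by simp
    next
      case 2 then show ?thesis using density_bad_dim_2 n Q_ge_2 by simp
    next
      case 3
      show ?thesis
      proof (cases "Q = 2")
        case True
        then show ?thesis using simple_ring_module_2.density_bad_dim_3_Q_2[OF two] 3 by simp
      next
        case False then show ?thesis using density_bad_dim_3 3 Q_ge_2 by simp
      qed
    next
      case 4
      then show ?thesis using density_bad_dim_4_Q_2 density_bad_large Q_ge_2 by (cases "Q = 2") simp_all
    next
      case 5 then show ?thesis using density_bad_large by simp
    qed
  qed
  show "density bad_pairs \<le> 5 / 8" "density bad_pairs = 5 / 8 \<longleftrightarrow> Q = 2 \<and> dim = 2"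
    using eq less by fastforce+
qed

end

section \<open>The generation probability\<close>

context finite_simple_algebra
begin

lemma finite_span: "finite B \<Longrightarrow> finite (span B)"
proof (induction B rule: finite_induct)
  case (insert b B)
  have "span (insert b B) \<subseteq> (\<lambda>(k, y). y + scale k b) ` (UNIV \<times> span B)"
  proof
    fix x assume "x \<in> span (insert b B)"
    then obtain k where "x - scale k b \<in> span B" by (auto simp: span_insert)
    then show "x \<in> (\<lambda>(k, y). y + scale k b) ` (UNIV \<times> span B)"
      by (intro image_eqI[of _ _ "(k, x - scale k b)"]) auto
  qed
  then show ?case using insert.IH by (auto intro: finite_subset)
qed simp

lemma finite_UNIV_algebra: "finite (UNIV :: 'a set)"
  using finite_dimensional finite_span by metis

lemma simple_subring_UNIV: "simple_subring (UNIV :: 'a set)"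
  using simple by (auto simp: simple_subring_def unital_subring_def ideal_of_def two_sided_ideal_def)

lemma scale_eq: "scale c x = scale c 1 * x"
  by (simp add: scale_mult_left)

lemma scale_1_central: "scale c 1 \<in> centre"
  by (simp add: centre_of_def scale_mult_left scale_mult_right)

lemma inj_scale_1: "inj (\<lambda>c. scale c (1 :: 'a))"
  by (rule injI) (simp add: scale_right_imp_eq)

lemma subalgebra_generated: "subalgebra (generated_subalgebra X)"
  unfolding generated_subalgebra_def
  by (rule hull_in) (auto simp: subalgebra_def intro: subspace_Inter)

lemma generated_eq_UNIV_iff:
  "generated_subalgebra X = UNIV \<longleftrightarrow> (\<forall>S. subalgebra S \<longrightarrow> X \<subseteq> S \<longrightarrow> S = UNIV)"
  using subalgebra_generated[of X] hull_subset[of X subalgebra] hull_minimal[of X _ subalgebra]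
  unfolding generated_subalgebra_def by blast

lemma subalgebra_unital: "subalgebra S \<Longrightarrow> unital_subring S"
  by (auto simp: subalgebra_def unital_subring_def intro: subspace_diff)

lemma ex_module: "\<exists>V :: 'a set. simple_ring_module V (card (centre :: 'a set))"
proof (rule simple_subring_structure[OF simple_subring_UNIV finite_UNIV_algebra], goal_cases)
  case (1 L)
  have "simple_ring_module L (card (centre :: 'a set))"
    by unfold_locales (use 1 simple_subring_UNIV finite_UNIV_algebra in auto)
  then show ?case by blast
qed

text \<open>\<open>p\<close> and \<open>r\<close> are the coordinates with respect to the basis
  \<open>a\<close>, \<open>b\<close> of \<open>V\<close>, and the isomorphism sends \<open>x\<close>
  to the matrix of left multiplication by \<open>x\<close>. Since V = {0, a, b, a + b}, additivity
  of the coordinates is a finite check.\<close>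

lemma matrix_isomorphism:
  assumes M: "simple_ring_module (V :: 'a set) 2" and dim: "simple_ring_module.dim V 2 = 2"
  shows "CARD('k) = 2" "isomorphic_to_matrix_algebra TYPE(2)"
proof -
  interpret M: simple_ring_module_2 V using M by (simp add: simple_ring_module_2_def)
  \<comment> \<open>The scalars embed in the centre, which has two elements, so \<open>k\<close> is
    the two-element field.\<close>
  have "card ((\<lambda>c. scale c (1 :: 'a)) ` UNIV) \<le> card (centre :: 'a set)"
    using scale_1_central by (intro card_mono M.finite_set) auto
  then have "CARD('k) \<le> 2" using inj_scale_1 by (simp add: card_image)
  moreover have "card {0, 1 :: 'k} \<le> CARD('k)" by (rule card_mono) auto
  ultimately show k2: "CARD('k) = 2" by simp
  have "{0, 1 :: 'k} = UNIV" using k2 by (intro card_seteq) auto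
  then have k01: "c = 0 \<or> c = 1" for c :: 'k by blast
  have kk: "(1 :: 'k) + 1 = 0" using k01[of "1 + 1"] by (metis add_cancel_right_right zero_neq_one)
  obtain vs where vs: "set vs \<subseteq> V" "lindep centre vs" "lspan centre vs = V" "length vs = M.dim"
    by (rule M.obtain_basis)
  obtain a b where ab: "vs = [a, b]" using vs(4) dim by (auto simp: length_Suc_conv numeral_2_eq_2)
  have Veq: "V = {0, a, b, a + b}" using vs(3) unfolding ab M.lspan_2 by simp
  have ne: "a \<noteq> 0" "b \<noteq> 0" "a \<noteq> b" using vs(2) unfolding ab M.lindep_2 by blast+
  have nab: "a + b \<noteq> 0" "a \<noteq> a + b" "b \<noteq> a + b"
    using ne M.add_cancel[of a b] by (metis add_0_right, auto)
  have inV: "a \<in> V" "b \<in> V" by (auto simp: Veq)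
  define p :: "'a \<Rightarrow> 'k" where "p v = (if v = a \<or> v = a + b then 1 else 0)" for v
  define r :: "'a \<Rightarrow> 'k" where "r v = (if v = b \<or> v = a + b then 1 else 0)" for v
  have p: "p 0 = 0" "p a = 1" "p b = 0" "p (a + b) = 1" using ne nab by (auto simp: p_def)
  have r: "r 0 = 0" "r a = 0" "r b = 1" "r (a + b) = 1" using ne nab by (auto simp: r_def)
  have decomp: "v = scale (p v) a + scale (r v) b" if "v \<in> V" for v
    using that p r by (auto simp: Veq)
  have add: "p (v + w) = p v + p w" "r (v + w) = r v + r w" if "v \<in> V" "w \<in> V" for v w
  proof -
    have eqs: "a + (a + b) = b" "b + (a + b) = a" "a + b + a = b" "a + b + b = a" "b + a = a + b"
      using M.add_cancel[of a b] M.add_cancel[of b a] by (simp_all add: add_ac)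
    show "p (v + w) = p v + p w" "r (v + w) = r v + r w"
      using that p r kk unfolding Veq by (auto simp: eqs)
  qed
  have scl: "p (scale c v) = c * p v" "r (scale c v) = c * r v" for c v
    using k01[of c] p r by auto
  define e :: "2 \<Rightarrow> 'a" where "e j = (if j = 1 then a else b)" for j
  define co :: "2 \<Rightarrow> 'a \<Rightarrow> 'k" where "co i = (if i = 1 then p else r)" for i
  have eV: "e j \<in> V" for j using inV by (simp add: e_def)
  have co_add: "co i (v + w) = co i v + co i w" if "v \<in> V" "w \<in> V" for i v w
    using add that by (simp add: co_def)
  have co_scale: "co i (scale c v) = c * co i v" for i c v using scl by (simp add: co_def)
  define f :: "'a \<Rightarrow> 'k ^ 2 ^ 2" where "f x = (\<chi> i j. co i (x * e j))" for x
  have xV: "x * v \<in> V" if "v \<in> V" for x v using M.V_closed that .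
  have f_add: "f (x + y) = f x + f y" for x y
    using co_add xV eV by (simp add: f_def vec_eq_iff distrib_right)
  have f_scale: "f (scale c x) = (\<chi> i j. c * f x $ i $ j)" for c x
    using co_scale by (simp add: f_def scale_mult_left)
  have f_one: "f 1 = mat 1"
    using p r by (simp add: f_def mat_def vec_eq_iff forall_2 co_def e_def)
  have f_mult: "f (x * y) = f x ** f y" for x y
  proof -
    have "co i (x * y * e j) = co i (x * e 1) * co 1 (y * e j) + co i (x * e 2) * co 2 (y * e j)" for i j
    proof -
      let ?v = "y * e j"
      have "x * y * e j = x * (scale (p ?v) a + scale (r ?v) b)"
        using decomp[OF xV[OF eV], of y j] by (simp add: mult.assoc)
      also have "\<dots> = scale (p ?v) (x * a) + scale (r ?v) (x * b)"
        by (simp add: distrib_left scale_mult_right)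
      also have "co i \<dots> = p ?v * co i (x * a) + r ?v * co i (x * b)"
      proof -
        have "scale c v \<in> V" if "v \<in> V" for c v using k01[of c] that by (auto simp: Veq)
        then show ?thesis using co_add co_scale xV inV by simp
      qed
      finally show ?thesis by (simp add: co_def e_def mult.commute)
    qed
    then show ?thesis by (simp add: f_def vec_eq_iff matrix_matrix_mult_def sum_2)
  qed
  have "inj f"
  proof (rule injI)
    fix x y assume "f x = f y"
    then have c: "co i (x * e j) = co i (y * e j)" for i j by (auto simp: f_def vec_eq_iff)
    have co: "p (x * e j) = p (y * e j)" "r (x * e j) = r (y * e j)" for j
      using c[of 1 j] c[of 2 j] by (simp_all add: co_def)
    have "x * e j = y * e j" for j
      using decomp[OF xV[OF eV], of x j] decomp[OF xV[OF eV], of y j] co[of j] by simp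
    from this[of 1] this[of 2] have "x * a = y * a" "x * b = y * b" by (simp_all add: e_def)
    then have "x * v = y * v" if "v \<in> set vs" for v using that unfolding ab by auto
    then show "x = y" using M.determined_by_basis[OF _ _ _ vs(3)] centre_commute by metis
  qed
  moreover have "range f = UNIV"
  \<comment> \<open>Both sides have 16 elements, so injectivity gives surjectivity.\<close>
  proof (rule card_seteq)
    have "CARD('k ^ 2 ^ 2) = card (range f)"
      unfolding card_image[OF \<open>inj f\<close>] using M.card_ring k2 dim by simp
    then show "CARD('k ^ 2 ^ 2) \<le> card (range f)" by (rule eq_refl)
  qed auto
  ultimately have "bij f" by (simp add: bij_def)
  moreover have "Vector_Spaces.linear scale (\<lambda>c M. \<chi> i j. c * M $ i $ j) f"
  proof -
    have "vector_space (\<lambda>(c :: 'k) (M :: 'k ^ 2 ^ 2). \<chi> i j. c * M $ i $ j)"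
      by unfold_locales (auto simp: vec_eq_iff algebra_simps)
    then show ?thesis
      using vector_space_axioms f_add f_scale by (simp add: Vector_Spaces.linear_iff)
  qed
  ultimately show "isomorphic_to_matrix_algebra TYPE(2)"
    unfolding isomorphic_to_matrix_algebra_def using f_one f_mult by blast
qed

text \<open>The order 16 = Q^(dim^2) leaves only Q = 16, dim = 1 and Q = 2, dim = 2; the first would
  make the ring commutative.\<close>

lemma matrix_algebra_parameters:
  assumes "CARD('k) = 2" "isomorphic_to_matrix_algebra TYPE(2)"
    and M: "simple_ring_module (V :: 'a set) Q"
  shows "Q = 2" "simple_ring_module.dim V Q = 2"
proof -
  interpret M: simple_ring_module V Q by fact
  obtain f :: "'a \<Rightarrow> 'k ^ 2 ^ 2" where f: "bij f" "\<And>x y. f (x * y) = f x ** f y"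
    using assms(2) unfolding isomorphic_to_matrix_algebra_def by blast
  have "CARD('a) = CARD('k ^ 2 ^ 2)" using f(1) by (rule bij_betw_same_card)
  then have c: "Q ^ (M.dim * M.dim) = 16" using M.card_ring assms(1) by simp
  have "M.dim \<noteq> 1"
  proof
    assume "M.dim = 1"
    then have "(centre :: 'a set) = UNIV" using M.card_ring M.fin by (intro card_subset_eq) auto
    then have comm: "x * y = y * x" for x y :: 'a using centre_commute[of x y] by blast
    \<comment> \<open>Two matrix units that do not commute refute dimension 1.\<close>
    define E :: "2 \<Rightarrow> 2 \<Rightarrow> 'k ^ 2 ^ 2" where "E k l = (\<chi> i j. if i = k \<and> j = l then 1 else 0)" for k l
    obtain x y where "f x = E 1 2" "f y = E 2 1" using f(1) by (metis bij_pointE)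
    then have "E 1 2 ** E 2 1 = E 2 1 ** E 1 2" using f(2) comm by metis
    then have "(E 1 2 ** E 2 1) $ 1 $ 1 = (E 2 1 ** E 1 2) $ 1 $ 1" by simp
    then show False by (simp add: E_def matrix_matrix_mult_def sum_2)
  qed
  then have d2: "2 \<le> M.dim" using M.dim_pos by simp
  have "M.dim = 2"
  proof (rule ccontr)
    assume "M.dim \<noteq> 2"
    then have "3 * 3 \<le> M.dim * M.dim" using d2 by (intro mult_le_mono) auto
    then have "(2::nat) ^ 9 \<le> 2 ^ (M.dim * M.dim)" by (intro power_increasing) auto
    also have "\<dots> \<le> Q ^ (M.dim * M.dim)" using M.Q_ge_2 by (intro power_mono) auto
    finally show False using c by simp
  qed
  moreover have "Q = 2"
  proof (rule ccontr)
    assume "Q \<noteq> 2"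
    then have "3 ^ 4 \<le> Q ^ 4" using M.Q_ge_2 by (intro power_mono) auto
    then show False using c \<open>M.dim = 2\<close> by simp
  qed
  ultimately show "Q = 2" "M.dim = 2" by simp_all
qed

end

theorem theorem1p3:
  fixes scale :: "'k::{field, finite} \<Rightarrow> 'a::ring_1 \<Rightarrow> 'a"
  assumes "finite_simple_algebra scale"
  shows "assoc_algebra.generation_probability scale \<ge> 3 / 8 \<and>
    (assoc_algebra.generation_probability scale = 3 / 8 \<longleftrightarrow>
       CARD('k) = 2 \<and> assoc_algebra.isomorphic_to_matrix_algebra scale TYPE(2))"
proof -
  interpret finite_simple_algebra scale by fact
  define Q where "Q = card (centre :: 'a set)"
  obtain V :: "'a set" where V: "simple_ring_module V Q" using ex_module Q_def by blast
  interpret M: simple_ring_module V Q by fact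
  let ?G = "{(x, y). generated_subalgebra {x, y} = UNIV}" and ?N = "real Q ^ (2 * M.dim * M.dim)"
  have N: "real CARD('a) ^ 2 = ?N"
    unfolding M.card_ring mult.assoc by (simp only: of_nat_power power_even_eq)
  have N0: "?N > 0" using M.q_ge by simp
  have fin2: "finite (X :: ('a \<times> 'a) set)" for X
    by (rule finite_subset[OF _ finite_cartesian_product[OF M.fin M.fin]]) simp
  have "card ?G + card (- ?G) = card (?G \<union> - ?G)" using fin2 by (subst card_Un_disjoint) auto
  also have "?G \<union> - ?G = UNIV \<times> UNIV" by blast
  also have "card (UNIV \<times> UNIV :: ('a \<times> 'a) set) = CARD('a) ^ 2"
    by (simp only: card_cartesian_product power2_eq_square)
  finally have "real (card ?G + card (- ?G)) = real (CARD('a) ^ 2)" by (rule arg_cong)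
  then have "real (card ?G) + real (card (- ?G)) = ?N" unfolding of_nat_add of_nat_power N .
  then have P: "generation_probability = 1 - M.density (- ?G)"
    using N0 unfolding generation_probability_def N M.density_def by (simp add: field_simps)
  \<comment> \<open>A pair that does not generate lies in a proper subalgebra, which is in
    particular a proper subring.\<close>
  have "- ?G \<subseteq> M.bad_pairs"
    using subalgebra_unital by (auto simp: M.bad_pairs_def generated_eq_UNIV_iff)
  then have le: "M.density (- ?G) \<le> M.density M.bad_pairs" by (rule M.density_mono)
  \<comment> \<open>With centre {0, 1} every scalar acts as 0 or 1, so subrings are subalgebras and
    the inclusion becomes an equality.\<close>
  have "- ?G = M.bad_pairs" if "Q = 2"
  proof
    show "- ?G \<subseteq> M.bad_pairs" by fact
    show "M.bad_pairs \<subseteq> - ?G"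
    proof (clarsimp simp: M.bad_pairs_def generated_eq_UNIV_iff)
      fix x y B assume B: "unital_subring B" "x \<in> B" "y \<in> B" "B \<noteq> UNIV"
        and all: "\<forall>S. subalgebra S \<longrightarrow> x \<in> S \<and> y \<in> S \<longrightarrow> S = UNIV"
      note d = unital_subringD[OF B(1)]
      have "simple_ring_module_2 V" using V that by (simp add: simple_ring_module_2_def)
      note Z = simple_ring_module_2.centre_eq[OF this]
      have sB: "scale c 1 \<in> B" for c
      proof -
        have "scale c 1 = 0 \<or> scale c 1 = 1" using scale_1_central[of c] unfolding Z by blast
        then show ?thesis using d(1,2) by (elim disjE) (simp_all only:)
      qed
      have "scale c z \<in> B" if "z \<in> B" for c z
        by (subst scale_eq) (rule d(6)[OF sB that])
      then have "subalgebra B" using d(1,2,4,6) by (simp add: subalgebra_def subspace_def)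
      then show False using all B by blast
    qed
  qed
  \<comment> \<open>If the smaller density reaches 5/8, so does that of \<open>M.bad_pairs\<close>,
    which forces Q = 2 and dimension 2; conversely these values make the two sets equal.\<close>
  then have eq: "M.density (- ?G) = 5 / 8 \<longleftrightarrow> Q = 2 \<and> M.dim = 2"
    using M.density_bad_pairs le by fastforce
  moreover have "Q = 2 \<and> M.dim = 2 \<longleftrightarrow> CARD('k) = 2 \<and> isomorphic_to_matrix_algebra TYPE(2)"
    using matrix_isomorphism[of V] matrix_algebra_parameters[OF _ _ V] V by blast
  moreover have "M.density (- ?G) \<le> 5 / 8" using le M.density_bad_pairs(1) by linarith
  ultimately show ?thesis unfolding P by auto
qed

end
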